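(* For any $\epsilon>0$ and $M>1$ there are $\eta>0$ and $\delta>0$ such that, whenever $\hbar\in\mathbb{R}\setminus\{0\}$ satisfies $|\hbar|<\delta$: (i) $s\mathrm{Sp}_M^{\eta}((S_1,S_\hbar))\neq\emptyset$; (ii) for any $\lambda=(\lambda_1,\lambda_2)\in s\mathrm{Sp}_M^{\eta}((S_1,S_\hbar))$ there exists a unit vector $v\in L^2(\mathbb{R})$ such that $$\|S_1v-\lambda_1v\|_2<\epsilon\quad\text{and}\quad\|S_\hbar v-\lambda_2v\|_2<\epsilon.$$ Here $S_1$ and $S_\hbar$ are the position and momentum operators on $L^2(\mathbb{R})$.
   Context: On $H=L^2(\mathbb{R})$ (Lebesgue measure) let $D_0$ be the dense subspace of infinitely differentiable $f\in L^2(\mathbb{R})$ with all derivatives $f^{(m)}\in L^2(\mathbb{R})$ and $t^mf(t),\,t^mf'(t)\in L^2(\mathbb{R})\cap C_0(\mathbb{R})$ for all $m\in\mathbb{N}$. The position operator is $(S_1f)(t)=tf(t)$ and the momentum operator is $(S_\hbar f)(t)=-i\hbar f'(t)$ for $f\in D_0$; $S_1$ and $S_\hbar$ also denote their unique self-adjoint extensions (closures). Synthetic spectrum $s\mathrm{Sp}_M^\eta$ of a pair of self-adjoint operators $(h_1,h_2)$. For $\lambda\in\mathbb{R}$ and $\eta>0$ let $\theta_{\lambda,\eta}\in C(\mathbb{R})$ be the function with $0\le\theta_{\lambda,\eta}\le 1$, $\theta_{\lambda,\eta}(t)=1$ if $|t-\lambda|\le 3\eta/4$, $\theta_{\lambda,\eta}(t)=0$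 if $|t-\lambda|\ge\eta$, and linear on $[\lambda-\eta,\lambda-3\eta/4]$ and on $[\lambda+3\eta/4,\lambda+\eta]$. For $\xi=(\lambda_1,\lambda_2)\in\mathbb{R}^2$ put $\Theta_{\xi,\eta}(h_1,h_2)=\theta_{\lambda_1,\eta}(h_1)\theta_{\lambda_2,\eta}(h_2)$. Let $k=\inf\{l\in\mathbb{N}:(M+1)/l<\eta/(2\sqrt 2)\}$, $\mathbb{P}_k^M=\bigcup_{l=1}^k\{(m_1/l,m_2/l): m_j\in\mathbb{Z},\ |m_j|\le Ml\}$, and $D_M^\eta=\mathbb{P}_k^M\cap\{\zeta\in\mathbb{R}^2:\|\zeta\|_2\le M\}$, a finite $\eta/2$-dense subset of $\{\|\zeta\|_2\le M\}$. Then $$s\mathrm{Sp}_M^\eta((h_1,h_2))=\bigcup\left\{\overline{B(\xi,\eta)}:\ \xi\in D_M^\eta,\ \|\Theta_{\xi,\eta}(h_1,h_2)\|\ge 1-\eta\right\},$$ where $\overline{B(\xi,\eta)}$ is the closed Euclidean ball in $\mathbb{R}^2$ with center $\xi$ and radius $\eta$. *)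

theory Defs
  imports "HOL-Analysis.Analysis"
begin

section \<open>The Hilbert space of square-integrable functions on the real line\<close>

definition square_integrable :: "(real \<Rightarrow> complex) \<Rightarrow> bool" where
  "square_integrable f \<longleftrightarrow>
     f \<in> borel_measurable lborel \<and> integrable lborel (\<lambda>t. (norm (f t))\<^sup>2)"

definition l2_rel :: "(real \<Rightarrow> complex) \<Rightarrow> (real \<Rightarrow> complex) \<Rightarrow> bool" where
  "l2_rel f g \<longleftrightarrow> square_integrable f \<and> square_integrable g \<and> (AE t in lborel. f t = g t)"

lemma square_integrable_mult_cnj:
  assumes "square_integrable f" "square_integrable g"
  shows "integrable lborel (\<lambda>t. f t * cnj (g t))"
proof (rule Bochner_Integration.integrable_bound)
  show "integrable lborel (\<lambda>t. (norm (f t))\<^sup>2 + (norm (g t))\<^sup>2)"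
    using assms by (auto simp: square_integrable_def)
  have [measurable]: "f \<in> borel_measurable borel" "g \<in> borel_measurable borel"
    using assms by (auto simp: square_integrable_def)
  show "(\<lambda>t. f t * cnj (g t)) \<in> borel_measurable lborel"
    by (auto intro!: borel_measurable_times borel_measurable_continuous_on[of cnj]
        continuous_intros)
  have "norm (f t * cnj (g t)) \<le> norm ((norm (f t))\<^sup>2 + (norm (g t))\<^sup>2)" for t
  proof -
    have "0 \<le> norm (f t) * norm (g t)" by simp
    moreover have "2 * norm (f t) * norm (g t) \<le> (norm (f t))\<^sup>2 + (norm (g t))\<^sup>2"
      by (rule sum_squares_bound)
    ultimately have "norm (f t) * norm (g t) \<le> (norm (f t))\<^sup>2 + (norm (g t))\<^sup>2" by linarith
    then show ?thesis by (simp add: norm_mult)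
  qed
  then show "AE t in lborel. norm (f t * cnj (g t)) \<le> norm ((norm (f t))\<^sup>2 + (norm (g t))\<^sup>2)"
    by simp
qed

lemma square_integrable_0: "square_integrable (\<lambda>_. 0)"
  by (simp add: square_integrable_def)

lemma square_integrable_cmult:
  "square_integrable f \<Longrightarrow> square_integrable (\<lambda>t. c * f t)"
  by (auto simp: square_integrable_def norm_mult power_mult_distrib intro!: borel_measurable_times)

lemma square_integrable_add:
  assumes "square_integrable f" "square_integrable g"
  shows "square_integrable (\<lambda>t. f t + g t)"
  unfolding square_integrable_def
proof
  have [measurable]: "f \<in> borel_measurable borel" "g \<in> borel_measurable borel"
    using assms by (auto simp: square_integrable_def)
  show "(\<lambda>t. f t + g t) \<in> borel_measurable lborel" by simp
  show "integrable lborel (\<lambda>t. (norm (f t + g t))\<^sup>2)"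
  proof (rule Bochner_Integration.integrable_bound)
    show "integrable lborel (\<lambda>t. 2 * (norm (f t))\<^sup>2 + 2 * (norm (g t))\<^sup>2)"
      using assms by (auto simp: square_integrable_def)
    show "(\<lambda>t. (norm (f t + g t))\<^sup>2) \<in> borel_measurable lborel" by simp
    have "norm ((norm (f t + g t))\<^sup>2) \<le> norm (2 * (norm (f t))\<^sup>2 + 2 * (norm (g t))\<^sup>2)" for t
    proof -
      have "(norm (f t + g t))\<^sup>2 \<le> (norm (f t) + norm (g t))\<^sup>2"
        by (intro power_mono norm_triangle_ineq) simp
      also have "\<dots> \<le> 2 * (norm (f t))\<^sup>2 + 2 * (norm (g t))\<^sup>2"
        using sum_squares_bound[of "norm (f t)" "norm (g t)"] by (simp add: power2_sum)
      finally show ?thesis by simp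
    qed
    then show "AE t in lborel. norm ((norm (f t + g t))\<^sup>2)
        \<le> norm (2 * (norm (f t))\<^sup>2 + 2 * (norm (g t))\<^sup>2)" by simp
  qed
qed

quotient_type l2 = "real \<Rightarrow> complex" / partial: l2_rel
proof (rule part_equivpI)
  show "\<exists>f. l2_rel f f"
    by (rule exI[of _ "\<lambda>_. 0"]) (simp add: l2_rel_def square_integrable_0)
  show "symp l2_rel" by (rule sympI) (auto simp: l2_rel_def)
  show "transp l2_rel" by (rule transpI) (auto simp: l2_rel_def)
qed

lift_definition cscale :: "complex \<Rightarrow> l2 \<Rightarrow> l2" (infixr "*\<^sub>C" 75)
  is "\<lambda>c f t. c * f t"
  by (auto simp: l2_rel_def intro: square_integrable_cmult)

lift_definition cinner :: "l2 \<Rightarrow> l2 \<Rightarrow> complex"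
  is "\<lambda>f g. integral\<^sup>L lborel (\<lambda>t. f t * cnj (g t))"
proof -
  fix f f' g g' :: "real \<Rightarrow> complex"
  assume *: "l2_rel f f'" "l2_rel g g'"
  then have "integrable lborel (\<lambda>t. f t * cnj (g t))"
    "integrable lborel (\<lambda>t. f' t * cnj (g' t))"
    by (auto simp: l2_rel_def intro: square_integrable_mult_cnj)
  moreover have "AE t in lborel. f t * cnj (g t) = f' t * cnj (g' t)"
    using * by (auto simp: l2_rel_def)
  ultimately show "integral\<^sup>L lborel (\<lambda>t. f t * cnj (g t)) = integral\<^sup>L lborel (\<lambda>t. f' t * cnj (g' t))"
    by (intro integral_cong_AE) auto
qed

instantiation l2 :: real_vector
begin

lift_definition zero_l2 :: l2 is "\<lambda>_. 0"
  by (simp add: l2_rel_def square_integrable_0)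

lift_definition plus_l2 :: "l2 \<Rightarrow> l2 \<Rightarrow> l2" is "\<lambda>f g t. f t + g t"
  by (auto simp: l2_rel_def intro: square_integrable_add)

definition uminus_l2 :: "l2 \<Rightarrow> l2" where "uminus_l2 v = (-1) *\<^sub>C v"

definition minus_l2 :: "l2 \<Rightarrow> l2 \<Rightarrow> l2" where "minus_l2 v w = v + - w"

definition scaleR_l2 :: "real \<Rightarrow> l2 \<Rightarrow> l2" where "scaleR_l2 r v = complex_of_real r *\<^sub>C v"

instance
proof
  fix u v w :: l2 and a b :: real
  show "u + v + w = u + (v + w)"
    by transfer (auto simp: l2_rel_def add.assoc intro!: square_integrable_add)
  show "u + v = v + u"
    by transfer (auto simp: l2_rel_def add.commute intro!: square_integrable_add)
  show "0 + u = u"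
    by transfer (auto simp: l2_rel_def)
  show "- u + u = 0"
    unfolding uminus_l2_def
    by transfer (auto simp: l2_rel_def square_integrable_0)
  show "u - v = u + - v" by (simp add: minus_l2_def)
  show "a *\<^sub>R (u + v) = a *\<^sub>R u + a *\<^sub>R v"
    unfolding scaleR_l2_def
    by transfer (auto simp: l2_rel_def distrib_left
        intro!: square_integrable_add[of "\<lambda>t. _ * _ t" "\<lambda>t. _ * _ t"] square_integrable_cmult)
  show "(a + b) *\<^sub>R u = a *\<^sub>R u + b *\<^sub>R u"
    unfolding scaleR_l2_def
    by transfer (auto simp: l2_rel_def distrib_right
        intro!: square_integrable_add[of "\<lambda>t. _ * _ t" "\<lambda>t. _ * _ t"] square_integrable_cmult)
  show "a *\<^sub>R b *\<^sub>R u = (a * b) *\<^sub>R u"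
    unfolding scaleR_l2_def
    by transfer (auto simp: l2_rel_def mult.assoc
        intro!: square_integrable_cmult[of "\<lambda>t. _ * _ t"] square_integrable_cmult)
  show "1 *\<^sub>R u = u"
    unfolding scaleR_l2_def by transfer (auto simp: l2_rel_def)
qed

end

lemma cinner_add_left: "cinner (u + v) w = cinner u w + cinner v w"
  by transfer (simp add: l2_rel_def square_integrable_mult_cnj distrib_right)

lemma cinner_cscale_left: "cinner (c *\<^sub>C v) w = c * cinner v w"
  by transfer (simp add: l2_rel_def square_integrable_mult_cnj mult.assoc)

lemma cinner_commute: "cinner v w = cnj (cinner w v)"
proof transfer
  fix f g :: "real \<Rightarrow> complex"
  show "integral\<^sup>L lborel (\<lambda>t. f t * cnj (g t)) = cnj (integral\<^sup>L lborel (\<lambda>t. g t * cnj (f t)))"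
    by (subst Bochner_Integration.integral_cnj[symmetric]) (simp add: mult.commute)
qed

lemma cinner_self_ge_0: "0 \<le> Re (cinner v v)"
proof transfer
  fix f assume "l2_rel f f"
  have "integral\<^sup>L lborel (\<lambda>t. f t * cnj (f t))
      = complex_of_real (integral\<^sup>L lborel (\<lambda>t. (norm (f t))\<^sup>2))"
    by (simp add: complex_norm_square[symmetric] flip: integral_complex_of_real)
  then show "0 \<le> Re (integral\<^sup>L lborel (\<lambda>t. f t * cnj (f t)))" by simp
qed

lemma cinner_self_eq_0: "Re (cinner v v) = 0 \<longleftrightarrow> v = 0"
proof transfer
  fix f assume f: "l2_rel f f"
  have "integral\<^sup>L lborel (\<lambda>t. f t * cnj (f t))
      = complex_of_real (integral\<^sup>L lborel (\<lambda>t. (norm (f t))\<^sup>2))"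
    by (simp add: complex_norm_square[symmetric] flip: integral_complex_of_real)
  then have "Re (integral\<^sup>L lborel (\<lambda>t. f t * cnj (f t))) = 0
      \<longleftrightarrow> integral\<^sup>L lborel (\<lambda>t. (norm (f t))\<^sup>2) = 0" by simp
  also have "\<dots> \<longleftrightarrow> (AE t in lborel. (norm (f t))\<^sup>2 = 0)"
    using f by (intro integral_nonneg_eq_0_iff_AE) (auto simp: l2_rel_def square_integrable_def)
  also have "\<dots> \<longleftrightarrow> l2_rel f (\<lambda>_. 0)"
    using f by (auto simp: l2_rel_def square_integrable_0)
  finally show "Re (integral\<^sup>L lborel (\<lambda>t. f t * cnj (f t))) = 0 \<longleftrightarrow> l2_rel f (\<lambda>_. 0)" .
qed

text \<open>
  The \<^class>\<open>real_inner\<close> structure is the underlying real one, with inner product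
  \<^term>\<open>Re (cinner v w)\<close>; its norm is the usual norm of the complex Hilbert space.
\<close>

instantiation l2 :: real_inner
begin

definition inner_l2 :: "l2 \<Rightarrow> l2 \<Rightarrow> real" where "inner_l2 v w = Re (cinner v w)"

definition norm_l2 :: "l2 \<Rightarrow> real" where "norm_l2 v = sqrt (Re (cinner v v))"

definition sgn_l2 :: "l2 \<Rightarrow> l2" where "sgn_l2 v = v /\<^sub>R norm v"

definition dist_l2 :: "l2 \<Rightarrow> l2 \<Rightarrow> real" where "dist_l2 v w = norm (v - w)"

definition uniformity_l2 :: "(l2 \<times> l2) filter" where
  "uniformity_l2 = (INF e\<in>{0<..}. principal {(x, y). dist x y < e})"

definition open_l2 :: "l2 set \<Rightarrow> bool" where
  "open_l2 U \<longleftrightarrow> (\<forall>x\<in>U. eventually (\<lambda>(x', y). x' = x \<longrightarrow> y \<in> U) uniformity)"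

instance
proof
  fix u v w :: l2 and r :: real
  show "inner u v = inner v u"
    unfolding inner_l2_def by (subst cinner_commute) simp
  show "inner (u + v) w = inner u w + inner v w"
    by (simp add: inner_l2_def cinner_add_left)
  show "inner (r *\<^sub>R u) v = r * inner u v"
    by (simp add: inner_l2_def scaleR_l2_def cinner_cscale_left)
  show "0 \<le> inner u u" by (simp add: inner_l2_def cinner_self_ge_0)
  show "inner u u = 0 \<longleftrightarrow> u = 0" by (simp add: inner_l2_def cinner_self_eq_0)
  show "norm u = sqrt (inner u u)" by (simp add: norm_l2_def inner_l2_def)
qed (simp_all only: sgn_l2_def dist_l2_def uniformity_l2_def open_l2_def)

end

section \<open>Position and momentum operators\<close>

definition C0 :: "(real \<Rightarrow> complex) set" where
  "C0 = {f. continuous_on UNIV f \<and> (f \<longlongrightarrow> 0) at_infinity}"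

definition nth_derivative :: "nat \<Rightarrow> (real \<Rightarrow> complex) \<Rightarrow> real \<Rightarrow> complex" where
  "nth_derivative m f = ((\<lambda>g t. vector_derivative g (at t)) ^^ m) f"

definition D0 :: "(real \<Rightarrow> complex) set" where
  "D0 = {f. (\<forall>m t. nth_derivative m f differentiable (at t)) \<and>
            (\<forall>m. square_integrable (nth_derivative m f)) \<and>
            (\<forall>m. square_integrable (\<lambda>t. of_real t ^ m * f t) \<and>
                 (\<lambda>t. of_real t ^ m * f t) \<in> C0 \<and>
                 square_integrable (\<lambda>t. of_real t ^ m * nth_derivative 1 f t) \<and>
                 (\<lambda>t. of_real t ^ m * nth_derivative 1 f t) \<in> C0)}"

text \<open>
  An unbounded operator is represented by its graph, so the closure of an operator is the
  topological closure of its graph, and \<open>(v, u) \<in> h\<close> says that \<open>v\<close> is in the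
  domain of \<open>h\<close> and \<open>h v = u\<close>.  \<^term>\<open>abs_l2 f\<close> is the class of a square-integrable \<open>f\<close>.
\<close>

type_synonym l2_operator = "(l2 \<times> l2) set"

definition position_op :: l2_operator where
  "position_op = closure {(abs_l2 f, abs_l2 (\<lambda>t. of_real t * f t)) | f. f \<in> D0}"

definition momentum_op :: "real \<Rightarrow> l2_operator" where
  "momentum_op hbar =
     closure {(abs_l2 f, abs_l2 (\<lambda>t. - \<i> * of_real hbar * nth_derivative 1 f t)) | f. f \<in> D0}"

section \<open>Functional calculus\<close>

text \<open>The bounded operator \<open>R\<close> is the inverse of \<open>h - z\<close>: \<open>(h - z) u = w\<close> iff \<open>u = R w\<close>.\<close>

definition is_resolvent :: "l2_operator \<Rightarrow> complex \<Rightarrow> (l2 \<Rightarrow>\<^sub>L l2) \<Rightarrow> bool" where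
  "is_resolvent h z R \<longleftrightarrow> (\<forall>u w. (u, w + z *\<^sub>C u) \<in> h \<longleftrightarrow> u = R w)"

text \<open>
  The functional calculus of a self-adjoint \<open>h\<close> on the continuous functions vanishing at
  infinity: the *-homomorphism into the bounded (complex-linear) operators that sends
  \<open>1 / (t - z)\<close> to the resolvent at each non-real \<open>z\<close>.  For self-adjoint \<open>h\<close> it exists by the
  spectral theorem, and it is unique on \<^term>\<open>C0\<close> by the Stone-Weierstrass theorem.
\<close>

definition is_functional_calculus ::
    "l2_operator \<Rightarrow> ((real \<Rightarrow> complex) \<Rightarrow> (l2 \<Rightarrow>\<^sub>L l2)) \<Rightarrow> bool" where
  "is_functional_calculus h \<Phi> \<longleftrightarrow>
     (\<forall>f\<in>C0. \<forall>c v. \<Phi> f (c *\<^sub>C v) = c *\<^sub>C \<Phi> f v) \<and>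
     (\<forall>f\<in>C0. \<forall>g\<in>C0. \<Phi> (\<lambda>t. f t + g t) = \<Phi> f + \<Phi> g) \<and>
     (\<forall>f\<in>C0. \<forall>c v. \<Phi> (\<lambda>t. c * f t) v = c *\<^sub>C \<Phi> f v) \<and>
     (\<forall>f\<in>C0. \<forall>g\<in>C0. \<Phi> (\<lambda>t. f t * g t) = \<Phi> f o\<^sub>L \<Phi> g) \<and>
     (\<forall>f\<in>C0. \<forall>v w. cinner (\<Phi> (\<lambda>t. cnj (f t)) v) w = cinner v (\<Phi> f w)) \<and>
     (\<forall>z. Im z \<noteq> 0 \<longrightarrow> is_resolvent h z (\<Phi> (\<lambda>t. 1 / (of_real t - z))))"

definition apply_fun :: "(real \<Rightarrow> complex) \<Rightarrow> l2_operator \<Rightarrow> (l2 \<Rightarrow>\<^sub>L l2)" where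
  "apply_fun f h = (THE T. \<exists>\<Phi>. is_functional_calculus h \<Phi> \<and> T = \<Phi> f)"

section \<open>Synthetic spectrum\<close>

definition theta :: "real \<Rightarrow> real \<Rightarrow> real \<Rightarrow> real" where
  "theta l \<eta> t = (if \<bar>t - l\<bar> \<le> 3 * \<eta> / 4 then 1
                  else if \<bar>t - l\<bar> \<ge> \<eta> then 0
                  else 4 * (\<eta> - \<bar>t - l\<bar>) / \<eta>)"

definition Theta :: "real \<times> real \<Rightarrow> real \<Rightarrow> l2_operator \<Rightarrow> l2_operator \<Rightarrow> (l2 \<Rightarrow>\<^sub>L l2)" where
  "Theta \<xi> \<eta> h1 h2 =
     apply_fun (\<lambda>t. of_real (theta (fst \<xi>) \<eta> t)) h1 o\<^sub>L apply_fun (\<lambda>t. of_real (theta (snd \<xi>) \<eta> t)) h2"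

text \<open>\<open>l > 0\<close> is required because \<open>(M + 1) / 0 = 0\<close> here.\<close>

definition grid_index :: "real \<Rightarrow> real \<Rightarrow> nat" where
  "grid_index M \<eta> = Inf {l::nat. l > 0 \<and> (M + 1) / real l < \<eta> / (2 * sqrt 2)}"

definition rational_grid :: "nat \<Rightarrow> real \<Rightarrow> (real \<times> real) set" where
  "rational_grid k M =
     (\<Union>l\<in>{1..k}. {(of_int m1 / real l, of_int m2 / real l) | m1 m2 :: int.
        \<bar>of_int m1\<bar> \<le> M * real l \<and> \<bar>of_int m2\<bar> \<le> M * real l})"

definition D_grid :: "real \<Rightarrow> real \<Rightarrow> (real \<times> real) set" where
  "D_grid M \<eta> = rational_grid (grid_index M \<eta>) M \<inter> {\<zeta>. norm \<zeta> \<le> M}"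

definition synthetic_spectrum ::
    "real \<Rightarrow> real \<Rightarrow> l2_operator \<Rightarrow> l2_operator \<Rightarrow> (real \<times> real) set" where
  "synthetic_spectrum M \<eta> h1 h2 =
     \<Union> {cball \<xi> \<eta> | \<xi>. \<xi> \<in> D_grid M \<eta> \<and> norm (Theta \<xi> \<eta> h1 h2) \<ge> 1 - \<eta>}"

end

theory Submission
  imports Defs
begin

text \<open>
  For (i), the Gaussian \<open>exp (- t\<^sup>2 / (2 * \<bar>h\<bar>))\<close> has position and momentum of size
  \<open>sqrt (\<bar>h\<bar> / 2)\<close>, so both cutoffs at the origin almost fix it. For (ii), take \<open>x\<close> at which the
  product of the cutoffs almost attains its norm, and localize \<open>\<theta>\<^sub>2(S\<^sub>h) x\<close> in position by a
  product of two resolvents of \<open>S\<^sub>1\<close>; its commutator with \<open>S\<^sub>h\<close> is of order \<open>h\<close> by the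
  canonical commutation relation.

  The functional calculus of a self-adjoint operator is obtained without spectral measures: a
  Laurent polynomial \<open>f\<close> of degree \<open>d\<close> in the Cayley transform satisfies
  \<open>\<bar>f(U)\<bar> \<le> (2 * d + 1) * sup \<bar>f\<bar>\<close> by bounding its coefficients, and applying this to the powers
  \<open>(f(U)\<^sup>* f(U)) ^ 2 ^ n\<close> removes the factor in the limit. The Stone--Weierstrass theorem does the
  rest.
\<close>

section \<open>The Hilbert space structure of square-integrable functions\<close>

text \<open>\<open>apply_fun\<close> is a definite description over all calculi of an operator, so
  nothing can be said about \<open>Theta\<close> before existence and uniqueness of the calculus are
  proved for both closures. Uniqueness needs continuity, which is not among the axioms of a calculus
  and has to be derived from them. Existence needs the ranges of \<open>S\<^sub>1\<close> and
  \<open>S\<^sub>h\<close> shifted by \<plusminus>\<i> to be dense; this reduces to density of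
  \<open>D0\<close> in the whole space and to solving the shifted equations inside
  \<open>D0\<close>, by division for the position and by a first-order differential equation for the
  momentum.

  In (ii) the width \<kappa> of the position localization is kept apart from \<eta>. The position
  error is of order \<kappa>, the momentum error of order \<eta> plus the commutator term
  \<open>\<bar>h\<bar> / \<kappa>\<close>, and the localization captures the support of the first
  cutoff once \<open>2 * \<eta> \<le> \<kappa>\<close>. Thus \<kappa> depends on \<epsilon> alone,
  \<eta> is small compared with \<kappa>, and \<delta> is chosen last.\<close>

lemma l2_rel_self [simp]: "l2_rel f f \<longleftrightarrow> square_integrable f"
  by (simp add: l2_rel_def)

lemma l2_cases:
  obtains f where "square_integrable f" "v = abs_l2 f"
  using Quotient_abs_rep[OF Quotient_l2] Quotient_rep_reflp[OF Quotient_l2] l2_rel_self by metis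

lemma abs_l2_eq_iff:
  "square_integrable f \<Longrightarrow> square_integrable g \<Longrightarrow> abs_l2 f = abs_l2 g \<longleftrightarrow> (AE t in lborel. f t = g t)"
  using Quotient_rel_abs2[OF Quotient_l2] Quotient_rel[OF Quotient_l2, of f g]
  by (auto simp: l2_rel_def)

lemma abs_l2_cscale: "square_integrable f \<Longrightarrow> c *\<^sub>C abs_l2 f = abs_l2 (\<lambda>t. c * f t)"
  by (simp add: cscale.abs_eq)

lemma abs_l2_add:
  "square_integrable f \<Longrightarrow> square_integrable g \<Longrightarrow> abs_l2 f + abs_l2 g = abs_l2 (\<lambda>t. f t + g t)"
  by (simp add: plus_l2.abs_eq)

lemma square_integrable_diff:
  "square_integrable f \<Longrightarrow> square_integrable g \<Longrightarrow> square_integrable (\<lambda>t. f t - g t)"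
  using square_integrable_add[OF _ square_integrable_cmult[of g "-1"]] by simp

lemma abs_l2_diff:
  "square_integrable f \<Longrightarrow> square_integrable g \<Longrightarrow> abs_l2 f - abs_l2 g = abs_l2 (\<lambda>t. f t - g t)"
  using abs_l2_add[OF _ square_integrable_cmult[of g "-1"]]
  by (simp only: minus_l2_def uminus_l2_def abs_l2_cscale) simp

lemma cinner_abs_l2:
  "square_integrable f \<Longrightarrow> square_integrable g \<Longrightarrow>
     cinner (abs_l2 f) (abs_l2 g) = integral\<^sup>L lborel (\<lambda>t. f t * cnj (g t))"
  by (simp add: cinner.abs_eq)

interpretation l2: vector_space cscale
proof
  fix a b :: complex and x y :: l2
  show "a *\<^sub>C (x + y) = a *\<^sub>C x + a *\<^sub>C y"
    by transfer (auto simp: l2_rel_def distrib_left intro!: square_integrable_add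
        square_integrable_cmult[of "\<lambda>t. _ t + _ t"] square_integrable_cmult)
  show "(a + b) *\<^sub>C x = a *\<^sub>C x + b *\<^sub>C x"
    by transfer (auto simp: l2_rel_def distrib_right
        intro!: square_integrable_add[of "\<lambda>t. _ * _ t" "\<lambda>t. _ * _ t"] square_integrable_cmult)
  show "a *\<^sub>C b *\<^sub>C x = (a * b) *\<^sub>C x"
    by transfer (auto simp: l2_rel_def mult.assoc
        intro!: square_integrable_cmult[of "\<lambda>t. _ * _ t"] square_integrable_cmult)
  show "1 *\<^sub>C x = x"
    by transfer (auto simp: l2_rel_def)
qed

lemma scaleR_cscale: "r *\<^sub>R v = of_real r *\<^sub>C v"
  by (simp add: scaleR_l2_def)

lemma cinner_add_right: "cinner u (v + w) = cinner u v + cinner u w"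
  by (metis cinner_add_left cinner_commute complex_cnj_add)

lemma cinner_cscale_right: "cinner u (c *\<^sub>C v) = cnj c * cinner u v"
  by (metis cinner_cscale_left cinner_commute complex_cnj_mult)

lemma cinner_self: "cinner v v = of_real ((norm v)\<^sup>2)"
proof -
  have "Im (cinner v v) = 0"
    using cinner_commute[of v v] by (metis complex_cnj_cancel_iff Reals_cnj_iff complex_is_Real_iff)
  then show ?thesis
    by (simp add: complex_eq_iff norm_l2_def cinner_self_ge_0)
qed

lemma norm_abs_l2:
  assumes "square_integrable f"
  shows "(norm (abs_l2 f))\<^sup>2 = integral\<^sup>L lborel (\<lambda>t. (norm (f t))\<^sup>2)"
proof -
  have "complex_of_real ((norm (abs_l2 f))\<^sup>2) = complex_of_real (integral\<^sup>L lborel (\<lambda>t. (norm (f t))\<^sup>2))"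
    unfolding cinner_self[symmetric] cinner_abs_l2[OF assms assms]
    by (simp add: complex_norm_square[symmetric] flip: integral_complex_of_real)
  then show ?thesis by (simp only: of_real_eq_iff)
qed

lemma norm_cscale [simp]: "norm (c *\<^sub>C v) = cmod c * norm v"
proof -
  have "complex_of_real ((norm (c *\<^sub>C v))\<^sup>2) = of_real ((cmod c * norm v)\<^sup>2)"
    unfolding cinner_self[symmetric] cinner_cscale_left cinner_cscale_right
    using complex_norm_square[of c] by (simp add: cinner_self power_mult_distrib mult.commute)
  then have "(norm (c *\<^sub>C v))\<^sup>2 = (cmod c * norm v)\<^sup>2" by (simp only: of_real_eq_iff)
  then show ?thesis by (simp add: power2_eq_iff_nonneg)
qed

lemma bounded_linear_cscale: "bounded_linear (cscale c)"
  by (rule bounded_linear_intro[where K="cmod c"])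
     (auto simp: l2.scale_right_distrib scaleR_cscale mult_ac)

lemma inner_conv_cinner: "inner v w = Re (cinner v w)"
  by (simp add: inner_l2_def)

lemma Im_cinner: "Im (cinner v w) = inner (- \<i> *\<^sub>C v) w"
  by (simp add: inner_l2_def cinner_cscale_left l2.scale_minus_left[symmetric] del: l2.scale_minus_left)

section \<open>Completeness of \<open>l2\<close>\<close>

lemma nn_integral_norm_square:
  assumes "square_integrable f"
  shows "(\<integral>\<^sup>+t. ennreal ((norm (f t))\<^sup>2) \<partial>lborel) = ennreal ((norm (abs_l2 f))\<^sup>2)"
  using assms by (subst norm_abs_l2) (auto simp: square_integrable_def intro!: nn_integral_eq_integral)

lemma square_integrableI_nn:
  assumes "f \<in> borel_measurable lborel" "(\<integral>\<^sup>+t. ennreal ((norm (f t))\<^sup>2) \<partial>lborel) < \<infinity>"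
  shows "square_integrable f"
  unfolding square_integrable_def using assms by (auto intro!: integrableI_bounded)

text \<open>Riesz--Fischer: along a fast Cauchy subsequence, the increments \<open>g k\<close> satisfy
  \<open>\<Sum>k. 4 ^ k * \<bar>g k\<bar>\<^sup>2 < \<infinity>\<close> almost everywhere, so they are dominated by a geometric series.\<close>

lemma l2_fast_Cauchy_convergent:
  fixes X :: "nat \<Rightarrow> l2"
  assumes fast: "\<And>k m. k \<le> m \<Longrightarrow> norm (X m - X k) \<le> (1 / 4) ^ k"
  shows "convergent X"
proof -
  have "\<forall>k. \<exists>f. square_integrable f \<and> X k = abs_l2 f" by (metis l2_cases)
  then obtain f where f: "\<And>k. square_integrable (f k)" and X: "\<And>k. X k = abs_l2 (f k)" by metis
  define g where "g k t = f (Suc k) t - f k t" for k t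
  have [measurable]: "f k \<in> borel_measurable borel" for k
    using f by (auto simp: square_integrable_def)
  have sg: "square_integrable (\<lambda>t. f m t - f k t)" for k m by (intro square_integrable_diff f)
  have Xd: "X m - X k = abs_l2 (\<lambda>t. f m t - f k t)" for k m by (simp add: X abs_l2_diff f)
  have nn: "(\<integral>\<^sup>+t. ennreal ((norm (f m t - f k t))\<^sup>2) \<partial>lborel) \<le> ennreal ((1/16) ^ k)"
    if "k \<le> m" for k m
  proof -
    have "(norm (X m - X k))\<^sup>2 \<le> ((1 / 4) ^ k)\<^sup>2" using fast[OF that] by (intro power_mono) auto
    also have "\<dots> = (1/16) ^ k" by (simp add: power2_eq_square flip: power_mult_distrib)
    finally show ?thesis
      using nn_integral_norm_square[OF sg] by (simp add: Xd ennreal_leI)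
  qed
  have "(\<integral>\<^sup>+t. (\<Sum>k. ennreal (4 ^ k * (norm (g k t))\<^sup>2)) \<partial>lborel)
      = (\<Sum>k. \<integral>\<^sup>+t. ennreal (4 ^ k * (norm (g k t))\<^sup>2) \<partial>lborel)"
    unfolding g_def by (intro nn_integral_suminf) measurable
  also have "\<dots> \<le> (\<Sum>k. ennreal ((1/4) ^ k))"
  proof (intro suminf_le)
    fix k
    have "(\<integral>\<^sup>+t. ennreal (4 ^ k * (norm (g k t))\<^sup>2) \<partial>lborel)
        = ennreal (4 ^ k) * (\<integral>\<^sup>+t. ennreal ((norm (g k t))\<^sup>2) \<partial>lborel)"
      unfolding g_def by (subst nn_integral_cmult[symmetric]) (auto simp: ennreal_mult')
    also have "\<dots> \<le> ennreal (4 ^ k) * ennreal ((1/16) ^ k)"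
      unfolding g_def by (intro mult_left_mono nn) auto
    also have "\<dots> = ennreal ((1/4) ^ k)"
      by (simp flip: ennreal_mult' power_mult_distrib)
    finally show "(\<integral>\<^sup>+t. ennreal (4 ^ k * (norm (g k t))\<^sup>2) \<partial>lborel) \<le> ennreal ((1/4) ^ k)" .
  qed auto
  also have "\<dots> < \<infinity>"
    by (subst suminf_ennreal2) (auto intro!: summable_geometric)
  finally have "(\<integral>\<^sup>+t. (\<Sum>k. ennreal (4 ^ k * (norm (g k t))\<^sup>2)) \<partial>lborel) \<noteq> \<infinity>" by simp
  then have "AE t in lborel. (\<Sum>k. ennreal (4 ^ k * (norm (g k t))\<^sup>2)) \<noteq> \<infinity>"
    unfolding g_def by (intro nn_integral_noteq_infinite) measurable
  then have AE_conv: "AE t in lborel. convergent (\<lambda>k. f k t)"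
  proof eventually_elim
    case (elim t)
    define s where "s = enn2real (\<Sum>k. ennreal (4 ^ k * (norm (g k t))\<^sup>2))"
    have s: "(\<Sum>k. ennreal (4 ^ k * (norm (g k t))\<^sup>2)) = ennreal s"
      using elim by (simp add: s_def less_top)
    have "norm (g k t) \<le> sqrt s * (1/2) ^ k" for k
    proof -
      have "sum (\<lambda>k. ennreal (4 ^ k * (norm (g k t))\<^sup>2)) {k} \<le> ennreal s"
        unfolding s[symmetric] by (rule sum_le_suminf) auto
      then have "ennreal (4 ^ k * (norm (g k t))\<^sup>2) \<le> ennreal s" by simp
      then have "4 ^ k * (norm (g k t))\<^sup>2 \<le> s" by (subst (asm) ennreal_le_iff) (auto simp: s_def)
      moreover have "(2 ^ k)\<^sup>2 = (4 :: real) ^ k" by (simp add: power2_eq_square flip: power_mult_distrib)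
      ultimately have "(2 ^ k * norm (g k t))\<^sup>2 \<le> s" by (simp only: power_mult_distrib)
      then have "2 ^ k * norm (g k t) \<le> sqrt s" by (rule real_le_rsqrt)
      then show ?thesis by (simp add: field_simps)
    qed
    then have "summable (\<lambda>k. g k t)"
      by (rule summable_comparison_test'[rotated, where N=0]) (intro summable_mult summable_geometric, simp)
    then have "convergent (\<lambda>n. \<Sum>k<n. g k t)" by (simp add: summable_iff_convergent)
    then have "convergent (\<lambda>n. (\<Sum>k<n. g k t) + f 0 t)" by (intro convergent_add convergent_const)
    then show "convergent (\<lambda>k. f k t)" unfolding g_def by (subst (asm) sum_lessThan_telescope) simp
  qed
  define F where "F t = lim (\<lambda>k. f k t)" for t
  have [measurable]: "F \<in> borel_measurable borel" unfolding F_def by measurable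
  \<comment> \<open>Fatou's lemma in \<open>m\<close>: the pointwise limit inherits the bound on the
    tail of the sequence, so \<open>F\<close> is square-integrable and is also the limit in
    norm.\<close>
  have bound: "(\<integral>\<^sup>+t. ennreal ((norm (F t - f k t))\<^sup>2) \<partial>lborel) \<le> ennreal ((1/16) ^ k)" for k
  proof -
    have "(\<integral>\<^sup>+t. ennreal ((norm (F t - f k t))\<^sup>2) \<partial>lborel)
        = (\<integral>\<^sup>+t. liminf (\<lambda>m. ennreal ((norm (f m t - f k t))\<^sup>2)) \<partial>lborel)"
    proof (intro nn_integral_cong_AE, use AE_conv in eventually_elim)
      case (elim t)
      then have "(\<lambda>m. f m t) \<longlonglongrightarrow> F t" by (simp add: F_def convergent_LIMSEQ_iff)
      then have "(\<lambda>m. ennreal ((norm (f m t - f k t))\<^sup>2)) \<longlonglongrightarrow> ennreal ((norm (F t - f k t))\<^sup>2)"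
        by (intro tendsto_ennrealI tendsto_intros)
      then show ?case by (intro lim_imp_Liminf[symmetric]) auto
    qed
    also have "\<dots> \<le> liminf (\<lambda>m. \<integral>\<^sup>+t. ennreal ((norm (f m t - f k t))\<^sup>2) \<partial>lborel)"
      by (intro nn_integral_liminf) measurable
    also have "\<dots> \<le> ennreal ((1/16) ^ k)"
      by (rule Liminf_le) (use nn in \<open>auto simp: eventually_sequentially\<close>)
    finally show ?thesis .
  qed
  have "square_integrable (\<lambda>t. F t - f 0 t)"
    using bound[of 0] by (intro square_integrableI_nn) (auto intro: le_less_trans)
  from square_integrable_add[OF this f[of 0]] have F: "square_integrable F" by simp
  have "norm (abs_l2 F - X k) \<le> (1/4) ^ k" for k
  proof -
    have "ennreal ((norm (abs_l2 F - X k))\<^sup>2) \<le> ennreal ((1/16) ^ k)"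
      using bound[of k] F f nn_integral_norm_square[OF square_integrable_diff[OF F f[of k]]]
      by (simp add: X abs_l2_diff)
    then have "(norm (abs_l2 F - X k))\<^sup>2 \<le> ((1/4) ^ k)\<^sup>2"
      by (simp add: power2_eq_square flip: power_mult_distrib)
    then show ?thesis by (rule power2_le_imp_le) simp
  qed
  then have "(\<lambda>k. norm (X k - abs_l2 F)) \<longlonglongrightarrow> 0"
    by (intro tendsto_sandwich[OF _ _ tendsto_const LIMSEQ_power_zero[of "1/4::real"]])
       (auto simp: norm_minus_commute)
  then show ?thesis by (metis LIM_zero_iff tendsto_norm_zero_iff convergentI)
qed

instance l2 :: complete_space
proof
  fix X :: "nat \<Rightarrow> l2" assume X: "Cauchy X"
  then have "\<forall>k. \<exists>N. \<forall>m\<ge>N. \<forall>n\<ge>N. norm (X m - X n) < (1/4) ^ k"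
    by (auto simp: Cauchy_def dist_norm)
  then obtain N where N: "\<And>k m n. m \<ge> N k \<Longrightarrow> n \<ge> N k \<Longrightarrow> norm (X m - X n) < (1/4) ^ k" by metis
  \<comment> \<open>The partial sum dominates \<open>N k\<close>, and the added \<open>k\<close>
    makes \<open>r\<close> strictly increasing even where \<open>N\<close> vanishes.\<close>
  define r where "r k = (\<Sum>i\<le>k. N i) + k" for k
  have r: "strict_mono r" unfolding r_def strict_mono_Suc_iff by simp
  have rN: "N k \<le> r k" for k
    using member_le_sum[of k "{..k}" N] by (simp add: r_def)
  have "convergent (X \<circ> r)"
  proof (rule l2_fast_Cauchy_convergent)
    fix k m :: nat assume "k \<le> m"
    then have "r k \<le> r m" using r by (simp add: strict_mono_less_eq)
    with rN[of k] show "norm ((X \<circ> r) m - (X \<circ> r) k) \<le> (1/4) ^ k"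
      using N[of k "r m" "r k"] by simp
  qed
  then obtain L where "(X \<circ> r) \<longlonglongrightarrow> L" by (auto simp: convergent_def)
  with X r have "X \<longlonglongrightarrow> L" using Cauchy_converges_subseq by blast
  then show "convergent X" by (rule convergentI)
qed

instance l2 :: banach ..

section \<open>Functions vanishing at infinity\<close>

lemma C0_iff: "f \<in> C0 \<longleftrightarrow> continuous_on UNIV f \<and> (f \<longlongrightarrow> 0) at_infinity"
  by (simp add: C0_def)

lemma C0_add: "f \<in> C0 \<Longrightarrow> g \<in> C0 \<Longrightarrow> (\<lambda>t. f t + g t) \<in> C0"
  using tendsto_add[of f 0 at_infinity g 0] by (auto simp: C0_iff intro: continuous_intros)

lemma C0_bounded:
  assumes "f \<in> C0"
  obtains B where "B > 0" "\<And>t. norm (f t) \<le> B"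
proof -
  have "\<forall>\<^sub>F t in at_infinity. norm (f t) < 1"
    using assms by (auto simp: C0_iff tendsto_iff)
  then obtain b where b: "\<And>t. norm t \<ge> b \<Longrightarrow> norm (f t) < 1"
    by (auto simp: eventually_at_infinity)
  have "compact (f ` {-b..b})"
    using assms by (intro compact_continuous_image) (auto simp: C0_iff intro: continuous_on_subset)
  then obtain B where B: "\<And>t. t \<in> {-b..b} \<Longrightarrow> norm (f t) \<le> B"
    by (force dest: compact_imp_bounded simp: bounded_iff)
  have "norm (f t) \<le> max B 1" for t
    using B[of t] b[of t] by (cases "\<bar>t\<bar> \<ge> b") (auto simp: abs_le_iff less_imp_le le_max_iff_disj)
  then show ?thesis by (intro that[of "max B 1"]) auto
qed

lemma C0_bounded_mult:
  assumes "f \<in> C0" "continuous_on UNIV g" "\<And>t. norm (g t) \<le> B"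
  shows "(\<lambda>t. g t * f t) \<in> C0"
  unfolding C0_iff
proof
  show "continuous_on UNIV (\<lambda>t. g t * f t)" using assms by (auto simp: C0_iff intro: continuous_intros)
  have "((\<lambda>t. B * norm (f t)) \<longlongrightarrow> B * norm (0::complex)) at_infinity"
    using assms by (intro tendsto_intros) (auto simp: C0_iff)
  then have lim: "((\<lambda>t. B * norm (f t)) \<longlongrightarrow> 0) at_infinity" by simp
  show "((\<lambda>t. g t * f t) \<longlongrightarrow> 0) at_infinity"
  proof (rule Lim_null_comparison[OF always_eventually lim], rule allI)
    show "norm (g t * f t) \<le> B * norm (f t)" for t
      unfolding norm_mult by (rule mult_right_mono[OF assms(3)]) simp
  qed
qed

lemma C0_scale: "f \<in> C0 \<Longrightarrow> (\<lambda>t. c * f t) \<in> C0"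
  by (rule C0_bounded_mult[where B="norm c"]) (auto intro: continuous_intros)

lemma C0_mult: "f \<in> C0 \<Longrightarrow> g \<in> C0 \<Longrightarrow> (\<lambda>t. f t * g t) \<in> C0"
  by (rule C0_bounded[of f], assumption, rule C0_bounded_mult) (auto simp: C0_iff)

lemma C0_cnj: "f \<in> C0 \<Longrightarrow> (\<lambda>t. cnj (f t)) \<in> C0"
  using tendsto_cnj[of f 0 at_infinity] by (auto simp: C0_iff intro: continuous_intros)

lemma C0_diff: "f \<in> C0 \<Longrightarrow> g \<in> C0 \<Longrightarrow> (\<lambda>t. f t - g t) \<in> C0"
  using C0_add[OF _ C0_scale[of g "-1"]] by simp

lemma of_real_diff_neq_0: "Im z \<noteq> 0 \<Longrightarrow> of_real t - z \<noteq> 0"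
  by (auto simp: complex_eq_iff)

lemma C0_inverse_affine:
  assumes "Im z \<noteq> 0"
  shows "(\<lambda>t. 1 / (of_real t - z)) \<in> C0"
  unfolding C0_iff
proof
  show "continuous_on UNIV (\<lambda>t::real. 1 / (of_real t - z))"
    using of_real_diff_neq_0[OF assms] by (intro continuous_intros) auto
  have "filterlim (\<lambda>t::real. complex_of_real t + (- z)) at_infinity at_infinity"
  proof (rule tendsto_add_filterlim_at_infinity'[OF _ tendsto_const])
    have "filterlim (\<lambda>t::real. norm (complex_of_real t)) at_top at_infinity"
      using filterlim_norm_at_top[where 'a=real] by (simp add: real_norm_def[abs_def])
    then show "filterlim complex_of_real at_infinity at_infinity"
      by (rule filterlim_norm_at_top_imp_at_infinity)
  qed
  then have "((\<lambda>t::real. inverse (complex_of_real t + (- z))) \<longlongrightarrow> 0) at_infinity"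
    by (rule filterlim_compose[OF tendsto_inverse_0])
  then show "((\<lambda>t::real. 1 / (of_real t - z)) \<longlongrightarrow> 0) at_infinity"
    by (simp only: inverse_eq_divide add_uminus_conv_diff)
qed

text \<open>Under \<open>t \<mapsto> 1 / (t - \<i>)\<close> the one-point compactification of the line becomes a circle
  through \<open>0\<close>, where the Stone--Weierstrass theorem applies.\<close>

theorem C0_induct [consumes 1, case_names resolvent add scale mult cnj limit]:
  assumes f: "f \<in> C0"
    and resolvent: "P (\<lambda>t. 1 / (of_real t - \<i>))"
    and add: "\<And>f g. f \<in> C0 \<Longrightarrow> g \<in> C0 \<Longrightarrow> P f \<Longrightarrow> P g \<Longrightarrow> P (\<lambda>t. f t + g t)"
    and scale: "\<And>c f. f \<in> C0 \<Longrightarrow> P f \<Longrightarrow> P (\<lambda>t. c * f t)"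
    and mult: "\<And>f g. f \<in> C0 \<Longrightarrow> g \<in> C0 \<Longrightarrow> P f \<Longrightarrow> P g \<Longrightarrow> P (\<lambda>t. f t * g t)"
    and cnj: "\<And>f. f \<in> C0 \<Longrightarrow> P f \<Longrightarrow> P (\<lambda>t. cnj (f t))"
    and limit: "\<And>f. f \<in> C0 \<Longrightarrow>
      (\<And>e. e > 0 \<Longrightarrow> \<exists>g. g \<in> C0 \<and> P g \<and> (\<forall>t. norm (f t - g t) \<le> e)) \<Longrightarrow> P f"
  shows "P f"
proof -
  define \<kappa> :: "real \<Rightarrow> complex" where "\<kappa> t = 1 / (of_real t - \<i>)" for t
  define A where "A = {f \<in> C0. P f}"
  have \<kappa>A: "\<kappa> \<in> A"
    using resolvent C0_inverse_affine[of \<i>] unfolding A_def \<kappa>_def[abs_def] by simp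
  have A_add: "(\<lambda>t. f t + g t) \<in> A" and A_mult: "(\<lambda>t. f t * g t) \<in> A" if "f \<in> A" "g \<in> A" for f g
    using that by (auto simp: A_def intro: add mult C0_add C0_mult)
  have A_scale: "(\<lambda>t. c * f t) \<in> A" and A_cnj: "(\<lambda>t. cnj (f t)) \<in> A" if "f \<in> A" for f c
    using that by (auto simp: A_def intro: scale cnj C0_scale C0_cnj)
  \<comment> \<open>\<open>A\<close> is an algebra without constants, since its members vanish at
    infinity, where \<kappa> tends to 0. Polynomials in \<kappa> therefore enter only after
    subtraction of their value at 0.\<close>
  have poly: "(\<lambda>t. complex_of_real (p (\<kappa> t) - p 0)) \<in> A" if "real_polynomial_function p" for p
    using that
  proof (induction p)
    case (linear p)
    interpret bounded_linear p by fact
    have p_eq: "p z = Re z * p 1 + Im z * p \<i>" for z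
    proof -
      have "z = Re z *\<^sub>R 1 + Im z *\<^sub>R \<i>" by (simp add: complex_eq_iff)
      then have "p z = p (Re z *\<^sub>R 1 + Im z *\<^sub>R \<i>)" by (rule arg_cong)
      also have "\<dots> = Re z * p 1 + Im z * p \<i>" by (simp only: add scale real_scaleR_def)
      finally show ?thesis .
    qed
    have "complex_of_real (p (\<kappa> t) - p 0)
        = Complex (p 1 / 2) (- p \<i> / 2) * \<kappa> t + Complex (p 1 / 2) (p \<i> / 2) * cnj (\<kappa> t)" for t
      unfolding complex_eq_iff by (simp add: zero p_eq[of "\<kappa> t"])
    then show ?case by (simp only: A_add A_scale A_cnj \<kappa>A)
  next
    case (const c)
    show ?case using A_scale[OF \<kappa>A, of 0] by simp
  next
    case (add p q)
    show ?case using A_add[OF add.IH] by (simp add: algebra_simps)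
  next
    case (mult p q)
    have "complex_of_real (p (\<kappa> t) * q (\<kappa> t) - p 0 * q 0)
      = of_real (p (\<kappa> t) - p 0) * of_real (q (\<kappa> t) - q 0)
        + (of_real (p 0) * of_real (q (\<kappa> t) - q 0) + of_real (q 0) * of_real (p (\<kappa> t) - p 0))" for t
      by (simp add: algebra_simps)
    then show ?case using mult.IH by (simp only: A_add A_mult A_scale)
  qed
  define K where "K = sphere (\<i> / 2) (1 / 2)"
  have \<kappa>0: "of_real t - \<i> \<noteq> 0" for t by (rule of_real_diff_neq_0) simp
  have \<kappa>K: "\<kappa> t \<in> K" for t
  proof -
    have "\<kappa> t - \<i> / 2 = (1 - \<i> * of_real t) / (2 * (of_real t - \<i>))"
      using \<kappa>0[of t] by (simp add: \<kappa>_def field_simps)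
    also have "norm \<dots> = 1 / 2"
    proof -
      have "norm (1 - \<i> * of_real t) = norm (of_real t - \<i>)"
        by (simp add: cmod_def add.commute)
      then show ?thesis using \<kappa>0[of t] by (simp only: norm_divide norm_mult) simp
    qed
    finally show ?thesis by (simp add: K_def dist_norm norm_minus_commute)
  qed
  have K_inv: "1 / z = of_real (Re (1 / z)) - \<i>" if "z \<in> K" "z \<noteq> 0" for z
  proof -
    have "(norm (z - \<i> / 2))\<^sup>2 = (1 / 2)\<^sup>2"
      using that by (simp add: K_def dist_norm norm_minus_commute)
    then have "(Re z)\<^sup>2 + (Im z)\<^sup>2 = Im z"
      unfolding cmod_power2 by (simp add: power2_eq_square algebra_simps)
    then have "Im (1 / z) = -1" using that by (auto simp: Im_divide complex_eq_iff sum_power2_eq_zero_iff)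
    then show ?thesis by (simp add: complex_eq_iff)
  qed
  \<comment> \<open>By \<open>K_inv\<close>, the map \<open>z \<mapsto> Re (1 / z)\<close> inverts
    \<kappa> on the circle without 0. The point 0 stands for infinity and receives the limit of
    \<open>f\<close> there.\<close>
  define F where "F z = (if z = 0 then 0 else f (Re (1 / z)))" for z
  have F\<kappa>: "F (\<kappa> t) = f t" for t
    using \<kappa>0[of t] by (simp add: F_def \<kappa>_def)
  have contF: "continuous_on K F"
    unfolding continuous_on_eq_continuous_within
  proof
    fix z assume z: "z \<in> K"
    show "continuous (at z within K) F"
    proof (cases "z = 0")
      case True
      have "(F \<longlongrightarrow> 0) (at 0 within K)"
        unfolding tendsto_iff
      proof (intro allI impI)
        fix e :: real assume "e > 0"
        then have "\<forall>\<^sub>F t in at_infinity. norm (f t) < e" using f by (auto simp: C0_iff tendsto_iff)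
        then obtain b where b: "\<And>t. \<bar>t\<bar> \<ge> b \<Longrightarrow> norm (f t) < e" by (auto simp: eventually_at_infinity)
        show "\<forall>\<^sub>F w in at 0 within K. dist (F w) 0 < e"
          unfolding eventually_at
        proof (intro exI[of _ "1 / (\<bar>b\<bar> + 1)"] conjI ballI impI)
          fix w assume w: "w \<in> K" "w \<noteq> 0 \<and> dist w 0 < 1 / (\<bar>b\<bar> + 1)"
          then have "norm (1 / w) > \<bar>b\<bar> + 1" by (simp add: norm_divide field_simps)
          moreover have "norm (1 / w) = norm (of_real (Re (1 / w)) - \<i>)"
            by (rule arg_cong[OF K_inv]) (use w in auto)
          then have "norm (1 / w) \<le> \<bar>Re (1 / w)\<bar> + 1"
            using norm_triangle_ineq4[of "of_real (Re (1 / w))" \<i>] by (simp only: norm_of_real norm_ii)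
          ultimately have "\<bar>Re (1 / w)\<bar> \<ge> b" by linarith
          with w show "dist (F w) 0 < e" using b by (simp add: F_def)
        qed auto
      qed
      then show ?thesis using True by (simp add: continuous_within F_def)
    next
      case False
      have "isCont (\<lambda>w. f (Re (1 / w))) z"
        using f False by (intro continuous_intros continuous_at_compose[of z "\<lambda>w. Re (1 / w)" f, unfolded o_def])
          (auto simp: C0_iff continuous_on_eq_continuous_at)
      moreover have "\<forall>\<^sub>F w in nhds z. F w = f (Re (1 / w))"
        using t1_space_nhds[OF False] by eventually_elim (simp add: F_def)
      ultimately have "isCont F z" by (metis isCont_cong)
      then show ?thesis by (rule continuous_at_imp_continuous_at_within)
    qed
  qed
  have "compact K" by (simp add: K_def)
  have "0 \<in> K" by (simp add: K_def dist_norm)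
  have "F 0 = 0" by (simp add: F_def)
  show ?thesis
  proof (rule limit[OF f])
    fix e :: real assume "e > 0"
    \<comment> \<open>Four errors: real and imaginary part each contribute the approximation at
      \<open>\<kappa> t\<close> and the subtracted value at 0, which is small because
      \<open>F 0 = 0\<close>.\<close>
    then have e: "e / 4 > 0" by simp
    obtain p where p: "real_polynomial_function p" "\<And>z. z \<in> K \<Longrightarrow> \<bar>Re (F z) - p z\<bar> < e / 4"
      using Stone_Weierstrass_real_polynomial_function[OF \<open>compact K\<close> _ e, of "\<lambda>z. Re (F z)"] contF
      by (auto intro: continuous_intros)
    obtain q where q: "real_polynomial_function q" "\<And>z. z \<in> K \<Longrightarrow> \<bar>Im (F z) - q z\<bar> < e / 4"
      using Stone_Weierstrass_real_polynomial_function[OF \<open>compact K\<close> _ e, of "\<lambda>z. Im (F z)"] contF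
      by (auto intro: continuous_intros)
    define g where "g t = complex_of_real (p (\<kappa> t) - p 0) + \<i> * complex_of_real (q (\<kappa> t) - q 0)" for t
    have "g \<in> A" unfolding g_def by (intro A_add A_scale poly p q)
    moreover have "norm (f t - g t) \<le> e" for t
    proof -
      have "Re (f t - g t) = (Re (F (\<kappa> t)) - p (\<kappa> t)) + p 0"
        "Im (f t - g t) = (Im (F (\<kappa> t)) - q (\<kappa> t)) + q 0"
        by (simp_all add: F\<kappa> g_def)
      moreover have "\<bar>p 0\<bar> < e / 4" "\<bar>q 0\<bar> < e / 4"
        using p(2)[OF \<open>0 \<in> K\<close>] q(2)[OF \<open>0 \<in> K\<close>] \<open>F 0 = 0\<close> by auto
      moreover have "\<bar>a + b\<bar> \<le> e / 2" if "\<bar>a\<bar> < e / 4" "\<bar>b\<bar> < e / 4" for a b :: real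
        using that by linarith
      ultimately have "\<bar>Re (f t - g t)\<bar> \<le> e / 2" "\<bar>Im (f t - g t)\<bar> \<le> e / 2"
        using p(2)[OF \<kappa>K[of t]] q(2)[OF \<kappa>K[of t]] by simp_all
      then show ?thesis using cmod_le[of "f t - g t"] by linarith
    qed
    ultimately show "\<exists>g. g \<in> C0 \<and> P g \<and> (\<forall>t. norm (f t - g t) \<le> e)"
      unfolding A_def by blast
  qed
qed

section \<open>Functional calculus\<close>

lemma cinner_diff_left: "cinner (u - v) w = cinner u w - cinner v w"
  using cinner_add_left[of u "(-1) *\<^sub>C v" w]
  by (simp only: minus_l2_def uminus_l2_def cinner_cscale_left) simp

locale functional_calculus =
  fixes h :: l2_operator and \<Phi> :: "(real \<Rightarrow> complex) \<Rightarrow> (l2 \<Rightarrow>\<^sub>L l2)"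
  assumes functional_calculus: "is_functional_calculus h \<Phi>"
begin

lemma calc_cscale: "f \<in> C0 \<Longrightarrow> \<Phi> f (c *\<^sub>C v) = c *\<^sub>C \<Phi> f v"
  and calc_add: "f \<in> C0 \<Longrightarrow> g \<in> C0 \<Longrightarrow> \<Phi> (\<lambda>t. f t + g t) = \<Phi> f + \<Phi> g"
  and calc_scale: "f \<in> C0 \<Longrightarrow> \<Phi> (\<lambda>t. c * f t) v = c *\<^sub>C \<Phi> f v"
  and calc_mult: "f \<in> C0 \<Longrightarrow> g \<in> C0 \<Longrightarrow> \<Phi> (\<lambda>t. f t * g t) = \<Phi> f o\<^sub>L \<Phi> g"
  and calc_cnj: "f \<in> C0 \<Longrightarrow> cinner (\<Phi> (\<lambda>t. cnj (f t)) v) w = cinner v (\<Phi> f w)"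
  and calc_resolvent: "Im z \<noteq> 0 \<Longrightarrow> (u, w + z *\<^sub>C u) \<in> h \<longleftrightarrow> u = \<Phi> (\<lambda>t. 1 / (of_real t - z)) w"
  using functional_calculus unfolding is_functional_calculus_def is_resolvent_def by blast+

lemma calc_diff:
  assumes "f \<in> C0" "g \<in> C0"
  shows "\<Phi> (\<lambda>t. f t - g t) v = \<Phi> f v - \<Phi> g v"
  using calc_add[OF assms(1) C0_scale[OF assms(2), of "-1"]] calc_scale[OF assms(2), of "-1" v]
  by (simp add: blinfun.bilinear_simps)

text \<open>With \<open>s = sqrt (c\<^sup>2 - \<bar>f\<bar>\<^sup>2)\<close>, the function \<open>q = c - s\<close> is in \<open>C0\<close> and
  \<open>\<bar>f\<bar>\<^sup>2 = 2 c q - q\<^sup>2\<close>, so \<open>c\<^sup>2 * \<bar>v\<bar>\<^sup>2 - \<bar>\<Phi> f v\<bar>\<^sup>2 = \<bar>c v - \<Phi> q v\<bar>\<^sup>2\<close>.\<close>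

lemma calc_norm_le:
  assumes f: "f \<in> C0" and bound: "\<And>t. norm (f t) \<le> c"
  shows "norm (\<Phi> f v) \<le> c * norm v"
proof -
  have c: "c \<ge> 0" using bound[of 0] norm_ge_zero[of "f 0"] by linarith
  define q where "q t = complex_of_real (c - sqrt (c\<^sup>2 - (norm (f t))\<^sup>2))" for t
  have q: "q \<in> C0"
    unfolding C0_iff
  proof
    show "continuous_on UNIV q"
      unfolding q_def using f by (auto simp: C0_iff intro!: continuous_intros)
    have "((\<lambda>t. complex_of_real (c - sqrt (c\<^sup>2 - (norm (f t))\<^sup>2))) \<longlongrightarrow>
        complex_of_real (c - sqrt (c\<^sup>2 - (norm (0::complex))\<^sup>2))) at_infinity"
      using f by (intro tendsto_intros) (auto simp: C0_iff)
    then show "(q \<longlongrightarrow> 0) at_infinity"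
      using c by (simp add: q_def[abs_def])
  qed
  have cnj_q: "(\<lambda>t. cnj (q t)) = q" by (simp add: q_def fun_eq_iff)
  have sq: "cnj (f t) * f t = 2 * of_real c * q t - q t * q t" for t
  proof -
    have "(sqrt (c\<^sup>2 - (norm (f t))\<^sup>2))\<^sup>2 = c\<^sup>2 - (norm (f t))\<^sup>2"
      using bound[of t] by (simp add: power_mono)
    then have "2 * c * (c - sqrt (c\<^sup>2 - (norm (f t))\<^sup>2)) - (c - sqrt (c\<^sup>2 - (norm (f t))\<^sup>2))\<^sup>2
        = (norm (f t))\<^sup>2"
      by (simp add: power2_eq_square algebra_simps)
    from arg_cong[OF this, of complex_of_real] show ?thesis
      unfolding q_def by (simp add: power2_eq_square mult.commute[of "cnj (f t)"]
          complex_norm_square[symmetric, unfolded power2_eq_square])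
  qed
  have "complex_of_real ((norm (\<Phi> f v))\<^sup>2) = cinner (\<Phi> (\<lambda>t. cnj (f t) * f t) v) v"
    by (simp add: calc_mult C0_cnj f calc_cnj cinner_self)
  also have "\<dots> = cinner (\<Phi> (\<lambda>t. 2 * of_real c * q t - q t * q t) v) v"
    by (simp only: sq)
  also have "\<dots> = 2 * of_real c * cinner (\<Phi> q v) v - cinner (\<Phi> q (\<Phi> q v)) v"
    by (simp add: calc_diff calc_scale calc_mult q C0_scale C0_mult cinner_cscale_left
        cinner_diff_left)
  also have "cinner (\<Phi> q (\<Phi> q v)) v = of_real ((norm (\<Phi> q v))\<^sup>2)"
    using calc_cnj[OF q, of "\<Phi> q v" v] by (simp add: cnj_q cinner_self)
  finally have "Re (complex_of_real ((norm (\<Phi> f v))\<^sup>2)) =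
      Re (2 * of_real c * cinner (\<Phi> q v) v - of_real ((norm (\<Phi> q v))\<^sup>2))" by (rule arg_cong)
  then have eq: "(norm (\<Phi> f v))\<^sup>2 = 2 * c * inner (\<Phi> q v) v - (norm (\<Phi> q v))\<^sup>2"
    by (simp add: inner_conv_cinner)
  have "0 \<le> (norm (c *\<^sub>R v - \<Phi> q v))\<^sup>2" by simp
  also have "\<dots> = c\<^sup>2 * (norm v)\<^sup>2 - 2 * c * inner (\<Phi> q v) v + (norm (\<Phi> q v))\<^sup>2"
    unfolding power2_norm_eq_inner
    by (simp add: inner_diff_left inner_diff_right inner_commute power2_eq_square algebra_simps)
  finally have "(norm (\<Phi> f v))\<^sup>2 \<le> (c * norm v)\<^sup>2"
    unfolding eq by (simp add: power_mult_distrib)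
  then show ?thesis by (rule power2_le_imp_le) (use c in simp)
qed

end

lemma cinner_eqI: "(\<And>w. cinner x w = cinner y w) \<Longrightarrow> x = y"
proof -
  assume *: "\<And>w. cinner x w = cinner y w"
  have "cinner (x - y) (x - y) = 0"
    using *[of "x - y"] by (simp add: cinner_diff_left)
  then show "x = y" by (simp add: cinner_self)
qed

text \<open>The bound \<open>calc_norm_le\<close> follows from the algebraic laws alone, so it holds
  for both calculi. Agreement at the single resolvent for \<i> therefore spreads to everything
  generated from it by algebra, conjugation and uniform limits.\<close>

lemma functional_calculus_unique:
  assumes \<Phi>: "is_functional_calculus h \<Phi>" and \<Psi>: "is_functional_calculus h \<Psi>" and f: "f \<in> C0"
  shows "\<Phi> f = \<Psi> f"
proof -
  interpret \<Phi>: functional_calculus h \<Phi> by standard fact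
  interpret \<Psi>: functional_calculus h \<Psi> by standard fact
  show ?thesis
    using f
  proof (induction f rule: C0_induct)
    case resolvent
    show ?case
      using \<Phi>.calc_resolvent[of \<i>] \<Psi>.calc_resolvent[of \<i>] by (intro blinfun_eqI) simp
  next
    case (add f g)
    then show ?case by (simp add: \<Phi>.calc_add \<Psi>.calc_add)
  next
    case (scale c f)
    then show ?case by (intro blinfun_eqI) (simp add: \<Phi>.calc_scale \<Psi>.calc_scale)
  next
    case (mult f g)
    then show ?case by (simp add: \<Phi>.calc_mult \<Psi>.calc_mult)
  next
    case (cnj f)
    then show ?case by (intro blinfun_eqI cinner_eqI) (simp add: \<Phi>.calc_cnj \<Psi>.calc_cnj)
  next
    case (limit f)
    show ?case
    proof (rule blinfun_eqI)
      fix v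
      have "norm (\<Phi> f v - \<Psi> f v) \<le> 0 + e" if "e > 0" for e
      proof -
        \<comment> \<open>The added 1 keeps the divisor positive when \<open>v = 0\<close>.\<close>
        define K where "K = norm v + 1"
        have "K > 0" using norm_ge_zero[of v] unfolding K_def by linarith
        define e' where "e' = e / 2 / K"
        have "e' > 0" "e' * K = e / 2" using that \<open>K > 0\<close> by (simp_all add: e'_def)
        then obtain g where g: "g \<in> C0" "\<Phi> g = \<Psi> g" "\<And>t. norm (f t - g t) \<le> e'"
          using limit(2) by blast
        have "\<Phi> f v - \<Psi> f v = \<Phi> (\<lambda>t. f t - g t) v - \<Psi> (\<lambda>t. f t - g t) v"
          by (simp add: \<Phi>.calc_diff \<Psi>.calc_diff g limit(1))
        also have "norm \<dots> \<le> e' * norm v + e' * norm v"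
          by (intro norm_triangle_le_diff add_mono \<Phi>.calc_norm_le \<Psi>.calc_norm_le C0_diff limit(1) g)
        also have "\<dots> \<le> 2 * (e' * K)" using \<open>e' > 0\<close> by (simp add: K_def algebra_simps)
        also have "\<dots> = e" using \<open>e' * K = e / 2\<close> by simp
        finally show ?thesis by simp
      qed
      then have "norm (\<Phi> f v - \<Psi> f v) \<le> 0" by (rule field_le_epsilon)
      then show "\<Phi> f v = \<Psi> f v" by simp
    qed
  qed
qed

lemma apply_fun_eq:
  assumes "is_functional_calculus h \<Phi>" "f \<in> C0"
  shows "apply_fun f h = \<Phi> f"
  unfolding apply_fun_def
  by (rule the_equality) (use assms functional_calculus_unique in blast)+

section \<open>Adjoint pairs, the power trick and the Cayley transform\<close>

lift_definition cscale_blinfun :: "complex \<Rightarrow> (l2 \<Rightarrow>\<^sub>L l2)" is cscale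
  by (rule bounded_linear_cscale)

lemma cscale_blinfun_apply [simp]: "cscale_blinfun c v = c *\<^sub>C v"
  by transfer simp

lemma inner_cscale_left: "inner (c *\<^sub>C v) w = inner v (cnj c *\<^sub>C w)"
  by (simp add: inner_conv_cinner cinner_cscale_left cinner_cscale_right)

text \<open>Stated with the real inner product, in which norms and Cauchy--Schwarz are available.
  For complex-linear operators the relation for \<open>cinner\<close> is recovered through
  \<open>cinner_conv_inner\<close>.\<close>

definition adjoint_pair :: "(l2 \<Rightarrow>\<^sub>L l2) \<Rightarrow> (l2 \<Rightarrow>\<^sub>L l2) \<Rightarrow> bool" where
  "adjoint_pair T S \<longleftrightarrow> (\<forall>v w. inner (T v) w = inner v (S w))"

lemma adjoint_pair_sym: "adjoint_pair T S \<Longrightarrow> adjoint_pair S T"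
  unfolding adjoint_pair_def by (metis inner_commute)

lemma adjoint_pair_compose:
  "adjoint_pair T S \<Longrightarrow> adjoint_pair T' S' \<Longrightarrow> adjoint_pair (T o\<^sub>L T') (S' o\<^sub>L S)"
  by (simp add: adjoint_pair_def)

text \<open>The substantial half of the C*-identity, from
  \<open>\<bar>T v\<bar>\<^sup>2 = inner v (S (T v))\<close> and Cauchy--Schwarz.\<close>

lemma norm_square_le_adjoint:
  assumes "adjoint_pair T S"
  shows "(norm T)\<^sup>2 \<le> norm (S o\<^sub>L T)"
proof -
  have "norm (T v) \<le> sqrt (norm (S o\<^sub>L T)) * norm v" for v
  proof -
    have "(norm (T v))\<^sup>2 = inner v ((S o\<^sub>L T) v)"
      using assms by (simp add: power2_norm_eq_inner adjoint_pair_def)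
    also have "\<dots> \<le> norm v * norm ((S o\<^sub>L T) v)" by (rule norm_cauchy_schwarz)
    also have "\<dots> \<le> norm v * (norm (S o\<^sub>L T) * norm v)"
      by (intro mult_left_mono norm_blinfun) simp
    also have "\<dots> = (sqrt (norm (S o\<^sub>L T)) * norm v)\<^sup>2"
      by (simp add: power2_eq_square)
    finally show ?thesis by (rule power2_le_imp_le) simp
  qed
  then have "norm T \<le> sqrt (norm (S o\<^sub>L T))" by (intro norm_blinfun_bound) auto
  then show ?thesis using sqrt_ge_absD by fastforce
qed

text \<open>If \<open>C < a\<close>, then with \<open>m = 2 ^ n\<close> the geometric decay of
  \<open>(C / a) ^ m\<close> beats the factor \<open>K * m + 1\<close>, which grows only linearly in
  \<open>m\<close>.\<close>

lemma le_of_pow2_le_linear: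
  fixes a C :: real
  assumes "0 \<le> a" "0 \<le> C" and le: "\<And>n. a ^ 2 ^ n \<le> (K * 2 ^ n + 1) * C ^ 2 ^ n"
  shows "a \<le> C"
proof (rule ccontr)
  assume "\<not> a \<le> C"
  then have "a > 0" "C < a" using assms by auto
  define z where "z = C / a"
  have z: "0 \<le> z" "z < 1" using \<open>C < a\<close> \<open>a > 0\<close> assms by (auto simp: z_def)
  have "(\<lambda>m. K * (real m * z ^ m) + z ^ m) \<longlonglongrightarrow> K * 0 + 0"
    using z by (intro tendsto_add tendsto_mult_left powser_times_n_limit_0 LIMSEQ_power_zero) auto
  then have "(\<lambda>m. K * (real m * z ^ m) + z ^ m) \<longlonglongrightarrow> 0" by simp
  then have "\<forall>\<^sub>F m in sequentially. K * (real m * z ^ m) + z ^ m < 1"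
    by (rule order_tendstoD) simp
  then obtain N where N: "\<And>m. m \<ge> N \<Longrightarrow> K * (real m * z ^ m) + z ^ m < 1"
    by (auto simp: eventually_sequentially)
  have "K * (real (2 ^ N) * z ^ 2 ^ N) + z ^ 2 ^ N < 1"
    by (rule N) (simp add: less_imp_le)
  moreover have "1 \<le> (K * 2 ^ N + 1) * z ^ 2 ^ N"
    using le[of N] \<open>a > 0\<close> by (simp add: z_def power_divide field_simps)
  ultimately show False by (simp add: algebra_simps)
qed

text \<open>The points are the \<open>N\<close>-th roots of -1. Their \<open>m\<close>-th powers
  form a geometric progression whose ratio is an \<open>N\<close>-th root of unity, different from 1
  when \<open>0 < \<bar>m\<bar> < N\<close>.\<close>

lemma sum_cis_roots:
  assumes "N > 0" "\<bar>m\<bar> < int N"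
  shows "(\<Sum>j<N. cis (pi * (2 * real j + 1) / real N) powi m) = (if m = 0 then of_nat N else 0)"
proof (cases "m = 0")
  case False
  define r where "r = cis (2 * pi * of_int m / real N)"
  have eq: "cis (pi * (2 * real j + 1) / real N) powi m = cis (pi * of_int m / real N) * r ^ j" for j
    unfolding r_def cis_power_int Complex.DeMoivre cis_mult
    by (rule arg_cong[of _ _ cis]) (simp add: algebra_simps add_divide_distrib)
  have "r \<noteq> 1"
  proof
    assume "r = 1"
    then obtain k :: int where k: "2 * pi * of_int m / real N = of_int (2 * k) * pi"
      using cos_one_2pi_int[of "2 * pi * of_int m / real N"]
      by (auto simp: r_def complex_eq_iff mult_ac)
    then have "pi * (of_int m) = pi * (of_int k * real N)" using assms by (simp add: field_simps)
    then have "real_of_int m = of_int (k * int N)" by simp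
    then have "m = k * int N" by (simp only: of_int_eq_iff)
    then show False using assms False by (auto simp: abs_mult zero_less_mult_iff)
  qed
  moreover have "r ^ N = 1" using assms by (simp add: r_def Complex.DeMoivre cis_multiple_2pi)
  ultimately have "(\<Sum>j<N. r ^ j) = 0" by (simp add: geometric_sum)
  then show ?thesis using False by (simp add: eq flip: sum_distrib_left)
qed simp

text \<open>For unitary \<open>U\<close> with inverse \<open>V\<close>, Laurent polynomials in the Cayley transform of \<open>t\<close>
  correspond to Laurent polynomials in \<open>U\<close>.\<close>

definition cayley :: "real \<Rightarrow> complex" where
  "cayley t = (of_real t - \<i>) / (of_real t + \<i>)"

lemma of_real_pm_ii_neq_0 [simp]: "of_real t - \<i> \<noteq> 0" "of_real t + \<i> \<noteq> 0"
  by (auto simp: complex_eq_iff)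

lemma norm_cayley [simp]: "norm (cayley t) = 1"
proof -
  have "norm (of_real t - \<i>) = norm (of_real t + \<i>)" by (simp add: cmod_def)
  then show ?thesis by (simp add: cayley_def norm_divide)
qed

lemma cayley_neq_0 [simp]: "cayley t \<noteq> 0"
  by (metis norm_cayley norm_zero zero_neq_one)

lemma cnj_cayley: "cnj (cayley t) = cayley t powi (-1)"
  by (simp add: cayley_def)

lemma cayley_surj:
  assumes "norm x = 1" "x \<noteq> 1"
  obtains t where "cayley t = x"
proof -
  \<comment> \<open>The inverse Moebius transform. It takes a real value because
    \<open>cnj x = 1 / x\<close> on the unit circle.\<close>
  define y where "y = \<i> * (1 + x) / (1 - x)"
  have "x \<noteq> 0" using assms by auto
  have "cnj x = 1 / x" using assms(1) by (metis divide_conv_cnj mult_1 norm_one one_power2 div_by_1 of_real_1)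
  then have "cnj y = y"
    using \<open>x \<noteq> 0\<close> assms(2) by (simp add: y_def divide_simps) (simp add: algebra_simps)
  then have y: "of_real (Re y) = y" by (simp add: complex_eq_iff)
  have "y - \<i> = 2 * \<i> * x / (1 - x)" "y + \<i> = 2 * \<i> / (1 - x)"
    using assms(2) by (auto simp: y_def field_simps)
  then have "cayley (Re y) = x" using assms(2) by (simp add: cayley_def y)
  then show ?thesis by (rule that)
qed


section \<open>Laurent polynomials in a unitary operator\<close>

lemma sum_fibers:
  fixes g :: "'a :: plus \<times> 'a \<Rightarrow> 'b :: comm_monoid_add"
  assumes "finite I" "finite J" "finite M" "\<And>j k. j \<in> I \<Longrightarrow> k \<in> J \<Longrightarrow> j + k \<in> M"
  shows "(\<Sum>m\<in>M. \<Sum>p\<in>{p \<in> I \<times> J. fst p + snd p = m}. g p) = (\<Sum>j\<in>I. \<Sum>k\<in>J. g (j, k))"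
  using assms by (subst sum.group) (auto simp: sum.cartesian_product)

lemma blinfun_compose_assoc: "(A o\<^sub>L B) o\<^sub>L C = A o\<^sub>L (B o\<^sub>L C)"
  and blinfun_compose_id: "A o\<^sub>L id_blinfun = A" "id_blinfun o\<^sub>L A = A"
  by (auto intro: blinfun_eqI)

text \<open>The operator type is only real-linear, so complex linearity appears as separate
  assumptions. \<open>V\<close> is both inverse and adjoint of \<open>U\<close>.\<close>

locale unitary =
  fixes U V :: "l2 \<Rightarrow>\<^sub>L l2"
  assumes UV: "U o\<^sub>L V = id_blinfun" and VU: "V o\<^sub>L U = id_blinfun"
    and U_cscale: "U (c *\<^sub>C v) = c *\<^sub>C U v" and V_cscale: "V (c *\<^sub>C v) = c *\<^sub>C V v"
    and adjoint_UV: "adjoint_pair U V"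
begin

definition zpow :: "int \<Rightarrow> (l2 \<Rightarrow>\<^sub>L l2)" where
  "zpow k = (if k \<ge> 0 then (((o\<^sub>L) U) ^^ nat k) id_blinfun else (((o\<^sub>L) V) ^^ nat (- k)) id_blinfun)"

lemma zpow_0 [simp]: "zpow 0 = id_blinfun"
  by (simp add: zpow_def)

lemma zpow_succ: "zpow (k + 1) = U o\<^sub>L zpow k"
proof (cases "k \<ge> 0")
  case True
  then have "nat (k + 1) = Suc (nat k)" by simp
  with True show ?thesis by (simp add: zpow_def)
next
  case False
  then have k: "nat (- k) = Suc (nat (- (k + 1)))" by simp
  have "zpow (k + 1) = (((o\<^sub>L) V) ^^ nat (- (k + 1))) id_blinfun"
    using False by (cases "k = -1") (auto simp: zpow_def)
  moreover have "zpow k = V o\<^sub>L (((o\<^sub>L) V) ^^ nat (- (k + 1))) id_blinfun"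
    using False unfolding zpow_def k by simp
  ultimately show ?thesis by (simp add: UV blinfun_compose_id flip: blinfun_compose_assoc)
qed

lemma zpow_pred: "zpow (k - 1) = V o\<^sub>L zpow k"
  using zpow_succ[of "k - 1"] by (simp add: VU blinfun_compose_id flip: blinfun_compose_assoc)

lemma zpow_add: "zpow (j + k) = zpow j o\<^sub>L zpow k"
proof (induction j rule: int_induct[where k=0])
  case (step1 j)
  have "zpow (j + 1 + k) = zpow (j + k + 1)" by (simp add: add_ac)
  then show ?case by (simp only: zpow_succ step1 blinfun_compose_assoc)
next
  case (step2 j)
  have "zpow (j - 1 + k) = zpow (j + k - 1)" by (simp add: algebra_simps)
  then show ?case by (simp only: zpow_pred step2 blinfun_compose_assoc)
qed (simp add: blinfun_compose_id)

lemma zpow_1: "zpow 1 = U" and zpow_minus_1: "zpow (-1) = V"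
  using zpow_succ[of 0] zpow_pred[of 0] by (simp_all add: blinfun_compose_id)

lemma zpow_cscale: "zpow k (c *\<^sub>C v) = c *\<^sub>C zpow k v"
proof (induction k arbitrary: v rule: int_induct[where k=0])
  case (step1 j)
  then show ?case by (simp add: zpow_succ U_cscale)
next
  case (step2 j)
  then show ?case by (simp add: zpow_pred V_cscale)
qed simp

lemma adjoint_zpow: "adjoint_pair (zpow k) (zpow (- k))"
proof (induction k rule: int_induct[where k=0])
  case (step1 j)
  have "zpow (- (j + 1)) = zpow (- j) o\<^sub>L V"
    using zpow_add[of "- j" "-1"] by (simp add: zpow_minus_1)
  then show ?case
    using adjoint_pair_compose[OF adjoint_UV step1(2)] by (simp add: zpow_succ)
next
  case (step2 j)
  have "zpow (- (j - 1)) = zpow (- j) o\<^sub>L U" using zpow_add[of "- j" 1] by (simp add: zpow_1)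
  then show ?case
    using adjoint_pair_compose[OF adjoint_pair_sym[OF adjoint_UV] step2(2)] by (simp add: zpow_pred)
qed (simp add: adjoint_pair_def)

lemma norm_zpow_apply: "norm (zpow k v) = norm v"
proof -
  have "(norm (zpow k v))\<^sup>2 = inner v ((zpow (- k) o\<^sub>L zpow k) v)"
    using adjoint_zpow[of k] by (simp add: power2_norm_eq_inner adjoint_pair_def)
  also have "\<dots> = (norm v)\<^sup>2" by (simp add: power2_norm_eq_inner flip: zpow_add)
  finally show ?thesis by (simp add: power2_eq_iff_nonneg)
qed

definition laurent_fun :: "nat \<Rightarrow> (int \<Rightarrow> complex) \<Rightarrow> real \<Rightarrow> complex" where
  "laurent_fun d c t = (\<Sum>k\<in>{- int d..int d}. c k * cayley t powi k)"

definition laurent_op :: "nat \<Rightarrow> (int \<Rightarrow> complex) \<Rightarrow> (l2 \<Rightarrow>\<^sub>L l2)" where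
  "laurent_op d c = (\<Sum>k\<in>{- int d..int d}. cscale_blinfun (c k) o\<^sub>L zpow k)"

lemma laurent_op_apply: "laurent_op d c v = (\<Sum>k\<in>{- int d..int d}. c k *\<^sub>C zpow k v)"
  by (simp add: laurent_op_def blinfun.sum_left)

text \<open>A relation rather than a map on coefficients: that the function \<open>f\<close>
  determines the operator \<open>T\<close> is a consequence of \<open>laurent_bound\<close> and
  comes only later.\<close>

definition laurent :: "nat \<Rightarrow> (real \<Rightarrow> complex) \<Rightarrow> (l2 \<Rightarrow>\<^sub>L l2) \<Rightarrow> bool" where
  "laurent d f T \<longleftrightarrow> (\<exists>c. f = laurent_fun d c \<and> T = laurent_op d c)"

lemma laurent_mono:
  assumes "laurent d f T" "d \<le> e"
  shows "laurent e f T"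
proof -
  obtain c where c: "f = laurent_fun d c" "T = laurent_op d c"
    using assms(1) by (auto simp: laurent_def)
  define c' where "c' k = (if k \<in> {- int d..int d} then c k else 0)" for k
  have sub: "{- int d..int d} \<subseteq> {- int e..int e}" using assms(2) by auto
  have "laurent_fun e c' = laurent_fun d c"
    unfolding laurent_fun_def fun_eq_iff
    by (intro allI sum.mono_neutral_cong_right) (use sub in \<open>auto simp: c'_def\<close>)
  moreover have "laurent_op e c' = laurent_op d c"
    by (rule blinfun_eqI, unfold laurent_op_apply, intro sum.mono_neutral_cong_right)
      (use sub in \<open>auto simp: c'_def\<close>)
  ultimately show ?thesis unfolding laurent_def c by metis
qed

lemma laurent_add:
  assumes "laurent d f T" "laurent d g S"
  shows "laurent d (\<lambda>t. f t + g t) (T + S)"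
proof -
  obtain b c where *: "f = laurent_fun d b" "T = laurent_op d b" "g = laurent_fun d c" "S = laurent_op d c"
    using assms by (auto simp: laurent_def)
  have "(\<lambda>t. f t + g t) = laurent_fun d (\<lambda>k. b k + c k)"
    by (simp add: * laurent_fun_def fun_eq_iff sum.distrib distrib_right)
  moreover have "T + S = laurent_op d (\<lambda>k. b k + c k)"
    by (rule blinfun_eqI)
       (simp add: * laurent_op_apply blinfun.add_left sum.distrib l2.scale_left_distrib)
  ultimately show ?thesis by (auto simp: laurent_def)
qed

lemma laurent_scale:
  assumes "laurent d f T"
  shows "laurent d (\<lambda>t. a * f t) (cscale_blinfun a o\<^sub>L T)"
proof -
  obtain c where *: "f = laurent_fun d c" "T = laurent_op d c"
    using assms by (auto simp: laurent_def)
  have "(\<lambda>t. a * f t) = laurent_fun d (\<lambda>k. a * c k)"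
    by (simp add: * laurent_fun_def fun_eq_iff sum_distrib_left mult.assoc)
  moreover have "cscale_blinfun a o\<^sub>L T = laurent_op d (\<lambda>k. a * c k)"
    by (rule blinfun_eqI) (simp add: * laurent_op_apply l2.scale_sum_right)
  ultimately show ?thesis by (auto simp: laurent_def)
qed

lemma laurent_op_cscale: "laurent d f T \<Longrightarrow> T (a *\<^sub>C v) = a *\<^sub>C T v"
  by (auto simp: laurent_def laurent_op_apply l2.scale_sum_right zpow_cscale mult.commute)

lemma laurent_mult:
  assumes "laurent d f T" "laurent e g S"
  shows "laurent (d + e) (\<lambda>t. f t * g t) (T o\<^sub>L S)"
proof -
  obtain b c where *: "f = laurent_fun d b" "T = laurent_op d b" "g = laurent_fun e c" "S = laurent_op e c"
    using assms by (auto simp: laurent_def)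
  define I J M where "I = {- int d..int d}" and "J = {- int e..int e}"
    and "M = {- int (d + e)..int (d + e)}"
  note fib = sum_fibers[of I J M]
  have IJM: "finite I" "finite J" "finite M" "\<And>j k. j \<in> I \<Longrightarrow> k \<in> J \<Longrightarrow> j + k \<in> M"
    by (auto simp: I_def J_def M_def)
  define a where "a m = (\<Sum>p\<in>{p \<in> I \<times> J. fst p + snd p = m}. b (fst p) * c (snd p))" for m
  have "f t * g t = laurent_fun (d + e) a t" for t
  proof -
    have "laurent_fun (d + e) a t = (\<Sum>m\<in>M. \<Sum>p\<in>{p \<in> I \<times> J. fst p + snd p = m}.
        b (fst p) * cayley t powi fst p * (c (snd p) * cayley t powi snd p))"
      unfolding laurent_fun_def a_def M_def[symmetric] sum_distrib_right
      by (intro sum.cong refl) (auto simp: power_int_add)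
    also have "\<dots> = f t * g t"
      by (subst fib[OF IJM]) (simp_all add: * laurent_fun_def sum_product I_def J_def)
    finally show ?thesis by simp
  qed
  moreover have "T o\<^sub>L S = laurent_op (d + e) a"
  proof (rule blinfun_eqI)
    fix v
    have "laurent_op (d + e) a v = (\<Sum>m\<in>M. \<Sum>p\<in>{p \<in> I \<times> J. fst p + snd p = m}.
        b (fst p) *\<^sub>C zpow (fst p) (c (snd p) *\<^sub>C zpow (snd p) v))"
      unfolding laurent_op_apply a_def M_def[symmetric] l2.scale_sum_left
      by (intro sum.cong refl) (auto simp: zpow_add zpow_cscale)
    also have "\<dots> = (T o\<^sub>L S) v"
      by (subst fib[OF IJM])
         (simp_all add: * laurent_op_apply I_def J_def blinfun.sum_right l2.scale_sum_right,
          rule sum.swap)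
    finally show "(T o\<^sub>L S) v = laurent_op (d + e) a v" by simp
  qed
  ultimately show ?thesis by (auto simp: laurent_def fun_eq_iff)
qed

text \<open>On the unit circle conjugation is inversion, and the adjoint of \<open>zpow k\<close> is
  \<open>zpow (- k)\<close>. Both sides thus reflect the coefficients to
  \<open>cnj (c (- k))\<close>.\<close>

lemma laurent_cnj:
  assumes "laurent d f T"
  obtains S where "laurent d (\<lambda>t. cnj (f t)) S" "adjoint_pair T S"
proof -
  obtain c where *: "f = laurent_fun d c" "T = laurent_op d c"
    using assms by (auto simp: laurent_def)
  define b where "b k = cnj (c (- k))" for k
  have refl: "(\<Sum>k\<in>{- int d..int d}. h k) = (\<Sum>k\<in>{- int d..int d}. h (- k))"
    for h :: "int \<Rightarrow> 'a :: comm_monoid_add"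
    by (rule sum.reindex_bij_witness[where i=uminus and j=uminus]) auto
  have "cnj (f t) = laurent_fun d b t" for t
    unfolding * laurent_fun_def
    by (subst refl) (simp add: b_def cnj_cayley power_int_minus flip: power_int_inverse)
  then have "(\<lambda>t. cnj (f t)) = laurent_fun d b" by (simp add: fun_eq_iff)
  moreover have "adjoint_pair T (laurent_op d b)"
    unfolding adjoint_pair_def
  proof (intro allI)
    fix v w
    have "inner (T v) w = (\<Sum>k\<in>{- int d..int d}. inner v (cnj (c k) *\<^sub>C zpow (- k) w))"
      using adjoint_zpow
      by (simp add: * laurent_op_apply inner_sum_left inner_cscale_left adjoint_pair_def
          flip: zpow_cscale)
    also have "\<dots> = inner v (laurent_op d b w)"
      by (subst refl) (simp add: laurent_op_apply b_def inner_sum_right)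
    finally show "inner (T v) w = inner v (laurent_op d b w)" .
  qed
  ultimately show ?thesis by (intro that[of "laurent_op d b"]) (auto simp: laurent_def)
qed

text \<open>The coefficients of a Laurent polynomial of degree \<open>d\<close> are averages of its values over
  \<open>2 * d + 1\<close> equidistributed points, here chosen to avoid \<open>1\<close>, which \<open>cayley\<close> omits.\<close>

lemma laurent_coeff_le:
  assumes bound: "\<And>t. norm (laurent_fun d c t) \<le> C" and k: "k \<in> {- int d..int d}"
  shows "norm (c k) \<le> C"
proof -
  define N where "N = 2 * d + 1"
  define x where "x j = cis (pi * (2 * real j + 1) / real N)" for j
  have N: "N > 0" by (simp add: N_def)
  have x1: "x j \<noteq> 1" for j
  proof
    assume "x j = 1"
    then have "x j ^ N = 1" by simp
    moreover have "x j ^ N = cis (2 * pi * real j + pi)"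
    proof -
      have "x j ^ N = cis (pi * (2 * real j + 1))" using N by (simp add: x_def Complex.DeMoivre)
      then show ?thesis by (simp add: algebra_simps)
    qed
    moreover have "cis (2 * pi * real j + pi) = -1"
      by (simp add: cis_multiple_2pi flip: cis_mult)
    ultimately show False by simp
  qed
  have "\<forall>j. \<exists>t. cayley t = x j"
    using cayley_surj x1 by (metis norm_cis x_def)
  then obtain t where t: "\<And>j. cayley (t j) = x j" by metis
  have x0: "x j \<noteq> 0" for j by (simp add: x_def)
  have "(\<Sum>j<N. laurent_fun d c (t j) * x j powi (- k))
      = (\<Sum>j<N. \<Sum>l\<in>{- int d..int d}. c l * x j powi (l - k))"
    by (simp add: laurent_fun_def t sum_distrib_right mult.assoc power_int_diff power_int_minus
        divide_inverse x0)
  also have "\<dots> = (\<Sum>l\<in>{- int d..int d}. c l * (\<Sum>j<N. x j powi (l - k)))"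
    by (subst sum.swap) (simp add: sum_distrib_left)
  also have "\<dots> = (\<Sum>l\<in>{- int d..int d}. if l = k then c l * of_nat N else 0)"
  proof (rule sum.cong)
    fix l assume l: "l \<in> {- int d..int d}"
    \<comment> \<open>Two exponents differ by at most \<open>2 * d\<close>, so
      \<open>2 * d + 1\<close> sample points are just enough to separate them.\<close>
    have "\<bar>l - k\<bar> < int N" using l k by (auto simp: N_def)
    from sum_cis_roots[OF N this]
    show "c l * (\<Sum>j<N. x j powi (l - k)) = (if l = k then c l * of_nat N else 0)"
      by (simp add: x_def)
  qed simp
  also have "\<dots> = c k * of_nat N" using k by simp
  finally have "norm (c k) * N = norm (\<Sum>j<N. laurent_fun d c (t j) * x j powi (- k))"
    by (simp add: norm_mult)
  also have "\<dots> \<le> (\<Sum>j<N. C)"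
    by (rule sum_norm_le) (simp add: norm_mult norm_power_int x_def bound)
  finally show ?thesis using N by simp
qed

lemma laurent_crude_bound:
  assumes "laurent d f T" "\<And>t. norm (f t) \<le> C"
  shows "norm T \<le> (2 * real d + 1) * C"
proof -
  obtain c where *: "f = laurent_fun d c" "T = laurent_op d c"
    using assms by (auto simp: laurent_def)
  have C: "C \<ge> 0" using assms(2)[of 0] norm_ge_zero order_trans by blast
  show ?thesis
  proof (rule norm_blinfun_bound)
    fix v
    have "norm (T v) \<le> (\<Sum>k\<in>{- int d..int d}. C * norm v)"
      unfolding * laurent_op_apply
      by (rule sum_norm_le) (use laurent_coeff_le[of d c C] assms(2) in
          \<open>auto simp: * norm_zpow_apply intro!: mult_right_mono\<close>)
    then show "norm (T v) \<le> (2 * real d + 1) * C * norm v"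
      by (simp add: algebra_simps)
  qed (use C in simp)
qed

text \<open>Passing from \<open>A\<close> to its square doubles the degree and squares the supremum
  bound. After \<open>n\<close> squarings the factor of the crude bound has grown only in proportion
  to \<open>2 ^ n\<close>, which \<open>le_of_pow2_le_linear\<close> can absorb.\<close>

lemma laurent_self_adjoint_bound:
  assumes "laurent d f A" "\<And>t. norm (f t) \<le> C" "adjoint_pair A A"
  shows "norm A ^ 2 ^ n \<le> (2 * real d * 2 ^ n + 1) * C ^ 2 ^ n"
  using assms
proof (induction n arbitrary: d f A C)
  case 0
  then show ?case using laurent_crude_bound[of d f A C] by simp
next
  case (Suc n)
  have C: "C \<ge> 0" using Suc.prems(2)[of 0] norm_ge_zero order_trans by blast
  have "norm A ^ 2 ^ Suc n = ((norm A)\<^sup>2) ^ 2 ^ n" by (simp add: power_mult)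
  also have "\<dots> \<le> norm (A o\<^sub>L A) ^ 2 ^ n"
    by (intro power_mono norm_square_le_adjoint Suc.prems) simp
  also have "\<dots> \<le> (2 * real (d + d) * 2 ^ n + 1) * (C * C) ^ 2 ^ n"
    by (rule Suc.IH[OF laurent_mult[OF Suc.prems(1,1)]])
       (use Suc.prems C in \<open>auto simp: norm_mult adjoint_pair_compose intro!: mult_mono\<close>)
  also have "(C * C) ^ 2 ^ n = C ^ 2 ^ Suc n" by (simp add: power_mult flip: power2_eq_square)
  finally show ?case by (simp add: algebra_simps)
qed

text \<open>The squaring argument needs a self-adjoint operator, so it is applied to
  \<open>S o\<^sub>L T\<close>, whose symbol \<open>\<bar>f\<bar>\<^sup>2\<close> is bounded by
  \<open>C * C\<close>.\<close>

lemma laurent_bound: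
  assumes "laurent d f T" "\<And>t. norm (f t) \<le> C"
  shows "norm T \<le> C"
proof -
  have C: "C \<ge> 0" using assms(2)[of 0] norm_ge_zero order_trans by blast
  obtain S where S: "laurent d (\<lambda>t. cnj (f t)) S" "adjoint_pair T S"
    using laurent_cnj[OF assms(1)] by blast
  have "norm (S o\<^sub>L T) \<le> C * C"
  proof (rule le_of_pow2_le_linear)
    show "norm (S o\<^sub>L T) ^ 2 ^ n \<le> (2 * real (d + d) * 2 ^ n + 1) * (C * C) ^ 2 ^ n" for n
      by (rule laurent_self_adjoint_bound[OF laurent_mult[OF S(1) assms(1)]])
        (use assms(2) C S(2) in \<open>auto simp: norm_mult adjoint_pair_sym intro!: mult_mono adjoint_pair_compose\<close>)
  qed (use C in auto)
  then have "(norm T)\<^sup>2 \<le> C\<^sup>2"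
    using norm_square_le_adjoint[OF S(2)] by (simp add: power2_eq_square)
  then show ?thesis by (rule power2_le_imp_le) (fact C)
qed

end

section \<open>Continuous extension from Laurent polynomials to \<open>C0\<close>\<close>

lemma adjoint_pair_norm_le:
  assumes "adjoint_pair T S"
  shows "norm S \<le> norm T"
proof (cases "norm S = 0")
  case False
  have "(norm S)\<^sup>2 \<le> norm (T o\<^sub>L S)"
    by (rule norm_square_le_adjoint[OF adjoint_pair_sym[OF assms]])
  also have "\<dots> \<le> norm T * norm S" by (rule norm_blinfun_compose)
  finally show ?thesis using False by (simp add: power2_eq_square)
qed simp

lemma adjoint_pair_diff:
  "adjoint_pair T S \<Longrightarrow> adjoint_pair T' S' \<Longrightarrow> adjoint_pair (T - T') (S - S')"
  by (simp add: adjoint_pair_def blinfun.diff_left inner_diff_left inner_diff_right)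

lemma bounded_of_C0: "f \<in> C0 \<Longrightarrow> bounded (range f)"
  by (rule C0_bounded[of f], assumption) (auto simp: bounded_iff)

context unitary
begin

lemma laurent_zpow:
  assumes "k \<in> {- int d..int d}"
  shows "laurent d (\<lambda>t. cayley t powi k) (zpow k)"
proof -
  define c where "c j = (if j = k then 1 else 0 :: complex)" for j
  have "c j * x = (if j = k then x else 0)" "c j *\<^sub>C y = (if j = k then y else 0)" for j x y
    by (simp_all add: c_def)
  then have "(\<lambda>t. cayley t powi k) = laurent_fun d c" "zpow k = laurent_op d c"
    using assms by (auto simp: laurent_fun_def laurent_op_apply intro!: blinfun_eqI)
  then show ?thesis by (auto simp: laurent_def)
qed

text \<open>The closure of the graph of \<open>f \<mapsto> f(U)\<close> in uniform and operator
  norm. It is not confined to \<open>C0\<close>: Laurent polynomials may have a nonzero limit at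
  infinity, and the powers of the Cayley transform do.\<close>

definition approximable :: "(real \<Rightarrow> complex) \<Rightarrow> (l2 \<Rightarrow>\<^sub>L l2) \<Rightarrow> bool" where
  "approximable f T \<longleftrightarrow> (\<exists>d g S. (\<forall>n::nat. laurent (d n) (g n) (S n)) \<and>
     uniform_limit UNIV g f sequentially \<and> S \<longlonglongrightarrow> T)"

lemma approximableE:
  assumes "approximable f T"
  obtains d g S where "\<And>n::nat. laurent (d n) (g n) (S n)" "uniform_limit UNIV g f sequentially" "S \<longlonglongrightarrow> T"
  using assms unfolding approximable_def by blast

lemma approximableD:
  assumes "approximable f T" "e > 0"
  obtains d g S where "laurent d g S" "\<And>t. norm (f t - g t) \<le> e" "norm (T - S) \<le> e"
proof -
  obtain d g S where *: "\<And>n::nat. laurent (d n) (g n) (S n)" "uniform_limit UNIV g f sequentially" "S \<longlonglongrightarrow> T"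
    using assms(1) by (rule approximableE) blast
  have "\<forall>\<^sub>F n in sequentially. (\<forall>t. dist (g n t) (f t) < e) \<and> dist (S n) T < e"
    using *(2,3) assms(2) by (auto simp: uniform_limit_iff tendsto_iff intro: eventually_conj)
  then obtain n where "\<forall>t. dist (g n t) (f t) < e" "dist (S n) T < e"
    by (auto dest: eventually_happens)
  then show ?thesis
    using that[OF *(1)[of n]] by (simp add: dist_norm norm_minus_commute less_imp_le)
qed

text \<open>The contraction \<open>laurent_bound\<close> survives the closure. With
  \<open>e = 0\<close> it makes \<open>T\<close> a function of \<open>f\<close>, and in general it
  turns uniformly Cauchy symbols into Cauchy operators.\<close>

lemma approximable_dist:
  assumes "approximable f T" "approximable g S" "\<And>t. norm (f t - g t) \<le> e"
  shows "norm (T - S) \<le> e"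
proof (rule field_le_epsilon)
  fix r :: real assume "r > 0"
  \<comment> \<open>The budget \<open>r\<close> is split evenly over two approximation errors of the
    symbols and two of the operators.\<close>
  then have r: "r / 4 > 0" by simp
  obtain d f' T' where f': "laurent d f' T'" "\<And>t. norm (f t - f' t) \<le> r / 4" "norm (T - T') \<le> r / 4"
    using approximableD[OF assms(1) r] by blast
  obtain d' g' S' where g': "laurent d' g' S'" "\<And>t. norm (g t - g' t) \<le> r / 4" "norm (S - S') \<le> r / 4"
    using approximableD[OF assms(2) r] by blast
  have "cscale_blinfun (-1) o\<^sub>L S' = - S'" by (rule blinfun_eqI) (simp add: blinfun.minus_left)
  then have "laurent (max d d') (\<lambda>t. f' t + (-1) * g' t) (T' - S')"
    using laurent_add[OF laurent_mono[OF f'(1)] laurent_mono[OF laurent_scale[OF g'(1), of "-1"]], of "max d d'"]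
    by simp
  moreover have "norm (f' t + (-1) * g' t) \<le> e + r / 2" for t
  proof -
    have "f' t + (-1) * g' t = (f t - g t) - (f t - f' t) + (g t - g' t)" by simp
    also have "norm \<dots> \<le> norm (f t - g t) + norm (f t - f' t) + norm (g t - g' t)"
      using norm_triangle_ineq[of "(f t - g t) - (f t - f' t)" "g t - g' t"]
        norm_triangle_ineq4[of "f t - g t" "f t - f' t"] by linarith
    finally show ?thesis using assms(3)[of t] f'(2)[of t] g'(2)[of t] by linarith
  qed
  ultimately have "norm (T' - S') \<le> e + r / 2" by (rule laurent_bound)
  moreover have "norm (T - S) \<le> norm (T - T') + norm (T' - S') + norm (S - S')"
    using norm_triangle_ineq[of "(T - T') + (T' - S')" "S' - S"] norm_triangle_ineq[of "T - T'" "T' - S'"]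
    by (simp add: norm_minus_commute)
  ultimately show "norm (T - S) \<le> e + r" using f'(3) g'(3) by linarith
qed

lemma approximable_unique: "approximable f T \<Longrightarrow> approximable f S \<Longrightarrow> T = S"
  using approximable_dist[of f T f S 0] by simp

lemma approximable_laurent: "laurent d f T \<Longrightarrow> approximable f T"
  unfolding approximable_def
  by (intro exI[of _ "\<lambda>_. d"] exI[of _ "\<lambda>_. f"] exI[of _ "\<lambda>_. T"]) (auto simp: uniform_limit_iff)

lemma approximable_add:
  assumes "approximable f T" "approximable g S"
  shows "approximable (\<lambda>t. f t + g t) (T + S)"
proof -
  obtain d f' T' where f': "\<And>n::nat. laurent (d n) (f' n) (T' n)" "uniform_limit UNIV f' f sequentially" "T' \<longlonglongrightarrow> T"
    using assms(1) by (rule approximableE) blast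
  obtain e g' S' where g': "\<And>n::nat. laurent (e n) (g' n) (S' n)" "uniform_limit UNIV g' g sequentially" "S' \<longlonglongrightarrow> S"
    using assms(2) by (rule approximableE) blast
  have "laurent (max (d n) (e n)) (\<lambda>t. f' n t + g' n t) (T' n + S' n)" for n
    by (intro laurent_add laurent_mono[OF f'(1)] laurent_mono[OF g'(1)]) auto
  moreover have "uniform_limit UNIV (\<lambda>n t. f' n t + g' n t) (\<lambda>t. f t + g t) sequentially"
    by (intro uniform_limit_add f' g')
  moreover have "(\<lambda>n. T' n + S' n) \<longlonglongrightarrow> T + S" by (intro tendsto_add f' g')
  ultimately show ?thesis
    unfolding approximable_def
    by (intro exI[of _ "\<lambda>n. max (d n) (e n)"] exI[of _ "\<lambda>n t. f' n t + g' n t"]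
        exI[of _ "\<lambda>n. T' n + S' n"]) blast
qed

text \<open>Uniform limits may be multiplied when the limit functions are bounded; membership in
  \<open>C0\<close> supplies this.\<close>

lemma approximable_mult:
  assumes "approximable f T" "approximable g S" "f \<in> C0" "g \<in> C0"
  shows "approximable (\<lambda>t. f t * g t) (T o\<^sub>L S)"
proof -
  obtain d f' T' where f': "\<And>n::nat. laurent (d n) (f' n) (T' n)" "uniform_limit UNIV f' f sequentially" "T' \<longlonglongrightarrow> T"
    using assms(1) by (rule approximableE) blast
  obtain e g' S' where g': "\<And>n::nat. laurent (e n) (g' n) (S' n)" "uniform_limit UNIV g' g sequentially" "S' \<longlonglongrightarrow> S"
    using assms(2) by (rule approximableE) blast
  have "uniform_limit UNIV (\<lambda>n t. f' n t * g' n t) (\<lambda>t. f t * g t) sequentially"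
    by (intro uniform_lim_mult f' g' bounded_of_C0 assms)
  moreover have "(\<lambda>n. T' n o\<^sub>L S' n) \<longlonglongrightarrow> (T o\<^sub>L S)"
    by (intro bounded_bilinear.tendsto[OF bounded_bilinear_blinfun_compose] f' g')
  ultimately show ?thesis
    unfolding approximable_def
    by (intro exI[of _ "\<lambda>n. d n + e n"] exI[of _ "\<lambda>n t. f' n t * g' n t"]
        exI[of _ "\<lambda>n. T' n o\<^sub>L S' n"]) (auto intro: laurent_mult f' g')
qed

lemma approximable_scale:
  assumes "approximable f T"
  shows "approximable (\<lambda>t. a * f t) (cscale_blinfun a o\<^sub>L T)"
proof -
  obtain d f' T' where f': "\<And>n::nat. laurent (d n) (f' n) (T' n)" "uniform_limit UNIV f' f sequentially" "T' \<longlonglongrightarrow> T"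
    using assms(1) by (rule approximableE) blast
  have "uniform_limit UNIV (\<lambda>n t. a * f' n t) (\<lambda>t. a * f t) sequentially"
    by (rule bounded_linear.uniform_limit[OF bounded_linear_mult_right f'(2)])
  moreover have "(\<lambda>n. cscale_blinfun a o\<^sub>L T' n) \<longlonglongrightarrow> (cscale_blinfun a o\<^sub>L T)"
    by (intro bounded_bilinear.tendsto[OF bounded_bilinear_blinfun_compose] f' tendsto_const)
  ultimately show ?thesis
    unfolding approximable_def
    by (intro exI[of _ d] exI[of _ "\<lambda>n t. a * f' n t"]
        exI[of _ "\<lambda>n. cscale_blinfun a o\<^sub>L T' n"]) (auto intro: laurent_scale f')
qed

lemma approximable_cscale:
  assumes "approximable f T"
  shows "T (a *\<^sub>C v) = a *\<^sub>C T v"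
proof -
  obtain d f' T' where f': "\<And>n::nat. laurent (d n) (f' n) (T' n)" "uniform_limit UNIV f' f sequentially" "T' \<longlonglongrightarrow> T"
    using assms(1) by (rule approximableE) blast
  have "(\<lambda>n. T' n (a *\<^sub>C v)) \<longlonglongrightarrow> T (a *\<^sub>C v)" "(\<lambda>n. T' n v) \<longlonglongrightarrow> T v"
    by (intro blinfun.tendsto f' tendsto_const)+
  moreover have "(\<lambda>n. T' n (a *\<^sub>C v)) = (\<lambda>n. a *\<^sub>C T' n v)"
    using laurent_op_cscale[OF f'(1)] by simp
  ultimately show ?thesis
    using LIMSEQ_unique bounded_linear.tendsto[OF bounded_linear_cscale] by metis
qed

text \<open>The adjoint is built as a limit: the adjoints of the approximating Laurent operators
  form a Cauchy sequence because passing to adjoints does not increase the norm of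
  differences.\<close>

lemma approximable_cnj:
  assumes "approximable f T"
  obtains S where "approximable (\<lambda>t. cnj (f t)) S" "adjoint_pair T S"
proof -
  obtain d f' T' where f': "\<And>n::nat. laurent (d n) (f' n) (T' n)" "uniform_limit UNIV f' f sequentially" "T' \<longlonglongrightarrow> T"
    using assms(1) by (rule approximableE) blast
  have "\<forall>n. \<exists>S. laurent (d n) (\<lambda>t. cnj (f' n t)) S \<and> adjoint_pair (T' n) S"
    using laurent_cnj[OF f'(1)] by metis
  then obtain S' where S': "\<And>n. laurent (d n) (\<lambda>t. cnj (f' n t)) (S' n)"
      "\<And>n. adjoint_pair (T' n) (S' n)" by metis
  have "Cauchy T'" using f'(3) by (rule LIMSEQ_imp_Cauchy)
  have "Cauchy S'"
    unfolding Cauchy_def dist_norm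
  proof (intro allI impI)
    fix e :: real assume "e > 0"
    then obtain N where "\<And>m n. m \<ge> N \<Longrightarrow> n \<ge> N \<Longrightarrow> norm (T' m - T' n) < e"
      using \<open>Cauchy T'\<close> unfolding Cauchy_def dist_norm by blast
    then show "\<exists>N. \<forall>m\<ge>N. \<forall>n\<ge>N. norm (S' m - S' n) < e"
      using adjoint_pair_norm_le[OF adjoint_pair_diff[OF S'(2) S'(2)]] by (meson le_less_trans)
  qed
  then obtain S where S: "S' \<longlonglongrightarrow> S" by (auto simp: Cauchy_convergent_iff convergent_def)
  have "uniform_limit UNIV (\<lambda>n t. cnj (f' n t)) (\<lambda>t. cnj (f t)) sequentially"
    by (rule bounded_linear.uniform_limit[OF bounded_linear_cnj f'(2)])
  then have "approximable (\<lambda>t. cnj (f t)) S"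
    unfolding approximable_def
    by (intro exI[of _ d] exI[of _ "\<lambda>n t. cnj (f' n t)"] exI[of _ S']) (auto intro: S' S)
  moreover have "adjoint_pair T S"
    unfolding adjoint_pair_def
  proof (intro allI)
    fix v w
    have "(\<lambda>n. inner (T' n v) w) \<longlonglongrightarrow> inner (T v) w" "(\<lambda>n. inner v (S' n w)) \<longlonglongrightarrow> inner v (S w)"
      by (intro tendsto_inner blinfun.tendsto f' S tendsto_const)+
    moreover have "(\<lambda>n. inner (T' n v) w) = (\<lambda>n. inner v (S' n w))"
      using S'(2) by (simp add: adjoint_pair_def)
    ultimately show "inner (T v) w = inner v (S w)" using LIMSEQ_unique by metis
  qed
  ultimately show ?thesis by (rule that)
qed

text \<open>Completeness of the space of bounded operators: Laurent approximants of \<open>f\<close>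
  have operators that are Cauchy by \<open>approximable_dist\<close>.\<close>

lemma approximable_limit:
  assumes "\<And>e. e > 0 \<Longrightarrow> \<exists>g S. approximable g S \<and> (\<forall>t. norm (f t - g t) \<le> e)"
  shows "\<exists>T. approximable f T"
proof -
  define \<epsilon> where "\<epsilon> n = 1 / real (Suc n)" for n
  have \<epsilon>: "\<epsilon> n > 0" for n by (simp add: \<epsilon>_def)
  have \<epsilon>_lim: "\<epsilon> \<longlonglongrightarrow> 0" unfolding \<epsilon>_def by (rule LIMSEQ_Suc[OF lim_1_over_n])
  have "\<exists>d g S. laurent d g S \<and> (\<forall>t. norm (f t - g t) \<le> \<epsilon> n)" for n
  proof -
    have \<epsilon>2: "\<epsilon> n / 2 > 0" using \<epsilon>[of n] by simp
    then obtain g S where g: "approximable g S" "\<And>t. norm (f t - g t) \<le> \<epsilon> n / 2"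
      using assms by blast
    obtain d g' S' where g': "laurent d g' S'" "\<And>t. norm (g t - g' t) \<le> \<epsilon> n / 2"
      by (rule approximableD[OF g(1) \<epsilon>2]) metis
    have "norm (f t - g' t) \<le> \<epsilon> n" for t
      using norm_triangle_ineq[of "f t - g t" "g t - g' t"] g(2)[of t] g'(2)[of t] by simp
    with g' show ?thesis by blast
  qed
  then obtain d g S where g: "\<And>n. laurent (d n) (g n) (S n)" "\<And>n t. norm (f t - g n t) \<le> \<epsilon> n"
    by metis
  have dist: "norm (S m - S n) \<le> \<epsilon> m + \<epsilon> n" for m n
  proof (rule approximable_dist[OF approximable_laurent[OF g(1)] approximable_laurent[OF g(1)]])
    show "norm (g m t - g n t) \<le> \<epsilon> m + \<epsilon> n" for t
      using norm_triangle_ineq4[of "f t - g n t" "f t - g m t"] g(2)[of t n] g(2)[of t m] by simp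
  qed
  have "Cauchy S"
    unfolding Cauchy_def dist_norm
  proof (intro allI impI)
    fix e :: real assume "e > 0"
    then have "\<forall>\<^sub>F n in sequentially. \<epsilon> n < e / 2" by (intro order_tendstoD(2)[OF \<epsilon>_lim]) simp
    then obtain N where "\<And>n. n \<ge> N \<Longrightarrow> \<epsilon> n < e / 2" by (auto simp: eventually_sequentially)
    then show "\<exists>N. \<forall>m\<ge>N. \<forall>n\<ge>N. norm (S m - S n) < e"
      using dist by (intro exI[of _ N]) (smt (verit) field_sum_of_halves)
  qed
  then obtain T where T: "S \<longlonglongrightarrow> T" by (auto simp: Cauchy_convergent_iff convergent_def)
  have "uniform_limit UNIV g f sequentially"
    unfolding uniform_limit_iff
  proof (intro allI impI)
    fix e :: real assume "e > 0"
    then have "\<forall>\<^sub>F n in sequentially. \<epsilon> n < e" by (intro order_tendstoD(2)[OF \<epsilon>_lim]) simp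
    then show "\<forall>\<^sub>F n in sequentially. \<forall>t\<in>UNIV. dist (g n t) (f t) < e"
      by eventually_elim (metis g(2) dist_norm norm_minus_commute le_less_trans)
  qed
  with g(1) T show ?thesis unfolding approximable_def by blast
qed

text \<open>\<open>V\<close> has the symbol \<open>(t + \<i>) / (t - \<i>)\<close>, and subtracting
  1 leaves \<open>2 * \<i> / (t - \<i>)\<close>.\<close>

lemma approximable_resolvent:
  "approximable (\<lambda>t. 1 / (of_real t - \<i>)) (cscale_blinfun (1 / (2 * \<i>)) o\<^sub>L (V - id_blinfun))"
proof -
  have "cscale_blinfun (-1) o\<^sub>L id_blinfun = - (id_blinfun :: l2 \<Rightarrow>\<^sub>L l2)"
    by (rule blinfun_eqI) (simp add: blinfun.minus_left)
  then have "laurent 1 (\<lambda>t. 1 / (2 * \<i>) * (cayley t powi (-1) + (-1) * cayley t powi 0))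
      (cscale_blinfun (1 / (2 * \<i>)) o\<^sub>L (V - id_blinfun))"
    using laurent_scale[OF laurent_add[OF laurent_zpow[of "-1" 1] laurent_scale[OF laurent_zpow[of 0 1]]],
        of "1 / (2 * \<i>)" "-1"]
    by (simp add: zpow_minus_1)
  moreover have "1 / (2 * \<i>) * (cayley t powi (-1) + (-1) * cayley t powi 0) = 1 / (of_real t - \<i>)" for t
  proof -
    have "cayley t powi (-1) - 1 = 2 * \<i> / (of_real t - \<i>)"
      using of_real_pm_ii_neq_0(1)[of t]
      by (simp add: cayley_def divide_simps del: of_real_pm_ii_neq_0)
    then show ?thesis by simp
  qed
  ultimately show ?thesis by (auto dest: approximable_laurent)
qed

lemma C0_approximable: "f \<in> C0 \<Longrightarrow> \<exists>T. approximable f T"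
proof (induction f rule: C0_induct)
  case resolvent
  show ?case by (rule exI, rule approximable_resolvent)
next
  case (add f g)
  then show ?case using approximable_add by metis
next
  case (scale c f)
  then show ?case using approximable_scale by metis
next
  case (mult f g)
  then show ?case using approximable_mult by metis
next
  case (cnj f)
  then show ?case using approximable_cnj by metis
next
  case (limit f)
  then show ?case by (intro approximable_limit) blast
qed

definition calc :: "(real \<Rightarrow> complex) \<Rightarrow> (l2 \<Rightarrow>\<^sub>L l2)" where
  "calc f = (THE T. approximable f T)"

lemma calc_eq: "approximable f T \<Longrightarrow> calc f = T"
  unfolding calc_def using approximable_unique by blast

lemma approximable_calc: "f \<in> C0 \<Longrightarrow> approximable f (calc f)"
  using C0_approximable calc_eq by metis

end

section \<open>From the resolvents at \<plusminus>\<i> to the functional calculus\<close>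

lemma cinner_conv_inner: "cinner v w = complex_of_real (inner v w) + \<i> * complex_of_real (inner (- \<i> *\<^sub>C v) w)"
  by (simp add: complex_eq_iff inner_conv_cinner[symmetric] Im_cinner)

text \<open>\<open>U = (h - \<i>) (h + \<i>)\<inverse>\<close> and
  \<open>V = (h + \<i>) (h - \<i>)\<inverse>\<close>, written with resolvents so that only bounded
  operators occur. The resolvent identity between \<i> and -\<i>, in both orders, makes them inverse
  to each other.\<close>

lemma functional_calculus_exists:
  assumes Rp: "is_resolvent h \<i> Rp" and Rm: "is_resolvent h (- \<i>) Rm"
    and Rp_cscale: "\<And>c v. Rp (c *\<^sub>C v) = c *\<^sub>C Rp v" and Rm_cscale: "\<And>c v. Rm (c *\<^sub>C v) = c *\<^sub>C Rm v"
    and adj: "adjoint_pair Rp Rm"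
  shows "\<exists>\<Phi>. is_functional_calculus h \<Phi>"
proof -
  define U where "U = id_blinfun - (cscale_blinfun (2 * \<i>) o\<^sub>L Rm)"
  define V where "V = id_blinfun + (cscale_blinfun (2 * \<i>) o\<^sub>L Rp)"
  have U: "U v = v - (2 * \<i>) *\<^sub>C Rm v" and V: "V v = v + (2 * \<i>) *\<^sub>C Rp v" for v
    by (simp_all add: U_def V_def blinfun.bilinear_simps)
  have double: "(2 * \<i>) *\<^sub>C x = \<i> *\<^sub>C x + \<i> *\<^sub>C x" for x
    by (simp flip: l2.scale_left_distrib)
  have id1: "Rp w = Rm w + (2 * \<i>) *\<^sub>C Rm (Rp w)" for w
  proof -
    have "(Rp w, w + \<i> *\<^sub>C Rp w) \<in> h" using Rp by (simp add: is_resolvent_def)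
    moreover have "w + \<i> *\<^sub>C Rp w = (w + (2 * \<i>) *\<^sub>C Rp w) + (- \<i>) *\<^sub>C Rp w"
      by (simp add: double)
    ultimately have "Rp w = Rm (w + (2 * \<i>) *\<^sub>C Rp w)" using Rm unfolding is_resolvent_def by metis
    then show ?thesis by (simp add: blinfun.add_right Rm_cscale)
  qed
  have id2: "Rm w = Rp w - (2 * \<i>) *\<^sub>C Rp (Rm w)" for w
  proof -
    have "(Rm w, w + (- \<i>) *\<^sub>C Rm w) \<in> h" using Rm by (simp add: is_resolvent_def)
    moreover have "w + (- \<i>) *\<^sub>C Rm w = (w - (2 * \<i>) *\<^sub>C Rm w) + \<i> *\<^sub>C Rm w"
      by (simp add: double)
    ultimately have "Rm w = Rp (w - (2 * \<i>) *\<^sub>C Rm w)" using Rp unfolding is_resolvent_def by metis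
    then show ?thesis by (simp add: blinfun.diff_right Rp_cscale)
  qed
  interpret unitary U V
  proof
    show "U o\<^sub>L V = id_blinfun"
    proof (rule blinfun_eqI)
      fix v
      have "(U o\<^sub>L V) v = v + (2 * \<i>) *\<^sub>C (Rp v - (Rm v + (2 * \<i>) *\<^sub>C Rm (Rp v)))"
        by (simp add: U V blinfun.bilinear_simps Rm_cscale l2.scale_right_distrib l2.scale_right_diff_distrib)
      then show "(U o\<^sub>L V) v = id_blinfun v" by (simp add: id1[symmetric])
    qed
    show "V o\<^sub>L U = id_blinfun"
    proof (rule blinfun_eqI)
      fix v
      have "(V o\<^sub>L U) v = v + (2 * \<i>) *\<^sub>C ((Rp v - (2 * \<i>) *\<^sub>C Rp (Rm v)) - Rm v)"
        by (simp add: U V blinfun.bilinear_simps Rp_cscale l2.scale_right_distrib l2.scale_right_diff_distrib)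
      then show "(V o\<^sub>L U) v = id_blinfun v" by (simp add: id2[symmetric])
    qed
    show "U (c *\<^sub>C v) = c *\<^sub>C U v" "V (c *\<^sub>C v) = c *\<^sub>C V v" for c v
      by (simp_all add: U V Rp_cscale Rm_cscale l2.scale_right_distrib l2.scale_right_diff_distrib mult.commute)
    have "inner (Rm v) w = inner v (Rp w)" for v w
      using adj by (metis adjoint_pair_def inner_commute)
    then have "inner ((2 * \<i>) *\<^sub>C Rm v) w = - inner v ((2 * \<i>) *\<^sub>C Rp w)" for v w
      by (simp add: inner_cscale_left Rp_cscale)
    then show "adjoint_pair U V"
      by (simp add: adjoint_pair_def U V inner_diff_left inner_add_right)
  qed
  have calc_ii: "calc (\<lambda>t. 1 / (of_real t - \<i>)) = Rp"
  proof -
    have "cscale_blinfun (1 / (2 * \<i>)) o\<^sub>L (V - id_blinfun) = Rp"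
      by (rule blinfun_eqI) (simp add: V blinfun.bilinear_simps)
    then show ?thesis using calc_eq[OF approximable_resolvent] by simp
  qed
  have resolvent: "is_resolvent h z (calc (\<lambda>t. 1 / (of_real t - z)))" if z: "Im z \<noteq> 0" for z
  proof -
    define r where "r z = (\<lambda>t. 1 / (complex_of_real t - z))" for z
    have r: "r z \<in> C0" "r \<i> \<in> C0" using z by (simp_all add: r_def C0_inverse_affine)
    define R where "R = calc (r z)"
    \<comment> \<open>The construction yields the resolvent at \<i> directly; other points come from
      the resolvent identity. The factor order in \<open>R1\<close> shows that a solution must be
      \<open>R w\<close>, the order in \<open>R2\<close> that \<open>R w\<close> is a
      solution.\<close>
    have eq: "r z t = r \<i> t + (z - \<i>) * (r z t * r \<i> t)" "r z t = r \<i> t + (z - \<i>) * (r \<i> t * r z t)" for t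
      using of_real_diff_neq_0[OF z, of t] of_real_pm_ii_neq_0(1)[of t]
      by (simp_all add: r_def divide_simps del: of_real_pm_ii_neq_0)
    have Ri: "approximable (r \<i>) Rp" and Rz: "approximable (r z) R"
      using approximable_calc[OF r(2)] approximable_calc[OF r(1)] calc_ii by (simp_all add: r_def R_def)
    have "approximable (r z) (Rp + (cscale_blinfun (z - \<i>) o\<^sub>L (R o\<^sub>L Rp)))"
      using approximable_add[OF Ri approximable_scale[OF approximable_mult[OF Rz Ri r], of "z - \<i>"]]
      by (simp only: eq(1)[symmetric])
    then have eqR: "R = Rp + (cscale_blinfun (z - \<i>) o\<^sub>L (R o\<^sub>L Rp))"
      using Rz approximable_unique by blast
    have R1: "R w = Rp w + (z - \<i>) *\<^sub>C R (Rp w)" for w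
    proof -
      have "R w = (Rp + (cscale_blinfun (z - \<i>) o\<^sub>L (R o\<^sub>L Rp))) w"
        by (rule arg_cong[OF eqR, where f="\<lambda>T. blinfun_apply T w"])
      also have "\<dots> = Rp w + (z - \<i>) *\<^sub>C R (Rp w)"
        by (simp only: blinfun.add_left blinfun_apply_blinfun_compose cscale_blinfun_apply)
      finally show ?thesis .
    qed
    have "approximable (r z) (Rp + (cscale_blinfun (z - \<i>) o\<^sub>L (Rp o\<^sub>L R)))"
      using approximable_add[OF Ri approximable_scale[OF approximable_mult[OF Ri Rz r(2,1)], of "z - \<i>"]]
      by (simp only: eq(2)[symmetric])
    then have eqR: "R = Rp + (cscale_blinfun (z - \<i>) o\<^sub>L (Rp o\<^sub>L R))"
      using Rz approximable_unique by blast
    have R2: "R w = Rp w + (z - \<i>) *\<^sub>C Rp (R w)" for w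
    proof -
      have "R w = (Rp + (cscale_blinfun (z - \<i>) o\<^sub>L (Rp o\<^sub>L R))) w"
        by (rule arg_cong[OF eqR, where f="\<lambda>T. blinfun_apply T w"])
      also have "\<dots> = Rp w + (z - \<i>) *\<^sub>C Rp (R w)"
        by (simp only: blinfun.add_left blinfun_apply_blinfun_compose cscale_blinfun_apply)
      finally show ?thesis .
    qed
    have "(u, w + z *\<^sub>C u) \<in> h \<longleftrightarrow> u = R w" for u w
    proof -
      have "w + z *\<^sub>C u = (w + (z - \<i>) *\<^sub>C u) + \<i> *\<^sub>C u"
        by (simp add: add.assoc flip: l2.scale_left_distrib)
      then have "(u, w + z *\<^sub>C u) \<in> h \<longleftrightarrow> u = Rp (w + (z - \<i>) *\<^sub>C u)"
        using Rp unfolding is_resolvent_def by metis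
      also have "\<dots> \<longleftrightarrow> u = R w"
      proof
        assume u: "u = Rp (w + (z - \<i>) *\<^sub>C u)"
        have "R w + (z - \<i>) *\<^sub>C R u = R (w + (z - \<i>) *\<^sub>C u)"
          by (simp add: blinfun.add_right approximable_cscale[OF Rz])
        also have "\<dots> = u + (z - \<i>) *\<^sub>C R u"
          using R1[of "w + (z - \<i>) *\<^sub>C u"] unfolding u[symmetric] .
        finally show "u = R w" by simp
      next
        assume "u = R w"
        then show "u = Rp (w + (z - \<i>) *\<^sub>C u)"
          using R2[of w] by (simp add: blinfun.add_right Rp_cscale)
      qed
      finally show ?thesis .
    qed
    then show ?thesis by (simp add: is_resolvent_def R_def r_def)
  qed
  have "is_functional_calculus h calc"
    unfolding is_functional_calculus_def
  proof (intro conjI ballI allI impI resolvent)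
    fix f :: "real \<Rightarrow> complex" and c v assume f: "f \<in> C0"
    note a = approximable_calc[OF f]
    show "calc f (c *\<^sub>C v) = c *\<^sub>C calc f v" by (rule approximable_cscale[OF a])
    show "calc (\<lambda>t. c * f t) v = c *\<^sub>C calc f v" by (simp add: calc_eq[OF approximable_scale[OF a]])
    fix w
    obtain S where S: "approximable (\<lambda>t. cnj (f t)) S" "adjoint_pair (calc f) S"
      using approximable_cnj[OF a] by blast
    have "inner (S v) w = inner v (calc f w)" for v w
      using adjoint_pair_sym[OF S(2)] by (simp add: adjoint_pair_def)
    \<comment> \<open>Complex linearity of \<open>S\<close> moves the factor -\<i> through it, so
      the real adjoint relation also gives the imaginary part.\<close>
    then show "cinner (calc (\<lambda>t. cnj (f t)) v) w = cinner v (calc f w)"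
      unfolding calc_eq[OF S(1)] cinner_conv_inner
      by (simp flip: approximable_cscale[OF S(1)])
  next
    fix f g :: "real \<Rightarrow> complex" assume "f \<in> C0" "g \<in> C0"
    then show "calc (\<lambda>t. f t + g t) = calc f + calc g" "calc (\<lambda>t. f t * g t) = calc f o\<^sub>L calc g"
      by (simp_all add: calc_eq[OF approximable_add] calc_eq[OF approximable_mult] approximable_calc)
  qed
  then show ?thesis by blast
qed

text \<open>The basic criterion for self-adjointness of a closed symmetric operator. Density of the
  ranges is asked instead of surjectivity because density can be checked on a core; surjectivity is
  \<open>range_complete\<close>.\<close>

locale essentially_selfadjoint =
  fixes h :: l2_operator
  assumes closed_graph: "closed h"
    and graph_add: "(u, y) \<in> h \<Longrightarrow> (u', y') \<in> h \<Longrightarrow> (u + u', y + y') \<in> h"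
    and graph_cscale: "(u, y) \<in> h \<Longrightarrow> (c *\<^sub>C u, c *\<^sub>C y) \<in> h"
    and symmetric: "(u, y) \<in> h \<Longrightarrow> (u', y') \<in> h \<Longrightarrow> cinner y u' = cinner u y'"
    and dense_range: "z \<in> {\<i>, - \<i>} \<Longrightarrow> e > 0 \<Longrightarrow> \<exists>u y. (u, y) \<in> h \<and> norm (y - z *\<^sub>C u - w) < e"
begin

lemma graph_diff: "(u, y) \<in> h \<Longrightarrow> (u', y') \<in> h \<Longrightarrow> (u - u', y - y') \<in> h"
  using graph_add[OF _ graph_cscale[of u' y' "-1"]] by simp

text \<open>Symmetry makes \<open>cinner y u\<close> real, so the cross term with \<plusminus>\<i>
  disappears. Hence \<open>h - z\<close> is injective with closed range, and its inverse is a
  contraction.\<close>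

lemma norm_graph:
  assumes "(u, y) \<in> h" and z: "z \<in> {\<i>, - \<i>}"
  shows "(norm (y - z *\<^sub>C u))\<^sup>2 = (norm y)\<^sup>2 + (norm u)\<^sup>2"
proof -
  have "cinner y u = cnj (cinner y u)"
    using symmetric[OF assms(1) assms(1)] cinner_commute[of u y] by simp
  then have "Im (cinner y u) = 0" by (simp add: complex_eq_iff)
  then have "inner y (z *\<^sub>C u) = 0"
    using z by (auto simp: inner_conv_cinner cinner_cscale_right)
  moreover have "norm (z *\<^sub>C u) = norm u" using z by auto
  ultimately have "0 = ((norm y)\<^sup>2 + (norm u)\<^sup>2 - (norm (y - z *\<^sub>C u))\<^sup>2) / 2"
    using dot_norm_neg[of y "z *\<^sub>C u"] by (simp only:)
  then show ?thesis by simp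
qed

text \<open>If \<open>y n - z *\<^sub>C u n\<close> converges, then by \<open>norm_graph\<close>
  both \<open>u\<close> and \<open>y\<close> are Cauchy, and closedness of the graph captures their
  limit.\<close>

lemma range_complete:
  assumes z: "z \<in> {\<i>, - \<i>}"
  shows "\<exists>!u. (u, w + z *\<^sub>C u) \<in> h"
proof -
  have "\<exists>u y. (u, y) \<in> h \<and> norm (y - z *\<^sub>C u - w) < 1 / real (Suc n)" for n
    by (rule dense_range[OF z]) simp
  then obtain u y where uy: "\<And>n. (u n, y n) \<in> h" "\<And>n. norm (y n - z *\<^sub>C u n - w) < 1 / real (Suc n)"
    by metis
  define x where "x n = y n - z *\<^sub>C u n" for n
  have "(\<lambda>n. norm (x n - w)) \<longlonglongrightarrow> 0"
    by (rule tendsto_sandwich[OF _ _ tendsto_const LIMSEQ_Suc[OF lim_1_over_n]])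
       (use uy(2) in \<open>auto simp: x_def intro!: always_eventually less_imp_le\<close>)
  then have x: "x \<longlonglongrightarrow> w" by (metis LIM_zero_iff tendsto_norm_zero_iff)
  then have Cx: "Cauchy x" by (rule LIMSEQ_imp_Cauchy)
  have le: "norm (u m - u n) \<le> norm (x m - x n)" "norm (y m - y n) \<le> norm (x m - x n)" for m n
  proof -
    have "x m - x n = (y m - y n) - z *\<^sub>C (u m - u n)"
      by (simp add: x_def l2.scale_right_diff_distrib)
    then have "(norm (x m - x n))\<^sup>2 = (norm (y m - y n))\<^sup>2 + (norm (u m - u n))\<^sup>2"
      using norm_graph[OF graph_diff[OF uy(1) uy(1)] z] by simp
    then show "norm (u m - u n) \<le> norm (x m - x n)" "norm (y m - y n) \<le> norm (x m - x n)"
      by (auto intro: power2_le_imp_le)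
  qed
  have "Cauchy u" "Cauchy y"
    using Cx le unfolding Cauchy_def dist_norm by (meson le_less_trans)+
  then obtain u' y' where lim: "u \<longlonglongrightarrow> u'" "y \<longlonglongrightarrow> y'"
    by (auto simp: Cauchy_convergent_iff convergent_def)
  have "(\<lambda>n. (u n, y n)) \<longlonglongrightarrow> (u', y')" by (intro tendsto_Pair lim)
  then have "(u', y') \<in> h"
    using closed_sequentially[OF closed_graph, of "\<lambda>n. (u n, y n)"] uy(1) by simp
  moreover have "x \<longlonglongrightarrow> y' - z *\<^sub>C u'"
    unfolding x_def by (intro tendsto_diff lim bounded_linear.tendsto[OF bounded_linear_cscale])
  then have "w = y' - z *\<^sub>C u'" using x LIMSEQ_unique by blast
  ultimately have u': "(u', w + z *\<^sub>C u') \<in> h" by simp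
  show ?thesis
  proof (rule ex1I[of _ u'])
    show "(u', w + z *\<^sub>C u') \<in> h" by (fact u')
    fix v assume v: "(v, w + z *\<^sub>C v) \<in> h"
    have "(w + z *\<^sub>C v) - (w + z *\<^sub>C u') - z *\<^sub>C (v - u') = 0"
      by (simp add: l2.scale_right_diff_distrib)
    then have "0 = (norm ((w + z *\<^sub>C v) - (w + z *\<^sub>C u')))\<^sup>2 + (norm (v - u'))\<^sup>2"
      using norm_graph[OF graph_diff[OF v u'] z] by (simp only: norm_zero power_zero_numeral)
    then have "(norm (v - u'))\<^sup>2 \<le> 0"
      using zero_le_power2[of "norm ((w + z *\<^sub>C v) - (w + z *\<^sub>C u'))"] by linarith
    then show "v = u'" by simp
  qed
qed

lemma resolvent_exists:
  assumes z: "z \<in> {\<i>, - \<i>}"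
  obtains R where "is_resolvent h z R" "\<And>c v. R (c *\<^sub>C v) = c *\<^sub>C R v"
proof -
  define r where "r w = (THE u. (u, w + z *\<^sub>C u) \<in> h)" for w
  have r: "(u, w + z *\<^sub>C u) \<in> h \<longleftrightarrow> u = r w" for u w
    unfolding r_def using theI'[OF range_complete[OF z, of w]] range_complete[OF z, of w] by blast
  have rh: "(r w, w + z *\<^sub>C r w) \<in> h" for w using r by blast
  have add: "r (v + w) = r v + r w" for v w
    using graph_add[OF rh[of v] rh[of w]] r[of "r v + r w" "v + w"]
    by (simp add: l2.scale_right_distrib add_ac)
  have scale: "r (c *\<^sub>C v) = c *\<^sub>C r v" for c v
    using graph_cscale[OF rh[of v], of c] r[of "c *\<^sub>C r v" "c *\<^sub>C v"]
    by (simp add: l2.scale_right_distrib mult.commute)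
  have "norm (r w) \<le> norm w * 1" for w
  proof -
    have "(norm (r w))\<^sup>2 \<le> (norm w)\<^sup>2" using norm_graph[OF rh[of w] z] by simp
    then show ?thesis by (simp add: power2_le_iff_abs_le)
  qed
  then have "bounded_linear r"
    by (intro bounded_linear_intro[where K=1]) (auto simp: add scaleR_cscale scale)
  then have "blinfun_apply (Blinfun r) = r" by (rule bounded_linear_Blinfun_apply)
  then show ?thesis by (intro that[of "Blinfun r"]) (auto simp: is_resolvent_def r scale)
qed

lemma functional_calculus_exists: "\<exists>\<Phi>. is_functional_calculus h \<Phi>"
proof -
  obtain Rp where Rp: "is_resolvent h \<i> Rp" "\<And>c v. Rp (c *\<^sub>C v) = c *\<^sub>C Rp v"
    using resolvent_exists[of \<i>] by auto
  obtain Rm where Rm: "is_resolvent h (- \<i>) Rm" "\<And>c v. Rm (c *\<^sub>C v) = c *\<^sub>C Rm v"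
    using resolvent_exists[of "- \<i>"] by auto
  have "inner (Rp v) w = inner v (Rm w)" for v w
  proof -
    have "(Rp v, v + \<i> *\<^sub>C Rp v) \<in> h" "(Rm w, w + (- \<i>) *\<^sub>C Rm w) \<in> h"
      using Rp(1) Rm(1) unfolding is_resolvent_def by blast+
    from symmetric[OF this] have "cinner v (Rm w) = cinner (Rp v) w"
      by (simp add: cinner_add_left cinner_add_right cinner_cscale_left cinner_cscale_right
          del: l2.scale_minus_left)
    then show ?thesis by (simp add: inner_conv_cinner)
  qed
  then have "adjoint_pair Rp Rm" by (simp add: adjoint_pair_def)
  with Rp Rm show ?thesis by (intro functional_calculus_exists)
qed

end

section \<open>The common core of position and momentum\<close>

declare One_nat_def [simp del] \<comment> \<open>it would rewrite \<open>nth_derivative 1\<close>\<close>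

section \<open>Domination in L2\<close>

lemma square_integrable_measurable [measurable_dest]: "square_integrable f \<Longrightarrow> f \<in> borel_measurable borel"
  by (simp add: square_integrable_def)

lemma square_integrable_bound:
  assumes D: "square_integrable D" and f: "f \<in> borel_measurable borel" and le: "\<And>t. norm (f t) \<le> norm (D t)"
  shows "square_integrable f"
  unfolding square_integrable_def
proof
  show "integrable lborel (\<lambda>t. (norm (f t))\<^sup>2)"
  proof (rule Bochner_Integration.integrable_bound)
    show "integrable lborel (\<lambda>t. (norm (D t))\<^sup>2)" using D by (simp add: square_integrable_def)
    show "(\<lambda>t. (norm (f t))\<^sup>2) \<in> borel_measurable lborel" using f by measurable
    show "AE t in lborel. norm ((norm (f t))\<^sup>2) \<le> norm ((norm (D t))\<^sup>2)"
      using le by (intro AE_I2) (simp add: power_mono)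
  qed
qed (use f in simp)

lemma square_integrable_bounded_mult:
  assumes f: "square_integrable f" and g: "g \<in> borel_measurable borel" and bound: "\<And>t. norm (g t) \<le> B"
  shows "square_integrable (\<lambda>t. g t * f t)"
proof (rule square_integrable_bound[OF square_integrable_cmult[OF f, of "of_real B"]])
  show "(\<lambda>t. g t * f t) \<in> borel_measurable borel"
    using g square_integrable_measurable[OF f] by measurable
  show "norm (g t * f t) \<le> norm (of_real B * f t)" for t
    using bound[of t] by (auto simp: norm_mult intro!: mult_right_mono)
qed

lemma norm_abs_l2_bounded_mult:
  assumes f: "square_integrable f" and g: "g \<in> borel_measurable borel" and bound: "\<And>t. norm (g t) \<le> B"
  shows "norm (abs_l2 (\<lambda>t. g t * f t)) \<le> B * norm (abs_l2 f)"
proof -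
  have B: "B \<ge> 0" using bound[of 0] norm_ge_zero order_trans by blast
  note gf = square_integrable_bounded_mult[OF assms]
  have "(norm (abs_l2 (\<lambda>t. g t * f t)))\<^sup>2 = (\<integral>t. (norm (g t * f t))\<^sup>2 \<partial>lborel)"
    by (rule norm_abs_l2[OF gf])
  also have "\<dots> \<le> (\<integral>t. B\<^sup>2 * (norm (f t))\<^sup>2 \<partial>lborel)"
  proof (rule integral_mono)
    show "integrable lborel (\<lambda>t. (norm (g t * f t))\<^sup>2)" using gf by (simp add: square_integrable_def)
    show "integrable lborel (\<lambda>t. B\<^sup>2 * (norm (f t))\<^sup>2)" using f by (simp add: square_integrable_def)
    show "(norm (g t * f t))\<^sup>2 \<le> B\<^sup>2 * (norm (f t))\<^sup>2" for t
      using bound[of t] by (auto simp: norm_mult power_mult_distrib intro!: mult_right_mono power_mono)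
  qed
  also have "\<dots> = (B * norm (abs_l2 f))\<^sup>2" by (simp add: norm_abs_l2[OF f] power_mult_distrib)
  finally show ?thesis by (rule power2_le_imp_le) (use B in simp)
qed

lemma l2_dominated_convergence:
  assumes D: "square_integrable D" and f: "\<And>n. f n \<in> borel_measurable borel"
    and le: "\<And>n t. norm (f n t) \<le> norm (D t)" and lim: "\<And>t. (\<lambda>n. f n t) \<longlonglongrightarrow> g t"
  shows "square_integrable g" "(\<lambda>n. abs_l2 (f n)) \<longlonglongrightarrow> abs_l2 g"
proof -
  have g: "g \<in> borel_measurable borel" by (rule borel_measurable_LIMSEQ_metric[OF f lim])
  have gD: "norm (g t) \<le> norm (D t)" for t
    by (rule LIMSEQ_le_const2[OF tendsto_norm[OF lim]]) (use le in auto)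
  show sg: "square_integrable g" by (rule square_integrable_bound[OF D g gD])
  have sf: "square_integrable (f n)" for n by (rule square_integrable_bound[OF D f le])
  have "(\<lambda>n. \<integral>t. (norm (f n t - g t))\<^sup>2 \<partial>lborel) \<longlonglongrightarrow> integral\<^sup>L lborel (\<lambda>t::real. 0 :: real)"
  proof (rule integral_dominated_convergence[where w="\<lambda>t. 4 * (norm (D t))\<^sup>2"])
    show "integrable lborel (\<lambda>t. 4 * (norm (D t))\<^sup>2)" using D by (simp add: square_integrable_def)
    show "(\<lambda>t. (norm (f n t - g t))\<^sup>2) \<in> borel_measurable lborel" for n
      using f g by measurable
    show "AE t in lborel. (\<lambda>n. (norm (f n t - g t))\<^sup>2) \<longlonglongrightarrow> 0"
    proof (rule AE_I2)
      fix t
      have "(\<lambda>n. (norm (f n t - g t))\<^sup>2) \<longlonglongrightarrow> (norm (g t - g t))\<^sup>2"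
        by (intro tendsto_intros lim)
      then show "(\<lambda>n. (norm (f n t - g t))\<^sup>2) \<longlonglongrightarrow> 0" by simp
    qed
    show "AE t in lborel. norm ((norm (f n t - g t))\<^sup>2) \<le> 4 * (norm (D t))\<^sup>2" for n
    proof (rule AE_I2)
      fix t
      have "norm (f n t - g t) \<le> 2 * norm (D t)"
        using norm_triangle_ineq4[of "f n t" "g t"] le[of n t] gD[of t] by linarith
      then have "(norm (f n t - g t))\<^sup>2 \<le> (2 * norm (D t))\<^sup>2" by (intro power_mono) auto
      then show "norm ((norm (f n t - g t))\<^sup>2) \<le> 4 * (norm (D t))\<^sup>2" by (simp add: power_mult_distrib)
    qed
  qed simp
  then have "(\<lambda>n. (norm (abs_l2 (f n) - abs_l2 g))\<^sup>2) \<longlonglongrightarrow> 0"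
    by (simp add: abs_l2_diff sf sg norm_abs_l2[OF square_integrable_diff[OF sf sg]])
  from tendsto_real_sqrt[OF this] have "(\<lambda>n. norm (abs_l2 (f n) - abs_l2 g)) \<longlonglongrightarrow> 0" by simp
  then show "(\<lambda>n. abs_l2 (f n)) \<longlonglongrightarrow> abs_l2 g"
    by (metis LIM_zero_iff tendsto_norm_zero_iff)
qed

section \<open>Rapidly decreasing functions\<close>

lemma integrable_inverse_1_plus_square: "integrable lborel (\<lambda>t::real. 1 / (1 + t\<^sup>2))"
proof -
  have "set_integrable lborel (einterval (-\<infinity>) \<infinity>) (\<lambda>t::real. 1 / (1 + t\<^sup>2))"
  proof (rule interval_integral_FTC_nonneg(1)[where F=arctan and A="- (pi / 2)" and B="pi / 2"])
    show "DERIV arctan t :> 1 / (1 + t\<^sup>2)" for t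
      by (auto intro!: derivative_eq_intros simp: inverse_eq_divide)
    show "isCont (\<lambda>t. 1 / (1 + t\<^sup>2)) t" for t :: real
      by (intro continuous_intros) (simp add: add_nonneg_eq_0_iff)
  qed (auto simp: ereal_tendsto_simps tendsto_arctan_at_bot tendsto_arctan_at_top)
  then show ?thesis by (simp add: set_integrable_def einterval_eq_UNIV)
qed

text \<open>Bounds for every power replace the L2 and \<open>C0\<close> conditions in
  \<open>D0\<close>: one extra power gives decay at infinity, two extra powers give square
  integrability.\<close>

definition rapid :: "(real \<Rightarrow> complex) \<Rightarrow> bool" where
  "rapid f \<longleftrightarrow> continuous_on UNIV f \<and> (\<forall>m. \<exists>C. \<forall>t. \<bar>t\<bar> ^ m * norm (f t) \<le> C)"

lemma rapidD:
  assumes "rapid f"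
  obtains C where "C > 0" "\<And>t. \<bar>t\<bar> ^ m * norm (f t) \<le> C"
proof -
  obtain C where "\<And>t. \<bar>t\<bar> ^ m * norm (f t) \<le> C" using assms unfolding rapid_def by blast
  then show ?thesis by (intro that[of "max C 1"]) (auto simp: le_max_iff_disj)
qed

lemma rapid_continuous: "rapid f \<Longrightarrow> continuous_on UNIV f"
  by (simp add: rapid_def)

lemma rapid_add:
  assumes "rapid f" "rapid g"
  shows "rapid (\<lambda>t. f t + g t)"
  unfolding rapid_def
proof (intro conjI allI)
  fix m
  obtain C where C: "\<And>t. \<bar>t\<bar> ^ m * norm (f t) \<le> C" using assms(1) by (rule rapidD) blast
  obtain E where E: "\<And>t. \<bar>t\<bar> ^ m * norm (g t) \<le> E" using assms(2) by (rule rapidD) blast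
  have "\<bar>t\<bar> ^ m * norm (f t + g t) \<le> C + E" for t
  proof -
    have "\<bar>t\<bar> ^ m * norm (f t + g t) \<le> \<bar>t\<bar> ^ m * (norm (f t) + norm (g t))"
      by (intro mult_left_mono norm_triangle_ineq) simp
    then show ?thesis using C[of t] E[of t] by (simp add: distrib_left)
  qed
  then show "\<exists>C. \<forall>t. \<bar>t\<bar> ^ m * norm (f t + g t) \<le> C" by blast
qed (use assms in \<open>auto simp: rapid_def intro: continuous_intros\<close>)

lemma rapid_bounded_mult:
  assumes "rapid f" "continuous_on UNIV g" "\<And>t. norm (g t) \<le> B"
  shows "rapid (\<lambda>t. g t * f t)"
  unfolding rapid_def
proof (intro conjI allI)
  fix m
  obtain C where C: "\<And>t. \<bar>t\<bar> ^ m * norm (f t) \<le> C" using assms(1) by (rule rapidD) blast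
  have "\<bar>t\<bar> ^ m * norm (g t * f t) \<le> B * C" for t
  proof -
    have "norm (g t) * (\<bar>t\<bar> ^ m * norm (f t)) \<le> B * C"
      using assms(3)[of t] C[of t] order_trans[OF norm_ge_zero assms(3)] by (intro mult_mono) auto
    then show ?thesis by (simp add: norm_mult mult_ac)
  qed
  then show "\<exists>C. \<forall>t. \<bar>t\<bar> ^ m * norm (g t * f t) \<le> C" by blast
qed (use assms in \<open>auto simp: rapid_def intro: continuous_intros\<close>)

lemma rapid_cmult: "rapid f \<Longrightarrow> rapid (\<lambda>t. c * f t)"
  by (rule rapid_bounded_mult[where B="norm c"]) auto

lemma rapid_times: "rapid f \<Longrightarrow> rapid (\<lambda>t. of_real t * f t)"
proof -
  assume f: "rapid f"
  show ?thesis
    unfolding rapid_def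
  proof (intro conjI allI)
    fix m
    obtain C where "\<And>t. \<bar>t\<bar> ^ Suc m * norm (f t) \<le> C" using f by (rule rapidD) blast
    then show "\<exists>C. \<forall>t. \<bar>t\<bar> ^ m * norm (of_real t * f t) \<le> C"
      by (intro exI[of _ C]) (simp add: norm_mult mult_ac)
  qed (use f in \<open>auto simp: rapid_def intro!: continuous_intros\<close>)
qed

lemma rapid_power: "rapid f \<Longrightarrow> rapid (\<lambda>t. of_real t ^ m * f t)"
proof (induction m)
  case (Suc m)
  then show ?case using rapid_times[of "\<lambda>t. of_real t ^ m * f t"] by (simp add: mult.assoc)
qed simp

lemma rapid_decay:
  assumes "rapid f"
  obtains C where "C > 0" "\<And>t. (1 + t\<^sup>2) * norm (f t) \<le> C"
proof -
  obtain C where C: "C > 0" "\<And>t. \<bar>t\<bar> ^ 0 * norm (f t) \<le> C" using assms by (rule rapidD) blast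
  obtain E where E: "E > 0" "\<And>t. \<bar>t\<bar> ^ 2 * norm (f t) \<le> E" using assms by (rule rapidD) blast
  have "(1 + t\<^sup>2) * norm (f t) \<le> C + E" for t
    using C(2)[of t] E(2)[of t] by (simp add: distrib_right)
  with C E show ?thesis by (intro that[of "C + E"]) auto
qed

lemma rapid_C0: "rapid f \<Longrightarrow> f \<in> C0"
proof -
  assume f: "rapid f"
  obtain C where C: "C > 0" "\<And>t. \<bar>t\<bar> ^ 1 * norm (f t) \<le> C" using f by (rule rapidD) blast
  have "(f \<longlongrightarrow> 0) at_infinity"
    unfolding tendsto_iff
  proof (intro allI impI)
    fix e :: real assume "e > 0"
    show "\<forall>\<^sub>F t in at_infinity. dist (f t) 0 < e"
      unfolding eventually_at_infinity
    proof (intro exI[of _ "C / e + 1"] allI impI)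
      fix t :: real assume "C / e + 1 \<le> norm t"
      then have "C / e < \<bar>t\<bar>" by simp
      then have "C < e * \<bar>t\<bar>" using \<open>e > 0\<close> by (simp add: field_simps)
      then have "\<bar>t\<bar> * norm (f t) < \<bar>t\<bar> * e" using C(2)[of t] by (simp add: mult.commute)
      then show "dist (f t) 0 < e" by (simp add: mult_less_cancel_left)
    qed
  qed
  with f show ?thesis by (simp add: C0_iff rapid_def)
qed

lemma rapid_square_integrable: "rapid f \<Longrightarrow> square_integrable f"
proof -
  assume f: "rapid f"
  obtain C where C: "C > 0" "\<And>t. (1 + t\<^sup>2) * norm (f t) \<le> C" using f by (rule rapid_decay) blast
  have [measurable]: "f \<in> borel_measurable borel"
    by (rule borel_measurable_continuous_onI[OF rapid_continuous[OF f]])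
  have "integrable lborel (\<lambda>t. (norm (f t))\<^sup>2)"
  proof (rule Bochner_Integration.integrable_bound)
    show "integrable lborel (\<lambda>t. C\<^sup>2 * (1 / (1 + t\<^sup>2)))"
      by (intro integrable_mult_right integrable_inverse_1_plus_square)
    show "AE t in lborel. norm ((norm (f t))\<^sup>2) \<le> norm (C\<^sup>2 * (1 / (1 + t\<^sup>2)))"
    proof (rule AE_I2)
      fix t :: real
      have pos: "1 + t\<^sup>2 \<ge> 1" by simp
      have "(1 + t\<^sup>2) * (norm (f t))\<^sup>2 \<le> ((1 + t\<^sup>2) * norm (f t))\<^sup>2"
        unfolding power_mult_distrib by (rule mult_right_mono) (use self_le_power[OF pos, of 2] in auto)
      also have "\<dots> \<le> C\<^sup>2" using C by (intro power_mono) auto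
      finally have "(norm (f t))\<^sup>2 \<le> C\<^sup>2 / (1 + t\<^sup>2)"
        using pos by (subst pos_le_divide_eq) (auto simp: mult.commute intro: less_le_trans[OF zero_less_one])
      then show "norm ((norm (f t))\<^sup>2) \<le> norm (C\<^sup>2 * (1 / (1 + t\<^sup>2)))" by simp
    qed
  qed measurable
  then show ?thesis by (simp add: square_integrable_def)
qed

lemma rapidI:
  assumes "\<And>m. (\<lambda>t. of_real t ^ m * f t) \<in> C0"
  shows "rapid f"
  unfolding rapid_def
proof (intro conjI allI)
  show "continuous_on UNIV f" using assms[of 0] by (simp add: C0_iff)
  fix m
  obtain B where "\<And>t. norm (of_real t ^ m * f t) \<le> B" using assms[of m] by (rule C0_bounded) blast
  then show "\<exists>C. \<forall>t. \<bar>t\<bar> ^ m * norm (f t) \<le> C" by (auto simp: norm_mult norm_power)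
qed

section \<open>Membership in \<open>D0\<close>\<close>

definition smooth_L2 :: "(real \<Rightarrow> complex) set" where
  "smooth_L2 = {f. \<forall>m. square_integrable (nth_derivative m f) \<and> (\<forall>t. nth_derivative m f differentiable (at t))}"

lemma nth_derivative_0 [simp]: "nth_derivative 0 f = f"
  by (simp add: nth_derivative_def)

lemma nth_derivative_Suc: "nth_derivative (Suc m) f = nth_derivative m (nth_derivative 1 f)"
  unfolding nth_derivative_def funpow_Suc_right by (simp add: One_nat_def)

lemma nth_derivative_1_eq: "(\<And>t. (f has_vector_derivative f' t) (at t)) \<Longrightarrow> nth_derivative 1 f = f'"
  by (simp add: nth_derivative_def vector_derivative_at fun_eq_iff One_nat_def)

text \<open>Spares all formulas for higher derivatives: it is enough to exhibit a family of
  square-integrable functions that differentiation maps into itself.\<close>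

lemma smooth_L2_coinduct:
  assumes "f \<in> K"
    and K: "\<And>f. f \<in> K \<Longrightarrow> square_integrable f \<and> (\<exists>f'\<in>K. \<forall>t. (f has_vector_derivative f' t) (at t))"
  shows "f \<in> smooth_L2"
proof -
  have "nth_derivative m f \<in> K" for m
    using assms(1)
  proof (induction m arbitrary: f)
    case (Suc m)
    then obtain f' where "f' \<in> K" "\<And>t. (f has_vector_derivative f' t) (at t)" using K by blast
    then show ?case using Suc.IH[of f'] nth_derivative_1_eq[of f f'] by (simp add: nth_derivative_Suc)
  qed simp
  then show ?thesis
    using K unfolding smooth_L2_def by (blast intro: differentiableI_vector)
qed

lemma smooth_L2D:
  assumes "f \<in> smooth_L2"
  shows "square_integrable f" "nth_derivative 1 f \<in> smooth_L2"
    "(f has_vector_derivative nth_derivative 1 f t) (at t)"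
proof -
  have *: "square_integrable (nth_derivative m f)" "nth_derivative m f differentiable (at t)" for m t
    using assms by (auto simp: smooth_L2_def)
  show "square_integrable f" using *(1)[of 0] by simp
  show "nth_derivative 1 f \<in> smooth_L2"
    unfolding smooth_L2_def by (simp add: * flip: nth_derivative_Suc)
  show "(f has_vector_derivative nth_derivative 1 f t) (at t)"
    using *(2)[of 0] by (simp add: nth_derivative_def vector_derivative_works One_nat_def)
qed

lemma smooth_L2_lincomb:
  assumes "f \<in> smooth_L2" "g \<in> smooth_L2"
  shows "(\<lambda>t. a * f t + b * g t) \<in> smooth_L2"
proof (rule smooth_L2_coinduct[where K="{\<lambda>t. a * f t + b * g t | f g. f \<in> smooth_L2 \<and> g \<in> smooth_L2}"])
  fix h assume "h \<in> {\<lambda>t. a * f t + b * g t | f g. f \<in> smooth_L2 \<and> g \<in> smooth_L2}"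
  then obtain f g where h: "h = (\<lambda>t. a * f t + b * g t)" and fg: "f \<in> smooth_L2" "g \<in> smooth_L2" by blast
  have "square_integrable h"
    unfolding h by (intro square_integrable_add square_integrable_cmult smooth_L2D fg)
  moreover have "(h has_vector_derivative a * nth_derivative 1 f t + b * nth_derivative 1 g t) (at t)" for t
    unfolding h by (intro derivative_intros smooth_L2D fg)
  ultimately show "square_integrable h \<and> (\<exists>f'\<in>{\<lambda>t. a * f t + b * g t | f g. f \<in> smooth_L2 \<and> g \<in> smooth_L2}.
      \<forall>t. (h has_vector_derivative f' t) (at t))"
    using smooth_L2D(2)[OF fg(1)] smooth_L2D(2)[OF fg(2)]
    by (intro conjI bexI[of _ "\<lambda>t. a * nth_derivative 1 f t + b * nth_derivative 1 g t"]) blast+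
qed (use assms in blast)

text \<open>Separates the condition on all derivatives, handled by
  \<open>smooth_L2_coinduct\<close>, from the weights, which concern only the function and its first
  derivative.\<close>

lemma D0_iff: "f \<in> D0 \<longleftrightarrow> f \<in> smooth_L2 \<and> rapid f \<and> rapid (nth_derivative 1 f)"
proof
  assume "f \<in> D0"
  then show "f \<in> smooth_L2 \<and> rapid f \<and> rapid (nth_derivative 1 f)"
    by (auto simp: D0_def smooth_L2_def intro: rapidI)
next
  assume "f \<in> smooth_L2 \<and> rapid f \<and> rapid (nth_derivative 1 f)"
  then show "f \<in> D0"
    by (auto simp: D0_def smooth_L2_def intro: rapid_C0 rapid_square_integrable rapid_power)
qed

lemma D0I:
  assumes "f \<in> smooth_L2" "rapid f" "\<And>t. (f has_vector_derivative f' t) (at t)" "rapid f'"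
  shows "f \<in> D0"
  using assms nth_derivative_1_eq[of f f'] by (simp add: D0_iff)

lemma D0_derivative: "f \<in> D0 \<Longrightarrow> (f has_vector_derivative nth_derivative 1 f t) (at t)"
  by (simp add: D0_iff smooth_L2D)

lemma D0_lincomb:
  assumes "f \<in> D0" "g \<in> D0"
  shows "(\<lambda>t. a * f t + b * g t) \<in> D0"
proof (rule D0I)
  show "(\<lambda>t. a * f t + b * g t) \<in> smooth_L2" using assms by (simp add: D0_iff smooth_L2_lincomb)
  show "((\<lambda>t. a * f t + b * g t) has_vector_derivative a * nth_derivative 1 f t + b * nth_derivative 1 g t) (at t)" for t
    by (intro derivative_intros D0_derivative assms)
qed (use assms in \<open>simp_all add: D0_iff rapid_add rapid_cmult\<close>)

lemma nth_derivative_1_lincomb: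
  assumes "f \<in> D0" "g \<in> D0"
  shows "nth_derivative 1 (\<lambda>t. a * f t + b * g t) = (\<lambda>t. a * nth_derivative 1 f t + b * nth_derivative 1 g t)"
  by (intro nth_derivative_1_eq derivative_intros D0_derivative assms)

section \<open>Stability of \<open>D0\<close> under the resolvents of the position\<close>

lemma norm_inverse_affine_le:
  assumes "Im z \<noteq> 0"
  shows "norm (1 / (of_real t - z)) \<le> 1 / \<bar>Im z\<bar>"
proof -
  have "\<bar>Im z\<bar> \<le> norm (of_real t - z)" using abs_Im_le_cmod[of "of_real t - z"] by simp
  then show ?thesis using assms by (simp add: norm_divide frac_le)
qed

lemma continuous_inverse_affine: "Im z \<noteq> 0 \<Longrightarrow> continuous_on UNIV (\<lambda>t::real. 1 / (of_real t - z))"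
  using C0_inverse_affine by (simp add: C0_iff)

lemma has_vector_derivative_inverse_affine:
  assumes "Im z \<noteq> 0"
  shows "((\<lambda>t. 1 / (of_real t - z)) has_vector_derivative - (1 / (of_real t - z) * (1 / (of_real t - z)))) (at t)"
proof -
  have "((\<lambda>w. 1 / (w - z)) has_field_derivative - (1 / (of_real t - z) * (1 / (of_real t - z)))) (at (of_real t))"
    using of_real_diff_neq_0[OF assms, of t] by (auto intro!: derivative_eq_intros simp: divide_simps)
  then show ?thesis by (rule has_vector_derivative_real_field)
qed

text \<open>For \<open>r = 1 / (t - z)\<close> one has
  \<open>(r * f)' = r * f' - r * (r * f)\<close>, so differences and multiplication by
  \<open>r\<close> suffice for closure under differentiation.\<close>

inductive_set resolvent_span :: "complex \<Rightarrow> (real \<Rightarrow> complex) set" for z where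
  base: "f \<in> smooth_L2 \<Longrightarrow> f \<in> resolvent_span z"
| diff: "f \<in> resolvent_span z \<Longrightarrow> g \<in> resolvent_span z \<Longrightarrow> (\<lambda>t. f t - g t) \<in> resolvent_span z"
| mult: "f \<in> resolvent_span z \<Longrightarrow> (\<lambda>t. 1 / (of_real t - z) * f t) \<in> resolvent_span z"

lemma resolvent_span_derivative:
  assumes "f \<in> resolvent_span z" and z: "Im z \<noteq> 0"
  shows "square_integrable f \<and> (\<exists>f'\<in>resolvent_span z. \<forall>t. (f has_vector_derivative f' t) (at t))"
  using assms(1)
proof induction
  case (base f)
  then show ?case using smooth_L2D by (blast intro: resolvent_span.base)
next
  case (diff f g)
  then obtain f' g' where *: "f' \<in> resolvent_span z" "\<And>t. (f has_vector_derivative f' t) (at t)"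
    "g' \<in> resolvent_span z" "\<And>t. (g has_vector_derivative g' t) (at t)" by blast
  have "((\<lambda>t. f t - g t) has_vector_derivative f' t - g' t) (at t)" for t
    by (intro derivative_intros *)
  then show ?case
    using diff.IH by (intro conjI bexI[OF _ resolvent_span.diff[OF *(1,3)]] square_integrable_diff) blast+
next
  case (mult f)
  then obtain f' where f': "f' \<in> resolvent_span z" "\<And>t. (f has_vector_derivative f' t) (at t)" by blast
  define r where "r t = 1 / (complex_of_real t - z)" for t
  have "((\<lambda>t. r t * f t) has_vector_derivative r t * f' t - r t * (r t * f t)) (at t)" for t
    using has_vector_derivative_mult[OF has_vector_derivative_inverse_affine[OF z] f'(2), of t]
    by (simp add: r_def algebra_simps)
  moreover have "(\<lambda>t. r t * f' t - r t * (r t * f t)) \<in> resolvent_span z"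
    unfolding r_def by (intro resolvent_span.diff resolvent_span.mult f' mult.hyps)
  moreover have "square_integrable (\<lambda>t. r t * f t)"
    unfolding r_def
    by (rule square_integrable_bounded_mult[where B="1 / \<bar>Im z\<bar>"])
      (use mult.IH z in \<open>auto intro!: norm_inverse_affine_le borel_measurable_continuous_onI continuous_inverse_affine\<close>)
  ultimately show ?case
    unfolding r_def by (intro conjI bexI[of _ "\<lambda>t. 1 / (of_real t - z) * f' t - 1 / (of_real t - z) * (1 / (of_real t - z) * f t)"]) blast+
qed

lemma D0_resolvent:
  assumes f: "f \<in> D0" and z: "Im z \<noteq> 0"
  shows "(\<lambda>t. 1 / (of_real t - z) * f t) \<in> D0"
    and "nth_derivative 1 (\<lambda>t. 1 / (of_real t - z) * f t) =
      (\<lambda>t. 1 / (of_real t - z) * nth_derivative 1 f t - 1 / (of_real t - z) * (1 / (of_real t - z) * f t))"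
proof -
  have fs: "f \<in> smooth_L2" "rapid f" "rapid (nth_derivative 1 f)" using f by (simp_all add: D0_iff)
  have d: "((\<lambda>t. 1 / (of_real t - z) * f t) has_vector_derivative
      1 / (of_real t - z) * nth_derivative 1 f t + (-1) * (1 / (of_real t - z) * (1 / (of_real t - z) * f t))) (at t)" for t
    using has_vector_derivative_mult[OF has_vector_derivative_inverse_affine[OF z] D0_derivative[OF f], of t]
    by (simp add: algebra_simps)
  have rapid: "rapid (\<lambda>t. 1 / (of_real t - z) * g t)" if "rapid g" for g
    by (rule rapid_bounded_mult[OF that continuous_inverse_affine[OF z] norm_inverse_affine_le[OF z]])
  show "(\<lambda>t. 1 / (of_real t - z) * f t) \<in> D0"
  proof (rule D0I[OF _ _ d])
    show "(\<lambda>t. 1 / (of_real t - z) * f t) \<in> smooth_L2"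
      by (rule smooth_L2_coinduct[OF resolvent_span.mult[OF resolvent_span.base[OF fs(1)]]
            resolvent_span_derivative[OF _ z]])
  qed (intro rapid rapid_add rapid_cmult fs)+
  show "nth_derivative 1 (\<lambda>t. 1 / (of_real t - z) * f t) =
      (\<lambda>t. 1 / (of_real t - z) * nth_derivative 1 f t - 1 / (of_real t - z) * (1 / (of_real t - z) * f t))"
    using nth_derivative_1_eq[OF d] by simp
qed

section \<open>Gaussians\<close>

definition gauss :: "real \<Rightarrow> real \<Rightarrow> complex" where
  "gauss s t = of_real (exp (- (t\<^sup>2 / (2 * s))))"

text \<open>From \<open>(1 + x / n) ^ n \<le> exp x\<close>, with the summand 1 dropped.\<close>

lemma power_times_exp_le:
  fixes x :: real
  assumes "x \<ge> 0" "n > 0"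
  shows "x ^ n * exp (- x) \<le> real n ^ n"
proof -
  have "(x / real n) ^ n \<le> (1 + x / real n) ^ n" using assms by (intro power_mono) auto
  also have "\<dots> \<le> exp x" using assms by (intro exp_ge_one_plus_x_over_n_power_n) auto
  finally show ?thesis using assms by (simp add: power_divide exp_minus field_simps)
qed

lemma rapid_gauss:
  assumes s: "s > 0"
  shows "rapid (gauss s)"
  unfolding rapid_def
proof (intro conjI allI)
  show "continuous_on UNIV (gauss s)" unfolding gauss_def using s by (auto intro!: continuous_intros)
  fix m
  \<comment> \<open>\<open>power_times_exp_le\<close> needs a positive exponent, and an even power
    of \<open>t\<close> is wanted to match the exponential; \<open>2 * Suc m\<close> dominates
    \<open>m\<close> where \<open>\<bar>t\<bar> > 1\<close>.\<close>
  define n where "n = Suc m"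
  have "\<bar>t\<bar> ^ m * norm (gauss s t) \<le> 1 + (2 * s) ^ n * real n ^ n" for t
  proof -
    have x: "t\<^sup>2 / (2 * s) \<ge> 0" using s by simp
    have "\<bar>t\<bar> ^ m \<le> 1 + (t\<^sup>2) ^ n"
    proof (cases "\<bar>t\<bar> \<le> 1")
      case True
      then have "\<bar>t\<bar> ^ m \<le> 1" by (simp add: power_le_one)
      then show ?thesis by (simp add: add_increasing2)
    next
      case False
      then have "\<bar>t\<bar> ^ m \<le> \<bar>t\<bar> ^ (2 * n)" unfolding n_def by (intro power_increasing) auto
      then show ?thesis by (simp add: power_mult)
    qed
    then have "\<bar>t\<bar> ^ m * norm (gauss s t) \<le> (1 + (t\<^sup>2) ^ n) * exp (- (t\<^sup>2 / (2 * s)))"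
      by (simp add: gauss_def mult_right_mono)
    also have "(t\<^sup>2) ^ n = (2 * s) ^ n * (t\<^sup>2 / (2 * s)) ^ n"
      using s by (simp add: power_divide)
    also have "(1 + (2 * s) ^ n * (t\<^sup>2 / (2 * s)) ^ n) * exp (- (t\<^sup>2 / (2 * s)))
        = exp (- (t\<^sup>2 / (2 * s))) + (2 * s) ^ n * ((t\<^sup>2 / (2 * s)) ^ n * exp (- (t\<^sup>2 / (2 * s))))"
      by (simp only: distrib_right mult_1 mult.assoc)
    also have "\<dots> \<le> 1 + (2 * s) ^ n * real n ^ n"
      using s x by (intro add_mono mult_left_mono power_times_exp_le) (auto simp: n_def)
    finally show ?thesis .
  qed
  then show "\<exists>C. \<forall>t. \<bar>t\<bar> ^ m * norm (gauss s t) \<le> C" by blast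
qed

lemma gauss_derivative:
  assumes "s \<noteq> 0"
  shows "(gauss s has_vector_derivative - (1 / of_real s) * (of_real t * gauss s t)) (at t)"
proof -
  have "((\<lambda>t. exp (- (t\<^sup>2 / (2 * s)))) has_real_derivative - (1 / s) * (t * exp (- (t\<^sup>2 / (2 * s))))) (at t)"
    using assms by (auto intro!: derivative_eq_intros simp: field_simps)
  then have "((\<lambda>t. complex_of_real (exp (- (t\<^sup>2 / (2 * s))))) has_vector_derivative
      of_real (- (1 / s) * (t * exp (- (t\<^sup>2 / (2 * s)))))) (at t)"
    by (rule has_vector_derivative_of_real)
  then show ?thesis unfolding gauss_def[abs_def] by simp
qed

text \<open>The derivative of the Gaussian is a multiple of \<open>t\<close> times itself, so these
  are polynomials times the Gaussian, a family closed under differentiation.\<close>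

inductive_set gauss_span :: "real \<Rightarrow> (real \<Rightarrow> complex) set" for s where
  base: "gauss s \<in> gauss_span s"
| times: "f \<in> gauss_span s \<Longrightarrow> (\<lambda>t. of_real t * f t) \<in> gauss_span s"
| lincomb: "f \<in> gauss_span s \<Longrightarrow> g \<in> gauss_span s \<Longrightarrow> (\<lambda>t. a * f t + b * g t) \<in> gauss_span s"

lemma gauss_span_derivative:
  assumes "f \<in> gauss_span s" and s: "s > 0"
  shows "rapid f \<and> (\<exists>f'\<in>gauss_span s. \<forall>t. (f has_vector_derivative f' t) (at t))"
  using assms(1)
proof induction
  case base
  have "(\<lambda>t. (- (1 / of_real s)) * (of_real t * gauss s t) + 0 * gauss s t) \<in> gauss_span s"
    by (intro gauss_span.lincomb gauss_span.times gauss_span.base)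
  moreover have "(gauss s has_vector_derivative (- (1 / of_real s)) * (of_real t * gauss s t) + 0 * gauss s t) (at t)" for t
    using gauss_derivative[of s t] s by simp
  ultimately show ?case
    by (intro conjI rapid_gauss[OF s] bexI[of _ "\<lambda>t. (- (1 / of_real s)) * (of_real t * gauss s t) + 0 * gauss s t"]) blast+
next
  case (times f)
  then obtain f' where f': "f' \<in> gauss_span s" "\<And>t. (f has_vector_derivative f' t) (at t)" by blast
  have "((\<lambda>t. of_real t * f t) has_vector_derivative 1 * (of_real t * f' t) + 1 * f t) (at t)" for t
    using has_vector_derivative_mult[OF has_vector_derivative_of_real[OF DERIV_ident] f'(2), of t] by simp
  moreover have "(\<lambda>t. 1 * (of_real t * f' t) + 1 * f t) \<in> gauss_span s"
    by (intro gauss_span.lincomb gauss_span.times f' times.hyps)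
  ultimately show ?case
    using times.IH by (intro conjI rapid_times bexI[of _ "\<lambda>t. 1 * (of_real t * f' t) + 1 * f t"]) blast+
next
  case (lincomb f g a b)
  then obtain f' g' where *: "f' \<in> gauss_span s" "\<And>t. (f has_vector_derivative f' t) (at t)"
    "g' \<in> gauss_span s" "\<And>t. (g has_vector_derivative g' t) (at t)" by blast
  have "((\<lambda>t. a * f t + b * g t) has_vector_derivative a * f' t + b * g' t) (at t)" for t
    by (intro derivative_intros *)
  then show ?case
    using lincomb.IH by (intro conjI rapid_add rapid_cmult bexI[OF _ gauss_span.lincomb[OF *(1,3)]]) blast+
qed

lemma gauss_span_D0:
  assumes f: "f \<in> gauss_span s" and s: "s > 0"
  shows "f \<in> D0"
proof -
  obtain f' where f': "f' \<in> gauss_span s" "\<And>t. (f has_vector_derivative f' t) (at t)"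
    using gauss_span_derivative[OF f s] by blast
  show ?thesis
  proof (rule D0I[OF _ _ f'(2)])
    show "f \<in> smooth_L2"
      by (rule smooth_L2_coinduct[OF f]) (use gauss_span_derivative[OF _ s] rapid_square_integrable in blast)
  qed (use gauss_span_derivative[OF _ s] f f' in blast)+
qed

section \<open>A first-order linear differential equation on the line\<close>

lemma exp_of_real_derivative:
  "((\<lambda>t. complex_of_real (exp (k * t))) has_vector_derivative of_real k * of_real (exp (k * t))) (at t)"
proof -
  have "((\<lambda>t. exp (k * t)) has_real_derivative k * exp (k * t)) (at t)"
    by (auto intro!: derivative_eq_intros)
  from has_vector_derivative_of_real[OF this] show ?thesis by simp
qed

text \<open>The solution is \<open>exp (- k t)\<close> times the integral of
  \<open>k * exp (k s) * w s\<close> over \<open>s \<le> t\<close>, an average of \<open>w\<close>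
  against a kernel of mass 1, hence bounded by \<open>B\<close>. The improper integral is expressed
  as \<open>G t - L\<close> with an antiderivative \<open>G\<close> and its limit \<open>L\<close>
  at minus infinity.\<close>

lemma bounded_solution_pos:
  fixes w :: "real \<Rightarrow> complex"
  assumes k: "k > 0" and cont: "continuous_on UNIV w" and bound: "\<And>t. norm (w t) \<le> B"
  shows "\<exists>f. (\<forall>t. (f has_vector_derivative of_real k * (w t - f t)) (at t)) \<and> (\<forall>t. norm (f t) \<le> B)"
proof -
  have B: "B \<ge> 0" using bound[of 0] norm_ge_zero order_trans by blast
  define e where "e t = complex_of_real (exp (k * t))" for t
  have "isCont (\<lambda>t. of_real k * e t * w t) t" for t
    using cont unfolding e_def
    by (intro continuous_intros) (auto simp: continuous_on_eq_continuous_at)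
  then obtain G where "\<forall>t::real. - \<infinity> < ereal t \<longrightarrow> ereal t < \<infinity> \<longrightarrow>
      (G has_vector_derivative of_real k * e t * w t) (at t)"
    using einterval_antiderivative[of "- \<infinity>" \<infinity> "\<lambda>t. of_real k * e t * w t"] by auto
  then have G: "(G has_vector_derivative of_real k * e t * w t) (at t)" for t by simp
  \<comment> \<open>Mean value inequality against \<open>B * exp (k t)\<close>, whose derivative
    dominates that of \<open>G\<close>. It yields both the existence of \<open>L\<close> and the
    bound on \<open>G t - L\<close>.\<close>
  have inc: "norm (G t - G s) \<le> B * exp (k * t) - B * exp (k * s)" if "s \<le> t" for s t
  proof (cases "s = t")
    case False
    with that have "s < t" by simp
    then show ?thesis
    proof (rule differentiable_bound_general)
      show "continuous_on {s..t} G"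
        using G by (intro continuous_at_imp_continuous_on ballI has_vector_derivative_continuous)
      show "continuous_on {s..t} (\<lambda>t. B * exp (k * t))" by (intro continuous_intros)
      show "((\<lambda>t. B * exp (k * t)) has_vector_derivative B * (k * exp (k * x))) (at x)" for x
        unfolding has_real_derivative_iff_has_vector_derivative[symmetric]
        by (auto intro!: derivative_eq_intros)
      show "norm (of_real k * e x * w x) \<le> B * (k * exp (k * x))" for x
        using bound[of x] k by (simp add: e_def norm_mult mult.commute)
    qed (use G in blast)
  qed simp
  have lim0: "(\<lambda>n. B * exp (k * - real n)) \<longlonglongrightarrow> 0"
  proof -
    have "exp (- k) < 1" "0 \<le> exp (- k)" using k by auto
    then have "(\<lambda>n. B * exp (- k) ^ n) \<longlonglongrightarrow> B * 0"
      by (intro tendsto_mult_left LIMSEQ_power_zero) simp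
    moreover have "exp (- k) ^ n = exp (k * - real n)" for n
      by (simp add: mult.commute flip: exp_of_nat_mult)
    ultimately show ?thesis by simp
  qed
  have "Cauchy (\<lambda>n. G (- real n))"
    unfolding Cauchy_altdef2 dist_norm
  proof (intro allI impI)
    fix r :: real assume "r > 0"
    then obtain N where N: "B * exp (k * - real N) < r"
      using order_tendstoD(2)[OF lim0] by (auto simp: eventually_sequentially)
    have "norm (G (- real n) - G (- real N)) < r" if "n \<ge> N" for n
    proof -
      have "norm (G (- real N) - G (- real n)) \<le> B * exp (k * - real N) - B * exp (k * - real n)"
        using that by (intro inc) simp
      moreover have "0 \<le> B * exp (k * - real n)" using B by simp
      ultimately show ?thesis using N by (simp only: norm_minus_commute)
    qed
    then show "\<exists>N. \<forall>n\<ge>N. norm (G (- real n) - G (- real N)) < r" by blast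
  qed
  then obtain L where L: "(\<lambda>n. G (- real n)) \<longlonglongrightarrow> L" by (auto simp: Cauchy_convergent_iff convergent_def)
  have GL: "norm (G t - L) \<le> B * exp (k * t)" for t
  proof (rule LIMSEQ_le_const2)
    show "(\<lambda>n. norm (G t - G (- real n))) \<longlonglongrightarrow> norm (G t - L)" by (intro tendsto_intros L)
    obtain N :: nat where N: "- t \<le> real N" using real_arch_simple by blast
    have "norm (G t - G (- real n)) \<le> B * exp (k * t)" if "n \<ge> N" for n
    proof -
      have "- real n \<le> t" using N that by linarith
      moreover have "0 \<le> B * exp (k * - real n)" using B by simp
      ultimately show ?thesis using inc[of "- real n" t] by linarith
    qed
    then show "\<exists>N. \<forall>n\<ge>N. norm (G t - G (- real n)) \<le> B * exp (k * t)" by blast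
  qed
  define f where "f t = of_real (exp (- k * t)) * (G t - L)" for t
  have e1: "complex_of_real (exp (- k * t)) * e t = 1" for t
    by (simp add: e_def exp_minus flip: of_real_mult)
  have "(f has_vector_derivative of_real k * (w t - f t)) (at t)" for t
  proof -
    have "(f has_vector_derivative of_real (exp (- k * t)) * (of_real k * e t * w t)
        + (of_real (- k) * of_real (exp (- k * t))) * (G t - L)) (at t)"
      unfolding f_def
      by (intro has_vector_derivative_mult exp_of_real_derivative has_vector_derivative_diff_const[THEN iffD2] G)
    also have "of_real (exp (- k * t)) * (of_real k * e t * w t)
        + (of_real (- k) * of_real (exp (- k * t))) * (G t - L)
      = of_real k * ((of_real (exp (- k * t)) * e t) * w t - f t)"
      by (simp add: f_def algebra_simps)
    finally show ?thesis by (simp only: e1 mult_1)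
  qed
  moreover have "norm (f t) \<le> B" for t
  proof -
    have "norm (f t) \<le> exp (- k * t) * (B * exp (k * t))"
      unfolding f_def norm_mult by (intro mult_mono GL) auto
    then show ?thesis by (simp add: exp_minus field_simps)
  qed
  ultimately show ?thesis by blast
qed

text \<open>For negative \<open>k\<close> the reflection \<open>t \<mapsto> - t\<close> changes the
  sign of \<open>k\<close>.\<close>

lemma bounded_solution:
  fixes w :: "real \<Rightarrow> complex"
  assumes k: "k \<noteq> 0" and cont: "continuous_on UNIV w" and bound: "\<And>t. norm (w t) \<le> B"
  shows "\<exists>f. (\<forall>t. (f has_vector_derivative of_real k * (w t - f t)) (at t)) \<and> (\<forall>t. norm (f t) \<le> B)"
proof (cases "k > 0")
  case True
  then show ?thesis by (rule bounded_solution_pos[OF _ cont bound])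
next
  case False
  with k have "- k > 0" by simp
  moreover have "continuous_on UNIV (\<lambda>t. w (- t))"
    by (rule continuous_on_compose2[OF cont]) (auto intro: continuous_intros)
  ultimately obtain g where g: "\<And>t. (g has_vector_derivative of_real (- k) * (w (- t) - g t)) (at t)"
      "\<And>t. norm (g t) \<le> B"
    using bounded_solution_pos[of "- k" "\<lambda>t. w (- t)" B] bound by blast
  have "((\<lambda>t. g (- t)) has_vector_derivative of_real k * (w t - g (- t))) (at t)" for t
  proof -
    have "(uminus has_vector_derivative (-1)) (at t)" by (auto intro!: derivative_eq_intros)
    from vector_diff_chain_at[OF this g(1)] show ?thesis by (simp add: o_def)
  qed
  with g(2) show ?thesis by (intro exI[of _ "\<lambda>t. g (- t)"]) blast
qed

text \<open>\<open>exp (k t) * d t\<close> is constant. Evaluated at \<open>t = - x / k\<close> with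
  large \<open>x\<close>, the exponential decay beats the linear growth of \<open>d\<close>, so the
  constant is 0.\<close>

lemma homogeneous_solution_zero:
  fixes d :: "real \<Rightarrow> complex"
  assumes k: "k \<noteq> 0" and d: "\<And>t. (d has_vector_derivative - (of_real k * d t)) (at t)"
    and growth: "\<And>t. norm (d t) \<le> a * \<bar>t\<bar> + b"
  shows "d t = 0"
proof -
  have "((\<lambda>t. of_real (exp (k * t)) * d t) has_vector_derivative
      of_real (exp (k * t)) * - (of_real k * d t) + of_real k * of_real (exp (k * t)) * d t) (at t)" for t
    by (intro has_vector_derivative_mult exp_of_real_derivative d)
  then have "((\<lambda>t. of_real (exp (k * t)) * d t) has_vector_derivative 0) (at t)" for t
    by (simp add: mult_ac)
  then obtain K where K: "\<And>t. of_real (exp (k * t)) * d t = K"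
    using has_vector_derivative_zero_constant[of UNIV "\<lambda>t. of_real (exp (k * t)) * d t"] by auto
  have le: "norm K \<le> a / \<bar>k\<bar> * (x ^ 1 / exp x) + b * (x ^ 0 / exp x)" if "x \<ge> 0" for x
  proof -
    have "norm K = exp (- x) * norm (d (- x / k))"
      using K[of "- x / k"] k by (auto simp: norm_mult)
    also have "\<dots> \<le> exp (- x) * (a * \<bar>- x / k\<bar> + b)" by (intro mult_left_mono growth) simp
    also have "\<dots> = a / \<bar>k\<bar> * (x ^ 1 / exp x) + b * (x ^ 0 / exp x)"
      using that k by (simp add: exp_minus abs_divide field_simps)
    finally show ?thesis .
  qed
  have "((\<lambda>x. a / \<bar>k\<bar> * (x ^ 1 / exp x) + b * (x ^ 0 / exp x)) \<longlongrightarrow> a / \<bar>k\<bar> * 0 + b * 0) at_top"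
    by (intro tendsto_intros tendsto_power_div_exp_0)
  then have "norm K \<le> a / \<bar>k\<bar> * 0 + b * 0"
    by (rule tendsto_lowerbound) (use le in \<open>auto intro!: eventually_mono[OF eventually_ge_at_top[of 0]]\<close>)
  then have "K = 0" by simp
  with K[of t] show ?thesis by simp
qed

text \<open>The bounded solution inherits rapid decay since \<open>t ^ Suc m * f t\<close>, which grows at most
  linearly by induction, is the bounded solution of an equation of the same form.\<close>

lemma solution_rapid:
  assumes k: "k \<noteq> 0" and w: "rapid w" and f: "\<And>t. (f has_vector_derivative of_real k * (w t - f t)) (at t)"
    and bound: "\<And>t. norm (f t) \<le> B"
  shows "rapid f"
  unfolding rapid_def
proof (intro conjI allI)
  show contf: "continuous_on UNIV f"
    using f by (intro continuous_at_imp_continuous_on ballI has_vector_derivative_continuous)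
  fix m
  show "\<exists>C. \<forall>t. \<bar>t\<bar> ^ m * norm (f t) \<le> C"
  proof (induction m)
    case 0
    then show ?case using bound by auto
  next
    case (Suc m)
    then obtain C where C: "\<And>t. \<bar>t\<bar> ^ m * norm (f t) \<le> C" by blast
    obtain E where E: "\<And>t. \<bar>t\<bar> ^ Suc m * norm (w t) \<le> E" using w by (rule rapidD) blast
    \<comment> \<open>Chosen so that \<open>p t = t ^ Suc m * f t\<close> satisfies
      \<open>p' = k * (v - p)\<close>: the derivative of the power contributes
      \<open>Suc m * t ^ m * f t\<close>, which is divided by \<open>k\<close> and moved into
      \<open>v\<close>. The induction hypothesis bounds that term.\<close>
    define v where "v t = of_real t ^ Suc m * w t + of_real (real (Suc m) / k) * (of_real t ^ m * f t)" for t
    have "continuous_on UNIV v" unfolding v_def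
      by (intro continuous_intros contf rapid_continuous[OF w])
    moreover have "norm (v t) \<le> E + \<bar>real (Suc m) / k\<bar> * C" for t
    proof -
      have "norm (v t) \<le> norm (of_real t ^ Suc m * w t) + norm (of_real (real (Suc m) / k) * (of_real t ^ m * f t))"
        unfolding v_def by (rule norm_triangle_ineq)
      also have "\<dots> = \<bar>t\<bar> ^ Suc m * norm (w t) + \<bar>real (Suc m) / k\<bar> * (\<bar>t\<bar> ^ m * norm (f t))"
        by (simp only: norm_mult norm_power norm_of_real)
      also have "\<dots> \<le> E + \<bar>real (Suc m) / k\<bar> * C"
        by (intro add_mono mult_left_mono C E) simp
      finally show ?thesis .
    qed
    ultimately obtain g where g: "\<And>t. (g has_vector_derivative of_real k * (v t - g t)) (at t)"
        "\<And>t. norm (g t) \<le> E + \<bar>real (Suc m) / k\<bar> * C"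
      using bounded_solution[OF k] by blast
    \<comment> \<open>\<open>g\<close> is a bounded solution of the same equation. The difference
      solves the homogeneous one and grows at most linearly, as \<open>t ^ m * f t\<close> is
      bounded.\<close>
    have "of_real t ^ Suc m * f t - g t = 0" for t
    proof (rule homogeneous_solution_zero[OF k])
      fix t
      have "((\<lambda>t. complex_of_real (t ^ Suc m)) has_vector_derivative of_real (real (Suc m) * t ^ m)) (at t)"
        by (rule has_vector_derivative_of_real, rule DERIV_cong[OF DERIV_pow]) simp
      from has_vector_derivative_diff[OF has_vector_derivative_mult[OF this f] g(1)]
      have "((\<lambda>t. of_real t ^ Suc m * f t - g t) has_vector_derivative
          of_real (t ^ Suc m) * (of_real k * (w t - f t)) + of_real (real (Suc m) * t ^ m) * f t
          - of_real k * (v t - g t)) (at t)" by (simp only: of_real_power)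
      also have "of_real (t ^ Suc m) * (of_real k * (w t - f t)) + of_real (real (Suc m) * t ^ m) * f t
          - of_real k * (v t - g t) = - (of_real k * (of_real t ^ Suc m * f t - g t))"
        using k by (simp add: v_def field_simps)
      finally show "((\<lambda>t. of_real t ^ Suc m * f t - g t) has_vector_derivative
          - (of_real k * (of_real t ^ Suc m * f t - g t))) (at t)" .
      have "norm (of_real t ^ Suc m * f t - g t) \<le> norm (of_real t ^ Suc m * f t) + norm (g t)"
        by (rule norm_triangle_ineq4)
      also have "norm (of_real t ^ Suc m * f t) = \<bar>t\<bar> * (\<bar>t\<bar> ^ m * norm (f t))"
        by (simp add: norm_mult norm_power)
      also have "\<bar>t\<bar> * (\<bar>t\<bar> ^ m * norm (f t)) \<le> \<bar>t\<bar> * C" by (intro mult_left_mono C) simp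
      finally show "norm (of_real t ^ Suc m * f t - g t) \<le> C * \<bar>t\<bar> + (E + \<bar>real (Suc m) / k\<bar> * C)"
        using g(2)[of t] by (simp add: mult.commute)
    qed
    then have "of_real t ^ Suc m * f t = g t" for t by simp
    then have "\<bar>t\<bar> ^ Suc m * norm (f t) = norm (g t)" for t
      by (metis norm_mult norm_power norm_of_real)
    with g(2) show ?case by (intro exI allI) (simp only:)
  qed
qed

text \<open>With \<open>c = \<plusminus>hbar\<close> this is the equation for the momentum shifted
  by \<plusminus>\<i>. In the form \<open>f' = (w - f) / c\<close> its bounded solution is rapid,
  and then so is \<open>f'\<close>.\<close>

lemma D0_solve:
  assumes w: "w \<in> D0" and c: "c \<noteq> 0"
  obtains f where "f \<in> D0" "\<And>t. f t + of_real c * nth_derivative 1 f t = w t"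
proof -
  have w': "rapid w" "w \<in> smooth_L2" using w by (simp_all add: D0_iff)
  obtain B where "\<And>t. norm (w t) \<le> B" using rapid_C0[OF w'(1)] by (rule C0_bounded) blast
  then obtain f where f: "\<And>t. (f has_vector_derivative of_real (1 / c) * (w t - f t)) (at t)"
      "\<And>t. norm (f t) \<le> B"
    using bounded_solution[of "1 / c" w B] rapid_continuous[OF w'(1)] c by auto
  have rf: "rapid f" using solution_rapid[OF _ w'(1) f] c by simp
  have f': "(f has_vector_derivative of_real (1 / c) * w t + of_real (- 1 / c) * f t) (at t)" for t
    using f(1)[of t] by (simp add: algebra_simps)
  have "f \<in> D0"
  proof (rule D0I[OF _ rf f'])
    show "rapid (\<lambda>t. of_real (1 / c) * w t + of_real (- 1 / c) * f t)"
      by (intro rapid_add rapid_cmult rf w')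
    \<comment> \<open>Since \<open>f'\<close> is a linear combination of \<open>f\<close> and
      \<open>w\<close>, differentiating \<open>a * f + g\<close> only changes \<open>a\<close> and
      the smooth remainder.\<close>
    let ?K = "{\<lambda>t. a * f t + g t | a g. g \<in> smooth_L2}"
    show "f \<in> smooth_L2"
    proof (rule smooth_L2_coinduct[where K="?K"])
      have "(\<lambda>t. 0 * w t + 0 * w t) \<in> smooth_L2" by (rule smooth_L2_lincomb[OF w'(2) w'(2)])
      then have "(\<lambda>t. 0) \<in> smooth_L2" by simp
      then show "f \<in> ?K" by (intro CollectI exI[of _ 1] exI[of _ "\<lambda>t. 0"]) simp
      fix h assume "h \<in> ?K"
      then obtain a g where h: "h = (\<lambda>t. a * f t + g t)" and g: "g \<in> smooth_L2" by blast
      have "square_integrable h"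
        unfolding h by (intro square_integrable_add square_integrable_cmult rapid_square_integrable rf smooth_L2D g)
      moreover have "(h has_vector_derivative (a * of_real (- 1 / c)) * f t
          + (a * of_real (1 / c) * w t + 1 * nth_derivative 1 g t)) (at t)" for t
        using has_vector_derivative_add[OF has_vector_derivative_mult[OF has_vector_derivative_const f'] smooth_L2D(3)[OF g]]
        unfolding h by (simp add: algebra_simps)
      moreover have "(\<lambda>t. a * of_real (1 / c) * w t + 1 * nth_derivative 1 g t) \<in> smooth_L2"
        by (intro smooth_L2_lincomb w' smooth_L2D g)
      ultimately show "square_integrable h \<and> (\<exists>f'\<in>?K. \<forall>t. (h has_vector_derivative f' t) (at t))"
        by (intro conjI bexI[of _ "\<lambda>t. (a * of_real (- 1 / c)) * f t
            + (a * of_real (1 / c) * w t + 1 * nth_derivative 1 g t)"] CollectI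
          exI[of _ "a * of_real (- 1 / c)"] exI[of _ "\<lambda>t. a * of_real (1 / c) * w t + 1 * nth_derivative 1 g t"])
          blast+
    qed
  qed
  moreover have "f t + of_real c * nth_derivative 1 f t = w t" for t
    unfolding nth_derivative_1_eq[OF f(1)] using c by simp
  ultimately show ?thesis by (rule that)
qed

lemma D0_integration_by_parts:
  assumes f: "f \<in> D0" and g: "g \<in> D0"
  shows "(\<integral>t. f t * cnj (nth_derivative 1 g t) + nth_derivative 1 f t * cnj (g t) \<partial>lborel) = 0"
    (is "integral\<^sup>L lborel ?h = 0")
proof -
  have r: "rapid f" "rapid g" "rapid (nth_derivative 1 f)" "rapid (nth_derivative 1 g)"
    using f g by (simp_all add: D0_iff)
  have int: "integrable lborel ?h"
    by (intro Bochner_Integration.integrable_add square_integrable_mult_cnj rapid_square_integrable r)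
  have "(LBINT t=-\<infinity>..\<infinity>. ?h t) = 0 - 0"
  proof (rule interval_integral_FTC_integrable[where F="\<lambda>t. f t * cnj (g t)"])
    show "((\<lambda>t. f t * cnj (g t)) has_vector_derivative ?h t) (at t)" for t
      by (intro has_vector_derivative_mult has_vector_derivative_cnj D0_derivative f g)
    show "isCont ?h t" for t
      using r[THEN rapid_continuous] by (intro continuous_intros) (auto simp: continuous_on_eq_continuous_at)
    show "set_integrable lborel (einterval (- \<infinity>) \<infinity>) ?h"
      using int by (simp add: set_integrable_def einterval_eq_UNIV)
    have "(\<lambda>t. f t * cnj (g t)) \<in> C0" by (intro C0_mult C0_cnj rapid_C0 r)
    then have "((\<lambda>t. f t * cnj (g t)) \<longlongrightarrow> 0) at_infinity" by (simp add: C0_iff)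
    then show "(((\<lambda>t. f t * cnj (g t)) \<circ> real_of_ereal) \<longlongrightarrow> 0) (at_right (- \<infinity>))"
      "(((\<lambda>t. f t * cnj (g t)) \<circ> real_of_ereal) \<longlongrightarrow> 0) (at_left \<infinity>)"
      unfolding ereal_tendsto_simps using at_top_le_at_infinity at_bot_le_at_infinity tendsto_mono by blast+
  qed simp
  then show ?thesis
    by (simp add: interval_lebesgue_integral_def set_lebesgue_integral_def einterval_eq_UNIV)
qed

section \<open>Essential self-adjointness of position and momentum\<close>

lemma D0_square_integrable: "f \<in> D0 \<Longrightarrow> square_integrable f"
  by (simp add: D0_iff smooth_L2D)

lemma closure_lincomb:
  fixes S :: "l2 set"
  assumes S: "\<And>u v a b. u \<in> S \<Longrightarrow> v \<in> S \<Longrightarrow> a *\<^sub>C u + b *\<^sub>C v \<in> S"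
    and u: "u \<in> closure S" and v: "v \<in> closure S"
  shows "a *\<^sub>C u + b *\<^sub>C v \<in> closure S"
proof -
  obtain x where x: "\<And>n. x n \<in> S" "x \<longlonglongrightarrow> u" using u unfolding closure_sequential by blast
  obtain y where y: "\<And>n. y n \<in> S" "y \<longlonglongrightarrow> v" using v unfolding closure_sequential by blast
  have "(\<lambda>n. a *\<^sub>C x n + b *\<^sub>C y n) \<longlonglongrightarrow> a *\<^sub>C u + b *\<^sub>C v"
    by (intro tendsto_add bounded_linear.tendsto[OF bounded_linear_cscale] x y)
  with x(1) y(1) S show ?thesis
    unfolding closure_sequential by (intro exI[of _ "\<lambda>n. a *\<^sub>C x n + b *\<^sub>C y n"]) blast
qed

section \<open>Density of \<open>D0\<close>\<close>

definition D0_space :: "l2 set" where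
  "D0_space = closure (abs_l2 ` D0)"

lemma D0_space_lincomb:
  "u \<in> D0_space \<Longrightarrow> v \<in> D0_space \<Longrightarrow> a *\<^sub>C u + b *\<^sub>C v \<in> D0_space"
  unfolding D0_space_def
proof (rule closure_lincomb)
  fix u v a b assume "u \<in> abs_l2 ` D0" "v \<in> abs_l2 ` D0"
  then obtain f g where fg: "f \<in> D0" "g \<in> D0" "u = abs_l2 f" "v = abs_l2 g" by blast
  then have "a *\<^sub>C u + b *\<^sub>C v = abs_l2 (\<lambda>t. a * f t + b * g t)"
    by (simp add: abs_l2_cscale abs_l2_add D0_square_integrable square_integrable_cmult)
  then show "a *\<^sub>C u + b *\<^sub>C v \<in> abs_l2 ` D0" using D0_lincomb[OF fg(1,2)] by blast
qed

text \<open>The functions acting on the closure of \<open>D0\<close> by multiplication. They form an algebra that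
  contains the resolvents of the position and is closed under bounded pointwise limits, hence it
  contains all indicators of Borel sets.\<close>

definition multiplier :: "(real \<Rightarrow> complex) \<Rightarrow> bool" where
  "multiplier g \<longleftrightarrow> g \<in> borel_measurable borel \<and> (\<exists>B. \<forall>t. norm (g t) \<le> B) \<and>
     (\<forall>f. square_integrable f \<longrightarrow> abs_l2 f \<in> D0_space \<longrightarrow> abs_l2 (\<lambda>t. g t * f t) \<in> D0_space)"

lemma multiplier_square_integrable:
  assumes "multiplier g" "square_integrable f"
  shows "square_integrable (\<lambda>t. g t * f t)"
proof -
  obtain B where "\<And>t. norm (g t) \<le> B" using assms(1) unfolding multiplier_def by blast
  then show ?thesis using assms by (intro square_integrable_bounded_mult) (auto simp: multiplier_def)
qed

lemma multiplier_mem: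
  "multiplier g \<Longrightarrow> square_integrable f \<Longrightarrow> abs_l2 f \<in> D0_space \<Longrightarrow> abs_l2 (\<lambda>t. g t * f t) \<in> D0_space"
  by (simp add: multiplier_def)

lemma multiplier_const: "multiplier (\<lambda>t. c)"
  unfolding multiplier_def
proof (intro conjI allI impI)
  fix f assume "square_integrable f" "abs_l2 f \<in> D0_space"
  then show "abs_l2 (\<lambda>t. c * f t) \<in> D0_space"
    using D0_space_lincomb[of "abs_l2 f" "abs_l2 f" c 0] by (simp add: abs_l2_cscale)
qed auto

lemma multiplier_add:
  assumes "multiplier g" "multiplier h"
  shows "multiplier (\<lambda>t. g t + h t)"
  unfolding multiplier_def
proof (intro conjI allI impI)
  show "(\<lambda>t. g t + h t) \<in> borel_measurable borel" using assms by (auto simp: multiplier_def)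
  obtain B C where "\<And>t. norm (g t) \<le> B" "\<And>t. norm (h t) \<le> C"
    using assms unfolding multiplier_def by blast
  then show "\<exists>B. \<forall>t. norm (g t + h t) \<le> B"
    by (intro exI[of _ "B + C"]) (auto intro: norm_triangle_le add_mono)
  fix f assume f: "square_integrable f" "abs_l2 f \<in> D0_space"
  have "abs_l2 (\<lambda>t. (g t + h t) * f t) = 1 *\<^sub>C abs_l2 (\<lambda>t. g t * f t) + 1 *\<^sub>C abs_l2 (\<lambda>t. h t * f t)"
    by (simp add: abs_l2_add multiplier_square_integrable assms f distrib_right)
  also have "\<dots> \<in> D0_space" by (intro D0_space_lincomb multiplier_mem assms f)
  finally show "abs_l2 (\<lambda>t. (g t + h t) * f t) \<in> D0_space" .
qed

lemma multiplier_mult: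
  assumes "multiplier g" "multiplier h"
  shows "multiplier (\<lambda>t. g t * h t)"
  unfolding multiplier_def
proof (intro conjI allI impI)
  show "(\<lambda>t. g t * h t) \<in> borel_measurable borel" using assms by (auto simp: multiplier_def)
  obtain B C where BC: "\<And>t. norm (g t) \<le> B" "\<And>t. norm (h t) \<le> C"
    using assms unfolding multiplier_def by blast
  have "norm (g t * h t) \<le> B * C" for t
    unfolding norm_mult using BC[of t] order_trans[OF norm_ge_zero BC(1)] by (intro mult_mono) auto
  then show "\<exists>B. \<forall>t. norm (g t * h t) \<le> B" by blast
  fix f assume f: "square_integrable f" "abs_l2 f \<in> D0_space"
  have "abs_l2 (\<lambda>t. g t * (h t * f t)) \<in> D0_space"
    by (intro multiplier_mem multiplier_square_integrable assms f)
  then show "abs_l2 (\<lambda>t. g t * h t * f t) \<in> D0_space" by (simp add: mult.assoc)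
qed

lemma multiplier_sum: "finite A \<Longrightarrow> (\<And>y. y \<in> A \<Longrightarrow> multiplier (g y)) \<Longrightarrow> multiplier (\<lambda>t. \<Sum>y\<in>A. g y t)"
proof (induction A rule: finite_induct)
  case empty
  then show ?case using multiplier_const[of 0] by simp
next
  case (insert x F)
  then show ?case using multiplier_add[of "g x" "\<lambda>t. \<Sum>y\<in>F. g y t"] by simp
qed

text \<open>Dominated convergence with majorant \<open>B * f\<close> turns the pointwise limit into
  an L2 limit, and \<open>D0_space\<close> is closed.\<close>

lemma multiplier_limit:
  assumes g: "\<And>n. multiplier (g n)" and bound: "\<And>n t. norm (g n t) \<le> B"
    and lim: "\<And>t. (\<lambda>n. g n t) \<longlonglongrightarrow> h t"
  shows "multiplier h"
  unfolding multiplier_def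
proof (intro conjI allI impI)
  have gm: "g n \<in> borel_measurable borel" for n using g by (simp add: multiplier_def)
  then show "h \<in> borel_measurable borel" by (rule borel_measurable_LIMSEQ_metric[OF _ lim])
  have "norm (h t) \<le> B" for t
    by (rule LIMSEQ_le_const2[OF tendsto_norm[OF lim]]) (use bound in auto)
  then show "\<exists>B. \<forall>t. norm (h t) \<le> B" by blast
  fix f assume f: "square_integrable f" "abs_l2 f \<in> D0_space"
  have "(\<lambda>n. abs_l2 (\<lambda>t. g n t * f t)) \<longlonglongrightarrow> abs_l2 (\<lambda>t. h t * f t)"
  proof (rule l2_dominated_convergence(2)[OF square_integrable_cmult[OF f(1), of "of_real B"]])
    show "(\<lambda>t. g n t * f t) \<in> borel_measurable borel" for n
      using gm square_integrable_measurable[OF f(1)] by measurable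
    have "norm (g n t) \<le> \<bar>B\<bar>" for n t using bound[of n t] by linarith
    then show "norm (g n t * f t) \<le> norm (of_real B * f t)" for n t
      by (simp add: norm_mult mult_right_mono)
    show "(\<lambda>n. g n t * f t) \<longlonglongrightarrow> h t * f t" for t by (intro tendsto_intros lim)
  qed
  moreover have "closed D0_space" by (simp add: D0_space_def)
  ultimately show "abs_l2 (\<lambda>t. h t * f t) \<in> D0_space"
    using closed_sequentially[of D0_space "\<lambda>n. abs_l2 (\<lambda>t. g n t * f t)"] multiplier_mem[OF g f] by metis
qed

lemma bounded_mult_continuous:
  assumes f: "\<And>n. square_integrable (f n)" and g: "square_integrable g"
    and lim: "(\<lambda>n. abs_l2 (f n)) \<longlonglongrightarrow> abs_l2 g"
    and r: "r \<in> borel_measurable borel" and bound: "\<And>t. norm (r t) \<le> B"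
  shows "(\<lambda>n. abs_l2 (\<lambda>t. r t * f n t)) \<longlonglongrightarrow> abs_l2 (\<lambda>t. r t * g t)"
proof -
  note s = square_integrable_bounded_mult[OF _ r bound]
  have "norm (abs_l2 (\<lambda>t. r t * f n t) - abs_l2 (\<lambda>t. r t * g t)) \<le> B * norm (abs_l2 (f n) - abs_l2 g)" for n
    using norm_abs_l2_bounded_mult[OF square_integrable_diff[OF f g] r bound]
    by (simp add: abs_l2_diff s f g right_diff_distrib)
  moreover have "(\<lambda>n. B * norm (abs_l2 (f n) - abs_l2 g)) \<longlonglongrightarrow> B * norm (abs_l2 g - abs_l2 g)"
    by (intro tendsto_intros lim)
  then have "(\<lambda>n. B * norm (abs_l2 (f n) - abs_l2 g)) \<longlonglongrightarrow> 0" by simp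
  ultimately have "(\<lambda>n. abs_l2 (\<lambda>t. r t * f n t) - abs_l2 (\<lambda>t. r t * g t)) \<longlonglongrightarrow> 0"
    by (rule Lim_null_comparison[OF always_eventually[OF allI]])
  then show ?thesis by (simp add: LIM_zero_iff)
qed

lemma borel_measurable_inverse_affine: "(\<lambda>t::real. 1 / (complex_of_real t - z)) \<in> borel_measurable borel"
  by measurable

lemma multiplier_resolvent:
  assumes z: "Im z \<noteq> 0"
  shows "multiplier (\<lambda>t. 1 / (of_real t - z))"
  unfolding multiplier_def
proof (intro conjI allI impI borel_measurable_inverse_affine)
  show "\<exists>B. \<forall>t. norm (1 / (complex_of_real t - z)) \<le> B" using norm_inverse_affine_le[OF z] by blast
  fix f assume f: "square_integrable f" "abs_l2 f \<in> D0_space"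
  then obtain x where x: "\<And>n. x n \<in> abs_l2 ` D0" "x \<longlonglongrightarrow> abs_l2 f"
    unfolding D0_space_def closure_sequential by blast
  then have "\<forall>n. \<exists>g\<in>D0. x n = abs_l2 g" by blast
  then obtain g where g: "\<And>n. g n \<in> D0" "\<And>n. x n = abs_l2 (g n)" by metis
  have "(\<lambda>n. abs_l2 (\<lambda>t. 1 / (of_real t - z) * g n t)) \<longlonglongrightarrow> abs_l2 (\<lambda>t. 1 / (of_real t - z) * f t)"
    by (rule bounded_mult_continuous[OF D0_square_integrable[OF g(1)] f(1) _
          borel_measurable_inverse_affine norm_inverse_affine_le[OF z]]) (use x(2) in \<open>simp only: g(2)[symmetric]\<close>)
  then show "abs_l2 (\<lambda>t. 1 / (of_real t - z) * f t) \<in> D0_space"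
    unfolding D0_space_def closure_sequential
    using D0_resolvent(1)[OF g(1) z]
    by (intro exI[of _ "\<lambda>n. abs_l2 (\<lambda>t. 1 / (of_real t - z) * g n t)"]) blast
qed

lemma multiplier_C0: "f \<in> C0 \<Longrightarrow> multiplier f"
proof -
  assume "f \<in> C0"
  \<comment> \<open>Conjugates are carried along because the induction has a conjugation case, while
    the conjugate of a multiplier is not evidently one.\<close>
  then have "multiplier f \<and> multiplier (\<lambda>t. cnj (f t))"
  proof (induction f rule: C0_induct)
    case resolvent
    show ?case using multiplier_resolvent[of \<i>] multiplier_resolvent[of "- \<i>"] by simp
  next
    case (add f g)
    then show ?case using multiplier_add by simp
  next
    case (scale c f)
    then show ?case using multiplier_mult[OF multiplier_const] by simp
  next
    case (mult f g)
    then show ?case using multiplier_mult by simp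
  next
    case (cnj f)
    then show ?case by simp
  next
    case (limit f)
    have "\<exists>g. g \<in> C0 \<and> (multiplier g \<and> multiplier (\<lambda>t. cnj (g t))) \<and> (\<forall>t. norm (f t - g t) \<le> 1 / real (Suc n))" for n
      by (rule limit(2)) simp
    then obtain g where g: "\<And>n. multiplier (g n)" "\<And>n. multiplier (\<lambda>t. cnj (g n t))"
        "\<And>n t. norm (f t - g n t) \<le> 1 / real (Suc n)"
      by metis
    obtain B where B: "\<And>t. norm (f t) \<le> B" using limit(1) by (rule C0_bounded) blast
    have bound: "norm (g n t) \<le> B + 1" for n t
    proof -
      have "1 / real (Suc n) \<le> 1" by simp
      moreover have "f t - (f t - g n t) = g n t" by simp
      ultimately show ?thesis
        using norm_triangle_ineq4[of "f t" "f t - g n t"] B[of t] g(3)[of t n] by (smt (verit))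
    qed
    have lim: "(\<lambda>n. g n t) \<longlonglongrightarrow> f t" for t
    proof -
      have "(\<lambda>n. g n t - f t) \<longlonglongrightarrow> 0"
        by (rule Lim_null_comparison[OF always_eventually LIMSEQ_Suc[OF lim_1_over_n]])
          (use g(3) in \<open>auto simp: norm_minus_commute\<close>)
      then show ?thesis by (simp add: LIM_zero_iff)
    qed
    have "multiplier f" by (rule multiplier_limit[OF g(1) bound lim])
    moreover have "multiplier (\<lambda>t. cnj (f t))"
      by (rule multiplier_limit[OF g(2) _ tendsto_cnj[OF lim]]) (use bound in simp)
    ultimately show ?case by simp
  qed
  then show ?thesis by simp
qed

lemma multiplier_indicator_atMost: "multiplier (indicator {..a})"
proof -
  \<comment> \<open>A trapezoid: the right edge falls from 1 at \<open>a\<close> to 0 at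
    \<open>a + 1 / Suc n\<close>, and the left edge, which starts at \<open>- Suc n\<close> and
    moves out with \<open>n\<close>, makes the support compact.\<close>
  define r where "r n t = max 0 (min 1 (min (1 + real (Suc n) * (a - t)) (real (Suc n) + t)))" for n :: nat and t
  have "(\<lambda>t. complex_of_real (r n t)) \<in> C0" for n
    unfolding C0_iff
  proof
    show "continuous_on UNIV (\<lambda>t. complex_of_real (r n t))"
      unfolding r_def by (intro continuous_intros)
    have "\<forall>\<^sub>F t in at_infinity. complex_of_real (r n t) = 0"
      unfolding eventually_at_infinity
    proof (intro exI[of _ "\<bar>a\<bar> + real (Suc n)"] allI impI)
      fix t :: real assume t: "\<bar>a\<bar> + real (Suc n) \<le> norm t"
      show "complex_of_real (r n t) = 0"
      proof (cases "t \<ge> 0")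
        case True
        with t have "1 \<le> t - a" by simp
        then have "1 * 1 \<le> real (Suc n) * (t - a)" by (intro mult_mono) auto
        then have "1 + real (Suc n) * (a - t) \<le> 0" by (simp add: algebra_simps)
        then show ?thesis by (simp add: r_def)
      qed (use t in \<open>simp add: r_def\<close>)
    qed
    then show "((\<lambda>t. complex_of_real (r n t)) \<longlongrightarrow> 0) at_infinity" by (rule tendsto_eventually)
  qed
  moreover have "norm (complex_of_real (r n t)) \<le> 1" for n t by (simp add: r_def)
  moreover have "(\<lambda>n. complex_of_real (r n t)) \<longlonglongrightarrow> indicator {..a} t" for t
  proof (rule tendsto_eventually)
    \<comment> \<open>\<open>\<bar>t\<bar> + 1\<close> puts \<open>t\<close> beyond the left edge,
      and \<open>1 / \<bar>a - t\<bar>\<close> beyond the right one if \<open>t > a\<close>. At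
      \<open>t = a\<close> the quotient is 0 by convention, and for \<open>t \<le> a\<close> only
      its nonnegativity is used.\<close>
    obtain N :: nat where N: "\<bar>t\<bar> + 1 + 1 / \<bar>a - t\<bar> \<le> real N" using real_arch_simple by blast
    show "\<forall>\<^sub>F n in sequentially. complex_of_real (r n t) = indicator {..a} t"
      unfolding eventually_sequentially
    proof (intro exI[of _ N] allI impI)
      fix n assume n: "N \<le> n"
      have p: "0 \<le> 1 / \<bar>a - t\<bar>" by simp
      have nN: "real N \<le> real (Suc n)" using n by simp
      show "complex_of_real (r n t) = indicator {..a} t"
      proof (cases "t \<le> a")
        case True
        then have "0 \<le> real (Suc n) * (a - t)" by simp
        moreover have "1 \<le> real (Suc n) + t" using N nN p by linarith
        ultimately show ?thesis using True by (simp add: r_def)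
      next
        case False
        then have "1 / (t - a) \<le> real (Suc n)" using N nN by simp
        then have "1 \<le> real (Suc n) * (t - a)" using False by (simp add: divide_le_eq)
        then have "1 + real (Suc n) * (a - t) \<le> 0" by (simp add: algebra_simps)
        then show ?thesis using False by (simp add: r_def)
      qed
    qed
  qed
  ultimately show ?thesis by (intro multiplier_limit[OF multiplier_C0])
qed

text \<open>The half-lines form an intersection-stable generator, so complements and disjoint unions
  remain. Disjointness keeps the partial sums of indicators bounded by 1, as
  \<open>multiplier_limit\<close> demands.\<close>

lemma multiplier_indicator:
  assumes "A \<in> sets borel"
  shows "multiplier (indicator A)"
proof -
  let ?G = "range (\<lambda>a::real. {..a})"
  have "Int_stable ?G" by (auto simp: Int_stable_def)
  moreover have "?G \<subseteq> Pow UNIV" by simp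
  moreover have "A \<in> sigma_sets UNIV ?G" using assms by (simp add: borel_eq_atMost)
  ultimately show ?thesis
  proof (induction rule: sigma_sets_induct_disjoint)
    case (basic A)
    then show ?case using multiplier_indicator_atMost by blast
  next
    case empty
    then show ?case using multiplier_const[of 0] by simp
  next
    case (compl A)
    have "multiplier (\<lambda>t. 1 + (-1) * indicator A t)"
      by (intro multiplier_add multiplier_mult multiplier_const compl)
    moreover have "(\<lambda>t. 1 + (-1) * indicator A t) = (indicator (UNIV - A) :: real \<Rightarrow> complex)"
      by (auto simp: indicator_def)
    ultimately show ?case by simp
  next
    case (union A)
    show ?case
    proof (rule multiplier_limit)
      show "multiplier (\<lambda>t. \<Sum>i<n. indicator (A i) t)" for n
        by (intro multiplier_sum union) auto
      have eq: "(\<Sum>i<n. indicator (A i) t) = (indicator (\<Union>i<n. A i) t :: complex)" for n t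
        by (rule indicator_UN_disjoint[symmetric])
          (use union(1) in \<open>auto intro: disjoint_family_on_mono\<close>)
      show "norm (\<Sum>i<n. indicator (A i) t :: complex) \<le> 1" for n t
        unfolding eq by (simp add: indicator_def)
      show "(\<lambda>n. \<Sum>i<n. indicator (A i) t) \<longlonglongrightarrow> (indicator (\<Union>i. A i) t :: complex)" for t
        unfolding eq by (rule LIMSEQ_indicator_UN)
    qed
  qed
qed

lemma multiplier_simple_function:
  fixes s :: "real \<Rightarrow> complex"
  assumes s: "simple_function borel s"
  shows "multiplier s"
proof -
  have fin: "finite (range s)" using s by (simp add: simple_function_def)
  have "multiplier (\<lambda>t. \<Sum>y\<in>range s. y * indicator (s -` {y}) t)"
  proof (intro multiplier_sum fin multiplier_mult multiplier_const multiplier_indicator)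
    fix y assume "y \<in> range s"
    then show "s -` {y} \<in> sets borel" using s by (auto simp: simple_function_def)
  qed
  moreover have "(\<Sum>y\<in>range s. y * indicator (s -` {y}) t) = s t" for t
  proof -
    have "(\<Sum>y\<in>range s. y * indicator (s -` {y}) t) = (\<Sum>y\<in>range s. if y = s t then y else 0)"
      by (intro sum.cong) (auto simp: indicator_def)
    then show ?thesis using fin by simp
  qed
  ultimately show ?thesis by simp
qed

text \<open>Divide \<open>f\<close> by a Gaussian, which lies in \<open>D0\<close> and has no zeros,
  and approximate the quotient by simple functions of at most twice its modulus. Multiplied back by
  the Gaussian they are dominated by \<open>2 * f\<close>, and they belong to
  \<open>D0_space\<close> because simple functions are multipliers.\<close>

lemma D0_dense: "v \<in> closure (abs_l2 ` D0)"
proof -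
  obtain f where f: "square_integrable f" "v = abs_l2 f" by (rule l2_cases)
  define \<gamma> where "\<gamma> = gauss 1"
  have "\<gamma> \<in> D0" unfolding \<gamma>_def by (rule gauss_span_D0[OF gauss_span.base]) simp
  then have \<gamma>: "square_integrable \<gamma>" "abs_l2 \<gamma> \<in> D0_space"
    by (auto simp: D0_square_integrable D0_space_def intro!: closure_subset[THEN subsetD])
  have \<gamma>0: "\<gamma> t \<noteq> 0" for t by (simp add: \<gamma>_def gauss_def)
  note [measurable] = square_integrable_measurable[OF f(1)] square_integrable_measurable[OF \<gamma>(1)]
  have "(\<lambda>t. f t / \<gamma> t) \<in> borel_measurable borel" by measurable
  from borel_measurable_implies_sequence_metric[OF this, of 0]
  obtain s where s: "\<And>n. simple_function borel (s n)" "\<And>t. (\<lambda>n. s n t) \<longlonglongrightarrow> f t / \<gamma> t"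
    "\<And>n t. norm (s n t) \<le> 2 * norm (f t / \<gamma> t)" by auto
  have "(\<lambda>n. abs_l2 (\<lambda>t. s n t * \<gamma> t)) \<longlonglongrightarrow> abs_l2 f"
  proof (rule l2_dominated_convergence(2)[OF square_integrable_cmult[OF f(1), of 2]])
    show "(\<lambda>t. s n t * \<gamma> t) \<in> borel_measurable borel" for n
      using borel_measurable_simple_function[OF s(1)] by measurable
    show "norm (s n t * \<gamma> t) \<le> norm (2 * f t)" for n t
      using mult_right_mono[OF s(3)[of n t] norm_ge_zero[of "\<gamma> t"]] \<gamma>0[of t]
      by (simp add: norm_mult norm_divide)
    show "(\<lambda>n. s n t * \<gamma> t) \<longlonglongrightarrow> f t" for t
      using tendsto_mult[OF s(2)[of t] tendsto_const[of "\<gamma> t"]] \<gamma>0[of t] by simp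
  qed
  moreover have "abs_l2 (\<lambda>t. s n t * \<gamma> t) \<in> D0_space" for n
    by (rule multiplier_mem[OF multiplier_simple_function[OF s(1)] \<gamma>])
  moreover have "closed D0_space" by (simp add: D0_space_def)
  ultimately have "abs_l2 f \<in> D0_space"
    using closed_sequentially[of D0_space "\<lambda>n. abs_l2 (\<lambda>t. s n t * \<gamma> t)"] by metis
  then show ?thesis by (simp add: f D0_space_def)
qed

lemma D0_approximates:
  assumes "e > 0"
  obtains f where "f \<in> D0" "norm (abs_l2 f - v) < e"
  using D0_dense[of v] assms unfolding closure_approachable dist_norm by blast

section \<open>Closures of symmetric operators with dense shifted ranges\<close>

lemma tendsto_cinner:
  assumes "(f \<longlongrightarrow> a) F" "(g \<longlongrightarrow> b) F"
  shows "((\<lambda>n. cinner (f n) (g n)) \<longlongrightarrow> cinner a b) F"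
proof -
  have "((\<lambda>n. complex_of_real (inner (f n) (g n)) + \<i> * complex_of_real (inner (- \<i> *\<^sub>C f n) (g n)))
      \<longlongrightarrow> complex_of_real (inner a b) + \<i> * complex_of_real (inner (- \<i> *\<^sub>C a) b)) F"
    by (intro tendsto_intros assms bounded_linear.tendsto[OF bounded_linear_cscale])
  then show ?thesis by (simp only: cinner_conv_inner[symmetric])
qed

text \<open>Linearity and symmetry pass to limits in the graph, and a dense range stays dense when
  the graph grows.\<close>

lemma essentially_selfadjoint_closure:
  fixes S :: l2_operator
  assumes lin: "\<And>u y u' y' a b. (u, y) \<in> S \<Longrightarrow> (u', y') \<in> S \<Longrightarrow> (a *\<^sub>C u + b *\<^sub>C u', a *\<^sub>C y + b *\<^sub>C y') \<in> S"
    and sym: "\<And>u y u' y'. (u, y) \<in> S \<Longrightarrow> (u', y') \<in> S \<Longrightarrow> cinner y u' = cinner u y'"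
    and dense: "\<And>z e w. z \<in> {\<i>, - \<i>} \<Longrightarrow> e > 0 \<Longrightarrow> \<exists>u y. (u, y) \<in> S \<and> norm (y - z *\<^sub>C u - w) < e"
  shows "essentially_selfadjoint (closure S)"
proof -
  have seq: "\<exists>x z. (\<forall>n. (x n, z n) \<in> S) \<and> x \<longlonglongrightarrow> u \<and> z \<longlonglongrightarrow> y" if uy: "(u, y) \<in> closure S" for u y
  proof -
    obtain p where p: "\<And>n. p n \<in> S" "p \<longlonglongrightarrow> (u, y)" using uy unfolding closure_sequential by blast
    then show ?thesis
      using tendsto_fst[OF p(2)] tendsto_snd[OF p(2)]
      by (intro exI[of _ "\<lambda>n. fst (p n)"] exI[of _ "\<lambda>n. snd (p n)"]) simp
  qed
  have lin': "(a *\<^sub>C u + b *\<^sub>C u', a *\<^sub>C y + b *\<^sub>C y') \<in> closure S"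
    if uy: "(u, y) \<in> closure S" "(u', y') \<in> closure S" for u y u' y' a b
  proof -
    obtain x z where xz: "\<And>n. (x n, z n) \<in> S" "x \<longlonglongrightarrow> u" "z \<longlonglongrightarrow> y" using seq[OF uy(1)] by blast
    obtain x' z' where xz': "\<And>n. (x' n, z' n) \<in> S" "x' \<longlonglongrightarrow> u'" "z' \<longlonglongrightarrow> y'" using seq[OF uy(2)] by blast
    have "(\<lambda>n. (a *\<^sub>C x n + b *\<^sub>C x' n, a *\<^sub>C z n + b *\<^sub>C z' n)) \<longlonglongrightarrow> (a *\<^sub>C u + b *\<^sub>C u', a *\<^sub>C y + b *\<^sub>C y')"
      by (intro tendsto_Pair tendsto_add bounded_linear.tendsto[OF bounded_linear_cscale] xz xz')
    then show ?thesis
      unfolding closure_sequential using lin[OF xz(1) xz'(1)]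
      by (intro exI[of _ "\<lambda>n. (a *\<^sub>C x n + b *\<^sub>C x' n, a *\<^sub>C z n + b *\<^sub>C z' n)"]) blast
  qed
  show ?thesis
  proof
    fix u y u' y' c assume uy: "(u, y) \<in> closure S"
    show "(c *\<^sub>C u, c *\<^sub>C y) \<in> closure S" using lin'[OF uy uy, of c 0] by simp
    assume uy': "(u', y') \<in> closure S"
    show "(u + u', y + y') \<in> closure S" using lin'[OF uy uy', of 1 1] by simp
    obtain x z where xz: "\<And>n. (x n, z n) \<in> S" "x \<longlonglongrightarrow> u" "z \<longlonglongrightarrow> y" using seq[OF uy] by blast
    obtain x' z' where xz': "\<And>n. (x' n, z' n) \<in> S" "x' \<longlonglongrightarrow> u'" "z' \<longlonglongrightarrow> y'" using seq[OF uy'] by blast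
    have "(\<lambda>n. cinner (z n) (x' n)) \<longlonglongrightarrow> cinner y u'" "(\<lambda>n. cinner (x n) (z' n)) \<longlonglongrightarrow> cinner u y'"
      by (intro tendsto_cinner xz xz')+
    then show "cinner y u' = cinner u y'"
      using sym[OF xz(1) xz'(1)] LIMSEQ_unique by simp
  next
    fix z w and e :: real assume "z \<in> {\<i>, - \<i>}" "e > 0"
    then show "\<exists>u y. (u, y) \<in> closure S \<and> norm (y - z *\<^sub>C u - w) < e"
      using dense closure_subset by blast
  qed simp
qed

lemma D0_times_square_integrable: "f \<in> D0 \<Longrightarrow> square_integrable (\<lambda>t. of_real t * f t)"
  by (simp add: D0_iff rapid_times rapid_square_integrable)

lemma D0_derivative_square_integrable: "f \<in> D0 \<Longrightarrow> square_integrable (nth_derivative 1 f)"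
  by (simp add: D0_iff rapid_square_integrable)

lemma essentially_selfadjoint_position: "essentially_selfadjoint position_op"
  unfolding position_op_def
proof (rule essentially_selfadjoint_closure)
  let ?S = "{(abs_l2 f, abs_l2 (\<lambda>t. of_real t * f t)) | f. f \<in> D0}"
  note s = D0_square_integrable D0_times_square_integrable
  fix u y u' y' a b assume "(u, y) \<in> ?S" "(u', y') \<in> ?S"
  then obtain f g where f: "f \<in> D0" "u = abs_l2 f" "y = abs_l2 (\<lambda>t. of_real t * f t)"
    and g: "g \<in> D0" "u' = abs_l2 g" "y' = abs_l2 (\<lambda>t. of_real t * g t)" by blast
  have "a *\<^sub>C u + b *\<^sub>C u' = abs_l2 (\<lambda>t. a * f t + b * g t)"
    by (simp add: f g s abs_l2_cscale abs_l2_add square_integrable_cmult)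
  moreover have "a *\<^sub>C y + b *\<^sub>C y' = abs_l2 (\<lambda>t. of_real t * (a * f t + b * g t))"
    by (simp add: f g s abs_l2_cscale abs_l2_add square_integrable_cmult algebra_simps)
  ultimately show "(a *\<^sub>C u + b *\<^sub>C u', a *\<^sub>C y + b *\<^sub>C y') \<in> ?S"
    using D0_lincomb[OF f(1) g(1), of a b] by blast
  show "cinner y u' = cinner u y'"
    by (simp add: f g s cinner_abs_l2 mult_ac)
next
  let ?S = "{(abs_l2 f, abs_l2 (\<lambda>t. of_real t * f t)) | f. f \<in> D0}"
  fix z :: complex and e :: real and w assume z: "z \<in> {\<i>, - \<i>}" and e: "e > 0"
  obtain g where g: "g \<in> D0" "norm (abs_l2 g - w) < e" using D0_approximates[OF e] by blast
  have z0: "Im z \<noteq> 0" using z by auto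
  \<comment> \<open>An exact preimage of \<open>g\<close> under the shifted position, so density of
    \<open>D0\<close> gives density of the range.\<close>
  define f where "f t = 1 / (of_real t - z) * g t" for t
  have f: "f \<in> D0" unfolding f_def by (rule D0_resolvent(1)[OF g(1) z0])
  have "of_real t * f t - z * f t = g t" for t
  proof -
    have "of_real t * f t - z * f t = (of_real t - z) * f t" by (simp add: left_diff_distrib)
    then show ?thesis using of_real_diff_neq_0[OF z0, of t] by (simp add: f_def)
  qed
  then have "abs_l2 (\<lambda>t. of_real t * f t) - z *\<^sub>C abs_l2 f = abs_l2 g"
    by (simp add: abs_l2_cscale abs_l2_diff square_integrable_cmult D0_square_integrable
        D0_times_square_integrable f)
  with g f show "\<exists>u y. (u, y) \<in> ?S \<and> norm (y - z *\<^sub>C u - w) < e"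
    by (intro exI[of _ "abs_l2 f"] exI[of _ "abs_l2 (\<lambda>t. of_real t * f t)"]) auto
qed

text \<open>Symmetry is integration by parts; the range condition is \<open>D0_solve\<close>, which
  hits every element of \<open>D0\<close> exactly.\<close>

lemma essentially_selfadjoint_momentum:
  assumes hbar: "hbar \<noteq> 0"
  shows "essentially_selfadjoint (momentum_op hbar)"
  unfolding momentum_op_def
proof (rule essentially_selfadjoint_closure)
  let ?S = "{(abs_l2 f, abs_l2 (\<lambda>t. - \<i> * of_real hbar * nth_derivative 1 f t)) | f. f \<in> D0}"
  note s = D0_square_integrable D0_derivative_square_integrable
  fix u y u' y' a b assume "(u, y) \<in> ?S" "(u', y') \<in> ?S"
  then obtain f g where f: "f \<in> D0" "u = abs_l2 f" "y = abs_l2 (\<lambda>t. - \<i> * of_real hbar * nth_derivative 1 f t)"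
    and g: "g \<in> D0" "u' = abs_l2 g" "y' = abs_l2 (\<lambda>t. - \<i> * of_real hbar * nth_derivative 1 g t)" by blast
  have sf: "square_integrable (\<lambda>t. - \<i> * of_real hbar * nth_derivative 1 f t)"
    and sg: "square_integrable (\<lambda>t. - \<i> * of_real hbar * nth_derivative 1 g t)"
    by (intro square_integrable_cmult s f g)+
  have "a *\<^sub>C u + b *\<^sub>C u' = abs_l2 (\<lambda>t. a * f t + b * g t)"
    by (simp add: f g s abs_l2_cscale abs_l2_add square_integrable_cmult)
  moreover have "a *\<^sub>C y + b *\<^sub>C y' = abs_l2 (\<lambda>t. - \<i> * of_real hbar * nth_derivative 1 (\<lambda>t. a * f t + b * g t) t)"
    unfolding nth_derivative_1_lincomb[OF f(1) g(1)] f(3) g(3)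
      abs_l2_cscale[OF sf] abs_l2_cscale[OF sg]
      abs_l2_add[OF square_integrable_cmult[OF sf] square_integrable_cmult[OF sg]]
    by (rule arg_cong[of _ _ abs_l2]) (simp add: fun_eq_iff algebra_simps)
  ultimately show "(a *\<^sub>C u + b *\<^sub>C u', a *\<^sub>C y + b *\<^sub>C y') \<in> ?S"
    using D0_lincomb[OF f(1) g(1), of a b] by blast
  have "cinner u y' - cinner y u' = \<i> * of_real hbar *
      (\<integral>t. f t * cnj (nth_derivative 1 g t) + nth_derivative 1 f t * cnj (g t) \<partial>lborel)"
  proof -
    have "cinner u y' - cinner y u' =
        (\<integral>t. f t * cnj (- \<i> * of_real hbar * nth_derivative 1 g t)
          - - \<i> * of_real hbar * nth_derivative 1 f t * cnj (g t) \<partial>lborel)"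
      unfolding f(2,3) g(2,3)
      by (subst cinner_abs_l2, (fact sf sg s(1)[OF f(1)] s(1)[OF g(1)])+)+
        (rule Bochner_Integration.integral_diff[symmetric]; intro square_integrable_mult_cnj s f g sf sg)
    also have "\<dots> = (\<integral>t. \<i> * of_real hbar * (f t * cnj (nth_derivative 1 g t) + nth_derivative 1 f t * cnj (g t)) \<partial>lborel)"
      by (intro Bochner_Integration.integral_cong refl) (simp add: algebra_simps)
    finally show ?thesis by simp
  qed
  then show "cinner y u' = cinner u y'"
    unfolding D0_integration_by_parts[OF f(1) g(1)] by simp
next
  let ?S = "{(abs_l2 f, abs_l2 (\<lambda>t. - \<i> * of_real hbar * nth_derivative 1 f t)) | f. f \<in> D0}"
  fix z :: complex and e :: real and w assume z: "z \<in> {\<i>, - \<i>}" and e: "e > 0"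
  obtain g where g: "g \<in> D0" "norm (abs_l2 g - w) < e" using D0_approximates[OF e] by blast
  have zg: "(\<lambda>t. z * g t + 0 * g t) \<in> D0" by (rule D0_lincomb[OF g(1) g(1)])
  \<comment> \<open>Multiplying \<open>- \<i> * hbar * f' - z * f = g\<close> by \<open>z\<close>
    and using \<open>z * z = -1\<close> gives \<open>f + c * f' = z * g\<close>, where the sign of
    \<open>c\<close> absorbs the choice of \<open>z\<close>.\<close>
  define c where "c = (if z = \<i> then hbar else - hbar)"
  have c: "c \<noteq> 0" "- \<i> * of_real hbar = - z * of_real c" "z * z = -1"
    using hbar z by (auto simp: c_def)
  obtain f where f: "f \<in> D0" "\<And>t. f t + of_real c * nth_derivative 1 f t = z * g t"
    using D0_solve[OF zg c(1)] by auto
  have "- \<i> * of_real hbar * nth_derivative 1 f t - z * f t = g t" for t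
  proof -
    have "- \<i> * of_real hbar * nth_derivative 1 f t - z * f t = - z * (f t + of_real c * nth_derivative 1 f t)"
      unfolding c(2) by (simp add: algebra_simps)
    also have "\<dots> = - (z * z) * g t" by (simp add: f(2))
    finally show ?thesis by (simp add: c(3))
  qed
  then have "abs_l2 (\<lambda>t. - \<i> * of_real hbar * nth_derivative 1 f t) - z *\<^sub>C abs_l2 f = abs_l2 g"
    by (simp only: abs_l2_cscale[OF D0_square_integrable[OF f(1)]]
        abs_l2_diff[OF square_integrable_cmult[OF D0_derivative_square_integrable[OF f(1)]]
          square_integrable_cmult[OF D0_square_integrable[OF f(1)]]])
  with g f show "\<exists>u y. (u, y) \<in> ?S \<and> norm (y - z *\<^sub>C u - w) < e"
    by (intro exI[of _ "abs_l2 f"] exI[of _ "abs_l2 (\<lambda>t. - \<i> * of_real hbar * nth_derivative 1 f t)"]) auto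
qed

section \<open>Joint approximate eigenvectors\<close>

context functional_calculus
begin

text \<open>With \<open>g = (t - \<i>) * f\<close>, multiplicativity writes \<open>\<Phi> f\<close>
  as the resolvent at \<i> after \<open>\<Phi> g\<close>, which places its range in the domain of
  \<open>h\<close>.\<close>

lemma calc_in_graph:
  assumes f: "f \<in> C0" and tf: "(\<lambda>t. of_real t * f t) \<in> C0"
  shows "(\<Phi> f v, \<Phi> (\<lambda>t. of_real t * f t) v) \<in> h"
proof -
  define g where "g t = of_real t * f t - \<i> * f t" for t
  have g: "g \<in> C0" unfolding g_def by (intro C0_diff C0_scale f tf)
  have r: "(\<lambda>t. 1 / (of_real t - \<i>)) \<in> C0" by (simp add: C0_inverse_affine)
  have "(\<lambda>t. 1 / (of_real t - \<i>) * g t) = f"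
  proof
    fix t
    have "g t = (of_real t - \<i>) * f t" by (simp add: g_def left_diff_distrib)
    then show "1 / (of_real t - \<i>) * g t = f t" using of_real_diff_neq_0[of \<i> t] by simp
  qed
  then have "\<Phi> f v = \<Phi> (\<lambda>t. 1 / (of_real t - \<i>)) (\<Phi> g v)"
    using calc_mult[OF r g] by simp
  then have "(\<Phi> f v, \<Phi> g v + \<i> *\<^sub>C \<Phi> f v) \<in> h"
    using calc_resolvent[of \<i>] by simp
  moreover have "\<Phi> g v = \<Phi> (\<lambda>t. of_real t * f t) v - \<i> *\<^sub>C \<Phi> f v"
    unfolding g_def by (simp add: calc_diff calc_scale f tf C0_scale)
  ultimately show ?thesis by simp
qed

text \<open>Neither the constant 1 nor \<open>t * g t\<close> need lie in \<open>C0\<close>, so the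
  calculus does not apply to the identity directly. Writing \<open>v\<close> as the resolvent of
  some \<open>w\<close> multiplies both sides by \<open>r\<close>, which brings every term into
  \<open>C0\<close>.\<close>

lemma calc_cutoff_diff:
  assumes vy: "(v, y) \<in> h" and f: "f \<in> C0" and g: "g \<in> C0"
    and fg: "\<And>t. 1 - f t = of_real t * g t"
  shows "v - \<Phi> f v = \<Phi> g y"
proof -
  define r where "r t = 1 / (complex_of_real t - \<i>)" for t
  have r: "r \<in> C0" unfolding r_def[abs_def] by (simp add: C0_inverse_affine)
  define w where "w = y - \<i> *\<^sub>C v"
  have "(v, w + \<i> *\<^sub>C v) \<in> h" using vy by (simp add: w_def)
  then have v: "v = \<Phi> r w" using calc_resolvent[of \<i>] by (simp add: r_def[abs_def])
  have y: "y = w + \<i> *\<^sub>C \<Phi> r w" unfolding v[symmetric] by (simp add: w_def)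
  have rt: "r t * (of_real t - \<i>) = 1" for t using of_real_diff_neq_0[of \<i> t] by (simp add: r_def)
  have "(\<lambda>t. r t - f t * r t) = (\<lambda>t. g t + \<i> * (g t * r t))"
  proof
    fix t
    have "r t - f t * r t = r t * (1 - f t)" by (simp add: algebra_simps)
    also have "\<dots> = g t * (r t * (of_real t - \<i>)) + \<i> * (g t * r t)"
      unfolding fg by (simp add: algebra_simps)
    finally show "r t - f t * r t = g t + \<i> * (g t * r t)" by (simp add: rt)
  qed
  then have "\<Phi> (\<lambda>t. r t - f t * r t) w = \<Phi> (\<lambda>t. g t + \<i> * (g t * r t)) w" by simp
  also have "\<Phi> (\<lambda>t. r t - f t * r t) w = \<Phi> r w - \<Phi> f (\<Phi> r w)"
    by (simp add: calc_diff calc_mult f r C0_mult)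
  also have "\<Phi> (\<lambda>t. g t + \<i> * (g t * r t)) w = \<Phi> g y"
    unfolding y by (simp add: calc_add calc_scale calc_mult calc_cscale g r C0_mult C0_scale blinfun.add_left blinfun.add_right)
  finally show ?thesis by (simp only: v[symmetric])
qed

end

section \<open>Cutoff functions and the grid\<close>

lemma C0_compact_support:
  assumes "continuous_on UNIV f" "\<And>t. \<bar>t\<bar> \<ge> a \<Longrightarrow> f t = 0"
  shows "f \<in> C0"
  unfolding C0_iff
proof
  have "\<forall>\<^sub>F t in at_infinity. f t = 0"
    unfolding eventually_at_infinity using assms(2) by auto
  then show "(f \<longlongrightarrow> 0) at_infinity" by (rule tendsto_eventually)
qed fact

lemma theta_eq:
  assumes "\<eta> > 0"
  shows "theta l \<eta> t = max 0 (min 1 (4 * (\<eta> - \<bar>t - l\<bar>) / \<eta>))"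
  using assms by (auto simp: theta_def max_def min_def field_simps)

lemma theta_range: "\<eta> > 0 \<Longrightarrow> 0 \<le> theta l \<eta> t" "\<eta> > 0 \<Longrightarrow> theta l \<eta> t \<le> 1"
  by (simp_all add: theta_eq)

lemma continuous_theta: "\<eta> > 0 \<Longrightarrow> continuous_on UNIV (theta l \<eta>)"
proof -
  assume \<eta>: "\<eta> > 0"
  have "theta l \<eta> = (\<lambda>t. max 0 (min 1 (4 * (\<eta> - \<bar>t - l\<bar>) / \<eta>)))" by (rule ext, rule theta_eq[OF \<eta>])
  then show ?thesis using \<eta> by (simp only:) (intro continuous_intros, auto)
qed

lemma C0_theta_mult:
  assumes \<eta>: "\<eta> > 0" and g: "continuous_on UNIV g"
  shows "(\<lambda>t. g t * of_real (theta l \<eta> t)) \<in> C0"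
proof (rule C0_compact_support[where a="\<bar>l\<bar> + \<eta>"])
  show "continuous_on UNIV (\<lambda>t. g t * of_real (theta l \<eta> t))"
    by (intro continuous_intros continuous_theta[OF \<eta>] g)
  fix t :: real assume "\<bar>l\<bar> + \<eta> \<le> \<bar>t\<bar>"
  then have "\<eta> \<le> \<bar>t - l\<bar>" by linarith
  then show "g t * of_real (theta l \<eta> t) = 0" using \<eta> by (simp add: theta_def)
qed

lemma C0_theta: "\<eta> > 0 \<Longrightarrow> (\<lambda>t. of_real (theta l \<eta> t)) \<in> C0"
  using C0_theta_mult[of \<eta> "\<lambda>_. 1" l] by simp

text \<open>\<open>(1 - theta 0 \<eta> t) / t\<close>, written so that its continuity at \<open>0\<close> is apparent.\<close>

definition cutoff_quotient :: "real \<Rightarrow> real \<Rightarrow> complex" where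
  "cutoff_quotient \<eta> t = of_real ((1 - theta 0 \<eta> t) * (t / max (t\<^sup>2) ((3 * \<eta> / 4)\<^sup>2)))"

text \<open>The numerator vanishes for \<open>\<bar>t\<bar> \<le> 3 * \<eta> / 4\<close>. Outside,
  the \<open>max\<close> is \<open>t\<^sup>2\<close>, so the quotient is at most
  \<open>1 / \<bar>t\<bar>\<close>, which explains the bound
  \<open>4 / (3 * \<eta>)\<close>.\<close>

lemma cutoff_quotient:
  assumes \<eta>: "\<eta> > 0"
  shows "cutoff_quotient \<eta> \<in> C0"
    and "1 - of_real (theta 0 \<eta> t) = of_real t * cutoff_quotient \<eta> t"
    and "norm (cutoff_quotient \<eta> t) \<le> 4 / (3 * \<eta>)"
proof -
  let ?m = "\<lambda>t. max (t\<^sup>2) ((3 * \<eta> / 4)\<^sup>2)"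
  have m: "?m t > 0" for t using \<eta> by (simp add: less_max_iff_disj)
  have k: "\<bar>(1 - theta 0 \<eta> t) * (t / ?m t)\<bar> \<le> \<bar>t / ?m t\<bar>" for t
    unfolding abs_mult[of "1 - theta 0 \<eta> t"] using theta_range[OF \<eta>, of 0 t]
    by (intro mult_left_le_one_le) auto
  have far: "?m t = t\<^sup>2" "t \<noteq> 0" if "theta 0 \<eta> t \<noteq> 1" for t
  proof -
    have "3 * \<eta> / 4 < \<bar>t\<bar>" using that by (auto simp: theta_def split: if_splits)
    then have "(3 * \<eta> / 4)\<^sup>2 \<le> \<bar>t\<bar>\<^sup>2" using \<eta> by (intro power_mono) auto
    then show "?m t = t\<^sup>2" by simp
    show "t \<noteq> 0" using \<open>3 * \<eta> / 4 < \<bar>t\<bar>\<close> \<eta> by auto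
  qed
  show "cutoff_quotient \<eta> \<in> C0"
    unfolding C0_iff
  proof
    show "continuous_on UNIV (cutoff_quotient \<eta>)"
      unfolding cutoff_quotient_def[abs_def] using m
      by (intro continuous_intros continuous_theta[OF \<eta>]) (metis less_irrefl)
    show "(cutoff_quotient \<eta> \<longlongrightarrow> 0) at_infinity"
    proof (rule Lim_null_comparison[OF always_eventually[OF allI]])
      show "((\<lambda>t::real. norm (inverse t)) \<longlongrightarrow> 0) at_infinity"
        by (intro tendsto_norm_zero tendsto_inverse_0)
      fix t :: real
      have "\<bar>t / ?m t\<bar> \<le> \<bar>inverse t\<bar>"
      proof (cases "t = 0")
        case False
        have "\<bar>t\<bar> / ?m t \<le> \<bar>t\<bar> / t\<^sup>2" using False m[of t] by (intro divide_left_mono) auto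
        then show ?thesis using False m[of t] by (simp add: abs_divide power2_eq_square divide_simps)
      qed simp
      then show "norm (cutoff_quotient \<eta> t) \<le> norm (inverse t)"
        using k[of t] unfolding cutoff_quotient_def norm_of_real real_norm_def by linarith
    qed
  qed
  show "1 - of_real (theta 0 \<eta> t) = of_real t * cutoff_quotient \<eta> t"
  proof (cases "theta 0 \<eta> t = 1")
    case False
    then show ?thesis using far[OF False] by (simp add: cutoff_quotient_def power2_eq_square)
  qed (simp add: cutoff_quotient_def)
  show "norm (cutoff_quotient \<eta> t) \<le> 4 / (3 * \<eta>)"
  proof -
    have "\<bar>t / ?m t\<bar> \<le> 4 / (3 * \<eta>)"
    proof (cases "\<bar>t\<bar> \<le> 3 * \<eta> / 4")
      case True
      have "\<bar>t\<bar> / ?m t \<le> (3 * \<eta> / 4) / ((3 * \<eta> / 4)\<^sup>2)"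
        using True \<eta> by (intro frac_le) auto
      also have "\<dots> = 4 / (3 * \<eta>)" using \<eta> by (simp add: power2_eq_square field_simps)
      finally show ?thesis using m[of t] by (simp add: abs_divide)
    next
      case False
      then have "t \<noteq> 0" using \<eta> by auto
      have "\<bar>t\<bar> / ?m t \<le> \<bar>t\<bar> / \<bar>t\<bar>\<^sup>2" using \<open>t \<noteq> 0\<close> m[of t] by (intro divide_left_mono) auto
      also have "\<dots> = 1 / \<bar>t\<bar>" using \<open>t \<noteq> 0\<close> by (metis abs_eq_0 nonzero_divide_mult_cancel_left power2_eq_square)
      also have "\<dots> \<le> 1 / (3 * \<eta> / 4)" using False \<eta> by (intro divide_left_mono) auto
      finally show ?thesis using m[of t] by (simp add: abs_divide)
    qed
    with k[of t] show ?thesis unfolding cutoff_quotient_def norm_of_real by linarith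
  qed
qed

lemma zero_in_D_grid:
  assumes "M > 1" "\<eta> > 0"
  shows "(0, 0) \<in> D_grid M \<eta>"
proof -
  let ?L = "{l::nat. l > 0 \<and> (M + 1) / real l < \<eta> / (2 * sqrt 2)}"
  have pos: "\<eta> / (2 * sqrt 2) > 0" using assms by simp
  obtain l :: nat where l: "(M + 1) / (\<eta> / (2 * sqrt 2)) < real l" using reals_Archimedean2 by blast
  have "0 < (M + 1) / (\<eta> / (2 * sqrt 2))" using assms pos by (intro divide_pos_pos) auto
  with l have l0: "0 < real l" by linarith
  have "M + 1 < real l * (\<eta> / (2 * sqrt 2))" using l pos by (subst (asm) pos_divide_less_eq) auto
  then have "(M + 1) / real l < \<eta> / (2 * sqrt 2)" using l0 by (subst pos_divide_less_eq) (auto simp: mult.commute)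
  with l0 have "?L \<noteq> {}" by auto
  \<comment> \<open>Nonemptiness puts the infimum into the set, whose elements are positive; so the
    layer of denominator 1, which contains the origin, belongs to the grid.\<close>
  then have "Inf ?L \<in> ?L" by (rule Inf_nat_def1)
  then have "1 \<in> {1..grid_index M \<eta>}" by (simp add: grid_index_def)
  moreover have "(0, 0) \<in> {(of_int m1 / real 1, of_int m2 / real 1) | m1 m2 :: int.
        \<bar>of_int m1\<bar> \<le> M * real 1 \<and> \<bar>of_int m2\<bar> \<le> M * real 1}"
    using assms by (intro CollectI exI[of _ 0]) auto
  ultimately have "(0, 0) \<in> rational_grid (grid_index M \<eta>) M" unfolding rational_grid_def by blast
  then show ?thesis using assms by (simp add: D_grid_def zero_prod_def[symmetric])
qed

section \<open>Resolvents of the position as multiplication operators and their commutators with the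
  momentum\<close>

lemma position_calc_resolvent:
  assumes \<Phi>: "is_functional_calculus position_op \<Phi>" and z: "Im z \<noteq> 0" and f: "square_integrable f"
  shows "\<Phi> (\<lambda>t. 1 / (of_real t - z)) (abs_l2 f) = abs_l2 (\<lambda>t. 1 / (of_real t - z) * f t)"
proof -
  interpret functional_calculus position_op \<Phi> by standard fact
  have D0: "\<Phi> (\<lambda>t. 1 / (of_real t - z)) (abs_l2 g) = abs_l2 (\<lambda>t. 1 / (of_real t - z) * g t)" if g: "g \<in> D0" for g
  proof -
    define r where "r t = 1 / (of_real t - z) * g t" for t
    have r: "r \<in> D0" unfolding r_def by (rule D0_resolvent(1)[OF g z])
    have "(abs_l2 r, abs_l2 (\<lambda>t. of_real t * r t)) \<in> position_op"
      unfolding position_op_def using closure_subset r by fast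
    moreover have "of_real t * r t = g t + z * r t" for t
    proof -
      have "of_real t * r t - z * r t = (of_real t - z) * r t" by (simp add: left_diff_distrib)
      also have "\<dots> = g t" using of_real_diff_neq_0[OF z, of t] by (simp add: r_def)
      finally show ?thesis by (simp add: algebra_simps)
    qed
    then have "abs_l2 (\<lambda>t. of_real t * r t) = abs_l2 g + z *\<^sub>C abs_l2 r"
      by (simp add: abs_l2_cscale abs_l2_add D0_square_integrable r g square_integrable_cmult)
    ultimately show ?thesis using calc_resolvent[OF z] by (simp add: r_def[abs_def])
  qed
  \<comment> \<open>Both sides are bounded in the vector, so agreement extends from
    \<open>D0\<close> by density.\<close>
  obtain x where x: "\<And>n. x n \<in> abs_l2 ` D0" "x \<longlonglongrightarrow> abs_l2 f"
    using D0_dense[of "abs_l2 f"] unfolding closure_sequential by blast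
  then have "\<forall>n. \<exists>g\<in>D0. x n = abs_l2 g" by blast
  then obtain g where g: "\<And>n. g n \<in> D0" "\<And>n. x n = abs_l2 (g n)" by metis
  have lim: "(\<lambda>n. abs_l2 (g n)) \<longlonglongrightarrow> abs_l2 f" using x(2) by (simp only: g(2)[symmetric])
  have "(\<lambda>n. \<Phi> (\<lambda>t. 1 / (of_real t - z)) (abs_l2 (g n))) \<longlonglongrightarrow> \<Phi> (\<lambda>t. 1 / (of_real t - z)) (abs_l2 f)"
    by (intro blinfun.tendsto tendsto_const lim)
  then have "(\<lambda>n. abs_l2 (\<lambda>t. 1 / (of_real t - z) * g n t)) \<longlonglongrightarrow> \<Phi> (\<lambda>t. 1 / (of_real t - z)) (abs_l2 f)"
    by (simp only: D0[OF g(1)])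
  moreover have "(\<lambda>n. abs_l2 (\<lambda>t. 1 / (of_real t - z) * g n t)) \<longlonglongrightarrow> abs_l2 (\<lambda>t. 1 / (of_real t - z) * f t)"
    by (rule bounded_mult_continuous[OF D0_square_integrable[OF g(1)] f lim
          borel_measurable_inverse_affine norm_inverse_affine_le[OF z]])
  ultimately show ?thesis by (rule LIMSEQ_unique)
qed

text \<open>The canonical commutation relation in the form \<open>[S\<^sub>h, R] = \<i> h R\<^sup>2\<close> for resolvents \<open>R\<close> of
  the position.\<close>

lemma momentum_position_resolvent_commutator:
  assumes \<Phi>: "is_functional_calculus position_op \<Phi>" and z: "Im z \<noteq> 0"
    and R: "R = \<Phi> (\<lambda>t. 1 / (of_real t - z))"
    and w: "(w, w') \<in> momentum_op hbar"
  shows "(R w, R w' + (\<i> * of_real hbar) *\<^sub>C R (R w)) \<in> momentum_op hbar"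
proof -
  let ?S = "{(abs_l2 f, abs_l2 (\<lambda>t. - \<i> * of_real hbar * nth_derivative 1 f t)) | f. f \<in> D0}"
  obtain p where p: "\<And>n. p n \<in> ?S" "p \<longlonglongrightarrow> (w, w')"
    using w unfolding momentum_op_def closure_sequential by blast
  \<comment> \<open>On the core this is the product rule: the derivative of \<open>r\<close> is
    \<open>- r\<^sup>2\<close>, and the factor \<open>- \<i> * hbar\<close> turns it into the
    commutator term. The closure follows since \<open>R\<close> is continuous.\<close>
  have S: "(R u, R u' + (\<i> * of_real hbar) *\<^sub>C R (R u)) \<in> ?S" if uu: "(u, u') \<in> ?S" for u u'
  proof -
    obtain f where f: "f \<in> D0" "u = abs_l2 f" "u' = abs_l2 (\<lambda>t. - \<i> * of_real hbar * nth_derivative 1 f t)"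
      using uu by blast
    define r where "r t = 1 / (complex_of_real t - z)" for t
    have R_eq: "R (abs_l2 g) = abs_l2 (\<lambda>t. r t * g t)" if "square_integrable g" for g
      unfolding R r_def by (rule position_calc_resolvent[OF \<Phi> z that])
    have sr: "square_integrable (\<lambda>t. r t * g t)" if "square_integrable g" for g
      unfolding r_def
      by (rule square_integrable_bounded_mult[OF that borel_measurable_inverse_affine norm_inverse_affine_le[OF z]])
    have sf: "square_integrable f" "square_integrable (\<lambda>t. - \<i> * of_real hbar * nth_derivative 1 f t)"
      by (intro square_integrable_cmult D0_square_integrable D0_derivative_square_integrable f)+
    have rf: "(\<lambda>t. r t * f t) \<in> D0" unfolding r_def by (rule D0_resolvent(1)[OF f(1) z])
    have "R u' + (\<i> * of_real hbar) *\<^sub>C R (R u)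
        = abs_l2 (\<lambda>t. r t * (- \<i> * of_real hbar * nth_derivative 1 f t) + \<i> * of_real hbar * (r t * (r t * f t)))"
      unfolding f R_eq[OF sf(2)] R_eq[OF sf(1)] R_eq[OF sr[OF sf(1)]] abs_l2_cscale[OF sr[OF sr[OF sf(1)]]]
      by (rule abs_l2_add[OF sr[OF sf(2)] square_integrable_cmult[OF sr[OF sr[OF sf(1)]]]])
    also have "\<dots> = abs_l2 (\<lambda>t. - \<i> * of_real hbar * nth_derivative 1 (\<lambda>t. r t * f t) t)"
      unfolding r_def D0_resolvent(2)[OF f(1) z]
      by (rule arg_cong[of _ _ abs_l2]) (simp add: fun_eq_iff algebra_simps)
    finally show ?thesis using rf unfolding f(2) R_eq[OF sf(1)] by blast
  qed
  have lim: "(\<lambda>n. (R (fst (p n)), R (snd (p n)) + (\<i> * of_real hbar) *\<^sub>C R (R (fst (p n)))))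
      \<longlonglongrightarrow> (R w, R w' + (\<i> * of_real hbar) *\<^sub>C R (R w))"
    by (intro tendsto_Pair tendsto_add blinfun.tendsto tendsto_const
        bounded_linear.tendsto[OF bounded_linear_cscale] tendsto_fst[OF p(2), simplified] tendsto_snd[OF p(2), simplified])
  have "(R (fst (p n)), R (snd (p n)) + (\<i> * of_real hbar) *\<^sub>C R (R (fst (p n)))) \<in> ?S" for n
    by (rule S) (use p(1)[of n] in simp)
  then show ?thesis
    unfolding momentum_op_def closure_sequential
    by (intro exI[of _ "\<lambda>n. (R (fst (p n)), R (snd (p n)) + (\<i> * of_real hbar) *\<^sub>C R (R (fst (p n))))"]
        conjI allI lim)
qed

text \<open>No Gaussian integral is evaluated. Since \<open>f' = - t * f / s\<close>, integrating by
  parts \<open>f\<close> against \<open>t * f\<close> gives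
  \<open>\<bar>f\<bar>\<^sup>2 = 2 / s * \<bar>t * f\<bar>\<^sup>2\<close> in L2 norm, and
  \<open>s = \<bar>hbar\<bar>\<close> makes the momentum image as long as the position
  image.\<close>

lemma gauss_minimal_uncertainty:
  assumes hbar: "hbar \<noteq> 0"
  obtains v p q where "v \<noteq> 0" "(v, p) \<in> position_op" "(v, q) \<in> momentum_op hbar"
    "norm p = sqrt (\<bar>hbar\<bar> / 2) * norm v" "norm q = sqrt (\<bar>hbar\<bar> / 2) * norm v"
proof -
  define s where "s = \<bar>hbar\<bar>"
  have s: "s > 0" using hbar by (simp add: s_def)
  define f where "f = gauss s"
  define g where "g t = of_real t * f t" for t
  have span: "f \<in> gauss_span s" "g \<in> gauss_span s"
    unfolding f_def g_def by (intro gauss_span.intros)+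
  have f: "f \<in> D0" and g: "g \<in> D0" using gauss_span_D0[OF span(1) s] gauss_span_D0[OF span(2) s] by blast+
  have sq: "square_integrable f" "square_integrable g" using f g by (simp_all add: D0_square_integrable)
  have f': "nth_derivative 1 f = (\<lambda>t. - (1 / of_real s) * g t)"
    unfolding f_def g_def by (rule nth_derivative_1_eq) (use gauss_derivative s in simp)
  have g': "nth_derivative 1 g = (\<lambda>t. of_real t * nth_derivative 1 f t + f t)"
  proof (rule nth_derivative_1_eq)
    fix t
    show "(g has_vector_derivative of_real t * nth_derivative 1 f t + f t) (at t)"
      using has_vector_derivative_mult[OF has_vector_derivative_of_real[OF DERIV_ident] D0_derivative[OF f], of t]
      unfolding g_def by simp
  qed
  have real: "cnj (f t) = f t" for t by (simp add: f_def gauss_def)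
  have nf: "f t * f t = of_real ((norm (f t))\<^sup>2)" for t
    using complex_norm_square[of "f t"] by (simp add: real)
  have "(\<integral>t. complex_of_real ((norm (f t))\<^sup>2 - 2 / s * (norm (g t))\<^sup>2) \<partial>lborel)
      = (\<integral>t. f t * cnj (nth_derivative 1 g t) + nth_derivative 1 f t * cnj (g t) \<partial>lborel)"
  proof (intro Bochner_Integration.integral_cong refl)
    fix t
    have "f t * cnj (nth_derivative 1 g t) + nth_derivative 1 f t * cnj (g t)
        = f t * f t - 2 / of_real s * ((of_real t)\<^sup>2 * (f t * f t))"
      unfolding g' f' using s by (simp add: g_def real power2_eq_square algebra_simps)
    then show "complex_of_real ((norm (f t))\<^sup>2 - 2 / s * (norm (g t))\<^sup>2)
        = f t * cnj (nth_derivative 1 g t) + nth_derivative 1 f t * cnj (g t)"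
      unfolding nf by (simp add: g_def norm_mult power_mult_distrib)
  qed
  then have "complex_of_real (\<integral>t. (norm (f t))\<^sup>2 - 2 / s * (norm (g t))\<^sup>2 \<partial>lborel) = 0"
    unfolding D0_integration_by_parts[OF f g] by (simp only: integral_complex_of_real)
  then have "(\<integral>t. (norm (f t))\<^sup>2 - 2 / s * (norm (g t))\<^sup>2 \<partial>lborel) = 0"
    by (simp only: of_real_eq_0_iff)
  then have "(norm (abs_l2 f))\<^sup>2 = 2 / s * (norm (abs_l2 g))\<^sup>2"
    using sq by (simp add: norm_abs_l2 square_integrable_def)
  then have "(norm (abs_l2 g))\<^sup>2 = s / 2 * (norm (abs_l2 f))\<^sup>2" using s by simp
  then have "sqrt ((norm (abs_l2 g))\<^sup>2) = sqrt (s / 2 * (norm (abs_l2 f))\<^sup>2)" by (rule arg_cong)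
  then have norm_g: "norm (abs_l2 g) = sqrt (s / 2) * norm (abs_l2 f)"
    by (simp only: real_sqrt_mult real_sqrt_abs abs_norm_cancel)
  have "abs_l2 f \<noteq> 0"
  proof
    assume "abs_l2 f = 0"
    then have "abs_l2 f = abs_l2 (\<lambda>_. 0)" by (simp add: zero_l2.abs_eq)
    then have "AE t in lborel. f t = 0" using sq by (simp add: abs_l2_eq_iff square_integrable_0)
    then have "AE t::real in lborel. False" by (simp add: f_def gauss_def)
    then show False by (simp add: AE_iff_measurable[OF _ refl])
  qed
  moreover have "(abs_l2 f, abs_l2 g) \<in> position_op"
    unfolding position_op_def g_def using closure_subset f by fast
  moreover have "(abs_l2 f, abs_l2 (\<lambda>t. - \<i> * of_real hbar * nth_derivative 1 f t)) \<in> momentum_op hbar"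
    unfolding momentum_op_def using closure_subset f by fast
  moreover have "norm (abs_l2 (\<lambda>t. - \<i> * of_real hbar * nth_derivative 1 f t)) = norm (abs_l2 g)"
  proof -
    have "(\<lambda>t. - \<i> * of_real hbar * nth_derivative 1 f t) = (\<lambda>t. (\<i> * of_real hbar / of_real s) * g t)"
      unfolding f' by (simp add: fun_eq_iff)
    then have "abs_l2 (\<lambda>t. - \<i> * of_real hbar * nth_derivative 1 f t) = (\<i> * of_real hbar / of_real s) *\<^sub>C abs_l2 g"
      by (simp add: abs_l2_cscale sq)
    then show ?thesis using hbar by (simp add: norm_mult norm_divide s_def)
  qed
  ultimately show ?thesis using that norm_g unfolding s_def by metis
qed

lemma synthetic_spectrum_nonempty:
  assumes M: "M > 1" and \<eta>: "\<eta> > 0" and hbar: "hbar \<noteq> 0" "sqrt (\<bar>hbar\<bar> / 2) \<le> 3 * \<eta>\<^sup>2 / 8"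
    and \<Phi>1: "is_functional_calculus position_op \<Phi>1"
    and \<Phi>2: "is_functional_calculus (momentum_op hbar) \<Phi>2"
  shows "synthetic_spectrum M \<eta> position_op (momentum_op hbar) \<noteq> {}"
proof -
  interpret p: functional_calculus position_op \<Phi>1 by standard fact
  interpret q: functional_calculus "momentum_op hbar" \<Phi>2 by standard fact
  let ?\<theta> = "\<lambda>t. complex_of_real (theta 0 \<eta> t)"
  note \<theta> = C0_theta[OF \<eta>, of 0] and c = cutoff_quotient[OF \<eta>]
  obtain v x y where v: "v \<noteq> 0" "(v, x) \<in> position_op" "(v, y) \<in> momentum_op hbar"
    "norm x = sqrt (\<bar>hbar\<bar> / 2) * norm v" "norm y = sqrt (\<bar>hbar\<bar> / 2) * norm v"
    using gauss_minimal_uncertainty[OF hbar(1)] by metis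
  \<comment> \<open>The bound \<open>3 * \<eta>\<^sup>2 / 8\<close> is made for this: times
    \<open>4 / (3 * \<eta>)\<close> it is \<open>\<eta> / 2\<close>, so each cutoff uses half of the
    allowed loss \<eta>.\<close>
  have small: "4 / (3 * \<eta>) * (sqrt (\<bar>hbar\<bar> / 2) * norm v) \<le> \<eta> / 2 * norm v"
  proof -
    have "4 / (3 * \<eta>) * (sqrt (\<bar>hbar\<bar> / 2) * norm v) \<le> 4 / (3 * \<eta>) * (3 * \<eta>\<^sup>2 / 8 * norm v)"
      using \<eta> by (intro mult_left_mono mult_right_mono hbar) auto
    also have "\<dots> = \<eta> / 2 * norm v" using \<eta> by (simp add: power2_eq_square field_simps)
    finally show ?thesis .
  qed
  have "norm (v - \<Phi>1 ?\<theta> v) \<le> 4 / (3 * \<eta>) * norm x"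
    unfolding p.calc_cutoff_diff[OF v(2) \<theta> c(1,2)] by (rule p.calc_norm_le[OF c(1,3)])
  then have 1: "norm (v - \<Phi>1 ?\<theta> v) \<le> \<eta> / 2 * norm v" using small v(4) by simp
  have "norm (v - \<Phi>2 ?\<theta> v) \<le> 4 / (3 * \<eta>) * norm y"
    unfolding q.calc_cutoff_diff[OF v(3) \<theta> c(1,2)] by (rule q.calc_norm_le[OF c(1,3)])
  then have 2: "norm (v - \<Phi>2 ?\<theta> v) \<le> \<eta> / 2 * norm v" using small v(5) by simp
  have "norm (\<Phi>1 ?\<theta> (v - \<Phi>2 ?\<theta> v)) \<le> 1 * norm (v - \<Phi>2 ?\<theta> v)"
    by (rule p.calc_norm_le[OF \<theta>]) (simp add: theta_range[OF \<eta>])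
  \<comment> \<open>Telescoping over the two cutoffs; the first one, being a contraction, does not
    enlarge the error of the second.\<close>
  moreover have "v = (v - \<Phi>1 ?\<theta> v) + \<Phi>1 ?\<theta> (v - \<Phi>2 ?\<theta> v) + \<Phi>1 ?\<theta> (\<Phi>2 ?\<theta> v)"
    by (simp add: blinfun.diff_right)
  then have "norm v \<le> norm (v - \<Phi>1 ?\<theta> v) + norm (\<Phi>1 ?\<theta> (v - \<Phi>2 ?\<theta> v)) + norm (\<Phi>1 ?\<theta> (\<Phi>2 ?\<theta> v))"
    by (metis norm_triangle_ineq norm_triangle_le add_right_mono order_trans)
  ultimately have "(1 - \<eta>) * norm v \<le> norm (\<Phi>1 ?\<theta> (\<Phi>2 ?\<theta> v))"
    using 1 2 by (simp add: left_diff_distrib)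
  also have "\<dots> \<le> norm (\<Phi>1 ?\<theta> o\<^sub>L \<Phi>2 ?\<theta>) * norm v"
    using norm_blinfun[of "\<Phi>1 ?\<theta> o\<^sub>L \<Phi>2 ?\<theta>" v] by simp
  finally have "1 - \<eta> \<le> norm (\<Phi>1 ?\<theta> o\<^sub>L \<Phi>2 ?\<theta>)" using v(1) by simp
  then have "1 - \<eta> \<le> norm (Theta (0, 0) \<eta> position_op (momentum_op hbar))"
    by (simp add: Theta_def apply_fun_eq[OF \<Phi>1 \<theta>] apply_fun_eq[OF \<Phi>2 \<theta>])
  then have "(0, 0) \<in> synthetic_spectrum M \<eta> position_op (momentum_op hbar)"
    unfolding synthetic_spectrum_def using zero_in_D_grid[OF M \<eta>] \<eta>
    by (intro UnionI[of "cball (0, 0) \<eta>"] CollectI exI[of _ "(0, 0)"]) auto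
  then show ?thesis by blast
qed

text \<open>Localizing \<open>\<theta>\<^sub>2(S\<^sub>h) u\<close> with \<open>\<kappa>\<^sup>2 / ((t - l1)\<^sup>2 + \<kappa>\<^sup>2)\<close> in place of
  \<open>\<theta>\<^sub>1\<close> stays in the domain of the momentum, because this function is a product of two
  resolvents of the position, whose commutators with the momentum are known.\<close>

lemma approximate_joint_eigenvector:
  assumes \<kappa>: "\<kappa> > 0" and \<eta>: "\<eta> > 0" "\<eta> \<le> 1 / 4" "2 * \<eta> \<le> \<kappa>"
    and l: "\<bar>l1 - \<xi>1\<bar> \<le> \<eta>" "\<bar>l2 - \<xi>2\<bar> \<le> \<eta>"
    and \<Phi>1: "is_functional_calculus position_op \<Phi>1"
    and \<Phi>2: "is_functional_calculus (momentum_op hbar) \<Phi>2"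
    and hbar: "hbar \<noteq> 0"
    and Theta: "norm (Theta (\<xi>1, \<xi>2) \<eta> position_op (momentum_op hbar)) \<ge> 1 - \<eta>"
  shows "\<exists>v u w. norm v = 1 \<and>
    (v, u) \<in> position_op \<and> norm (u - l1 *\<^sub>R v) \<le> 2 * \<kappa> \<and>
    (v, w) \<in> momentum_op hbar \<and> norm (w - l2 *\<^sub>R v) \<le> 8 * \<eta> + 8 * \<bar>hbar\<bar> / \<kappa>"
proof -
  interpret p: functional_calculus position_op \<Phi>1 by standard fact
  interpret q: functional_calculus "momentum_op hbar" \<Phi>2 by standard fact
  interpret ep: essentially_selfadjoint position_op by (rule essentially_selfadjoint_position)
  interpret eq: essentially_selfadjoint "momentum_op hbar" by (rule essentially_selfadjoint_momentum[OF hbar])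
  define \<theta>1 where "\<theta>1 t = complex_of_real (theta \<xi>1 \<eta> t)" for t
  define \<theta>2 where "\<theta>2 t = complex_of_real (theta \<xi>2 \<eta> t)" for t
  have \<theta>: "\<theta>1 \<in> C0" "\<theta>2 \<in> C0"
    unfolding \<theta>1_def[abs_def] \<theta>2_def[abs_def] using C0_theta[OF \<eta>(1)] by blast+
  have "Theta (\<xi>1, \<xi>2) \<eta> position_op (momentum_op hbar) = \<Phi>1 \<theta>1 o\<^sub>L \<Phi>2 \<theta>2"
    using apply_fun_eq[OF \<Phi>1 \<theta>(1)] apply_fun_eq[OF \<Phi>2 \<theta>(2)]
    by (simp add: Theta_def \<theta>1_def[abs_def] \<theta>2_def[abs_def])
  \<comment> \<open>\<open>1 - \<eta> \<ge> 3 / 4\<close>; the slack above 1/2 yields an actual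
    vector \<open>x\<close> without assuming that the norm is attained.\<close>
  then have large: "\<not> norm (\<Phi>1 \<theta>1 o\<^sub>L \<Phi>2 \<theta>2) \<le> 1 / 2" using Theta \<eta>(2) by simp
  have "\<exists>x. norm (\<Phi>1 \<theta>1 (\<Phi>2 \<theta>2 x)) > 1 / 2 * norm x"
  proof (rule ccontr)
    assume "\<not> ?thesis"
    then have "norm ((\<Phi>1 \<theta>1 o\<^sub>L \<Phi>2 \<theta>2) x) \<le> 1 / 2 * norm x" for x
      by (simp only: blinfun_apply_blinfun_compose not_ex not_less)
    then have "norm (\<Phi>1 \<theta>1 o\<^sub>L \<Phi>2 \<theta>2) \<le> 1 / 2" by (intro norm_blinfun_bound) auto
    with large show False ..
  qed
  then obtain x where x: "norm (\<Phi>1 \<theta>1 (\<Phi>2 \<theta>2 x)) > 1 / 2 * norm x" by blast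
  then have "x \<noteq> 0" by auto
  define n where "n = norm x"
  have n: "n > 0" using \<open>x \<noteq> 0\<close> by (simp add: n_def)
  define w where "w = \<Phi>2 \<theta>2 x"
  define w' where "w' = \<Phi>2 (\<lambda>t. of_real t * \<theta>2 t) x"
  have t\<theta>2: "(\<lambda>t. of_real t * \<theta>2 t) \<in> C0"
    unfolding \<theta>2_def by (intro C0_theta_mult[OF \<eta>(1)] continuous_intros)
  have ww': "(w, w') \<in> momentum_op hbar"
    unfolding w_def w'_def by (rule q.calc_in_graph[OF \<theta>(2) t\<theta>2])
  have norm_w: "norm w \<le> n"
    using q.calc_norm_le[OF \<theta>(2), of 1 x] theta_range[OF \<eta>(1)] by (simp add: w_def n_def \<theta>2_def)
  have w'_w: "norm (w' - of_real l2 *\<^sub>C w) \<le> 2 * \<eta> * n"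
  proof -
    have "w' - of_real l2 *\<^sub>C w = \<Phi>2 (\<lambda>t. of_real t * \<theta>2 t - of_real l2 * \<theta>2 t) x"
      by (simp add: w_def w'_def q.calc_diff q.calc_scale \<theta> t\<theta>2 C0_scale)
    also have "norm \<dots> \<le> 2 * \<eta> * n"
      unfolding n_def
    proof (rule q.calc_norm_le[OF C0_diff[OF t\<theta>2 C0_scale[OF \<theta>(2)]]])
      fix t
      have "of_real t * \<theta>2 t - of_real l2 * \<theta>2 t = of_real ((t - l2) * theta \<xi>2 \<eta> t)"
        by (simp add: \<theta>2_def left_diff_distrib)
      moreover have "\<bar>(t - l2) * theta \<xi>2 \<eta> t\<bar> \<le> 2 * \<eta>"
      proof (cases "\<bar>t - \<xi>2\<bar> \<ge> \<eta>")
        case True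
        then show ?thesis using \<eta>(1) by (simp add: theta_def)
      next
        case False
        then have "\<bar>t - l2\<bar> \<le> 2 * \<eta>" using l by linarith
        then have "\<bar>t - l2\<bar> * \<bar>theta \<xi>2 \<eta> t\<bar> \<le> 2 * \<eta> * 1"
          using theta_range[OF \<eta>(1)] \<eta>(1) by (intro mult_mono) auto
        then show ?thesis by (simp add: abs_mult)
      qed
      ultimately show "norm (of_real t * \<theta>2 t - of_real l2 * \<theta>2 t) \<le> 2 * \<eta>" by (simp only: norm_of_real)
    qed
    finally show ?thesis .
  qed
  \<comment> \<open>Real part \<open>l1\<close> and imaginary part \<kappa> make the product of the
    resolvents at \<open>z\<close> and \<open>cnj z\<close> equal to
    \<open>1 / ((t - l1)\<^sup>2 + \<kappa>\<^sup>2)\<close>.\<close>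
  define z where "z = Complex l1 \<kappa>"
  have z: "Im z \<noteq> 0" "Im (cnj z) \<noteq> 0" using \<kappa> by (simp_all add: z_def)
  define r1 where "r1 t = 1 / (complex_of_real t - z)" for t
  define r2 where "r2 t = 1 / (complex_of_real t - cnj z)" for t
  have r: "r1 \<in> C0" "r2 \<in> C0" unfolding r1_def[abs_def] r2_def[abs_def] using C0_inverse_affine z by blast+
  have r12: "r1 t * r2 t = of_real (1 / ((t - l1)\<^sup>2 + \<kappa>\<^sup>2))" for t
  proof -
    have "(complex_of_real t - z) * (of_real t - cnj z) = of_real ((t - l1)\<^sup>2 + \<kappa>\<^sup>2)"
      by (simp add: z_def complex_eq_iff power2_eq_square algebra_simps)
    then show ?thesis by (simp add: r1_def r2_def)
  qed
  have pos: "(t - l1)\<^sup>2 + \<kappa>\<^sup>2 > 0" for t using \<kappa> by (simp add: add_nonneg_pos)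
  define R1 where "R1 = \<Phi>1 r1"
  define R2 where "R2 = \<Phi>1 r2"
  have norm_R: "norm (R1 v) \<le> norm v / \<kappa>" "norm (R2 v) \<le> norm v / \<kappa>" for v
    using p.calc_norm_le[OF r(1), of "1 / \<kappa>" v] p.calc_norm_le[OF r(2), of "1 / \<kappa>" v]
      norm_inverse_affine_le[OF z(1)] norm_inverse_affine_le[OF z(2)] \<kappa>
    by (simp_all add: R1_def R2_def r1_def r2_def z_def)
  have R_cscale: "R1 (c *\<^sub>C v) = c *\<^sub>C R1 v" "R2 (c *\<^sub>C v) = c *\<^sub>C R2 v" for c v
    by (simp_all add: R1_def R2_def p.calc_cscale r)
  define \<rho> where "\<rho> t = of_real (\<kappa>\<^sup>2) * (r1 t * r2 t)" for t
  have \<rho>: "\<rho> \<in> C0" unfolding \<rho>_def by (intro C0_scale C0_mult r)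
  have \<rho>_eq: "\<rho> t = of_real (\<kappa>\<^sup>2 / ((t - l1)\<^sup>2 + \<kappa>\<^sup>2))" for t by (simp add: \<rho>_def r12)
  define y where "y = \<Phi>1 \<rho> w"
  have y: "y = of_real (\<kappa>\<^sup>2) *\<^sub>C R1 (R2 w)"
    unfolding y_def \<rho>_def by (simp add: p.calc_scale p.calc_mult r C0_mult R1_def R2_def)
  have norm_y: "n / 4 \<le> norm y"
  proof -
    \<comment> \<open>The quotient of \<theta>1 by \<rho>. On the support of \<theta>1 one has
      \<open>\<bar>t - l1\<bar> \<le> 2 * \<eta> \<le> \<kappa>\<close>, so it is at most 2, and
      \<rho> loses at most half of what \<theta>1 retains of \<open>w\<close>.\<close>
    define \<phi> where "\<phi> t = of_real (((t - l1)\<^sup>2 + \<kappa>\<^sup>2) / \<kappa>\<^sup>2) * \<theta>1 t" for t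
    have \<phi>: "\<phi> \<in> C0" unfolding \<phi>_def \<theta>1_def using \<kappa> by (intro C0_theta_mult[OF \<eta>(1)] continuous_intros) auto
    have "norm (\<phi> t) \<le> 2" for t
    proof (cases "\<bar>t - \<xi>1\<bar> \<ge> \<eta>")
      case True
      then show ?thesis using \<eta>(1) by (simp add: \<phi>_def \<theta>1_def theta_def)
    next
      case False
      then have "\<bar>t - l1\<bar> \<le> \<kappa>" using l \<eta> by linarith
      then have "\<bar>t - l1\<bar>\<^sup>2 \<le> \<kappa>\<^sup>2" by (intro power_mono) auto
      then have "((t - l1)\<^sup>2 + \<kappa>\<^sup>2) / \<kappa>\<^sup>2 \<le> 2" using \<kappa> by (simp add: divide_le_eq)
      moreover have "0 \<le> ((t - l1)\<^sup>2 + \<kappa>\<^sup>2) / \<kappa>\<^sup>2" by simp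
      ultimately have "\<bar>((t - l1)\<^sup>2 + \<kappa>\<^sup>2) / \<kappa>\<^sup>2\<bar> * \<bar>theta \<xi>1 \<eta> t\<bar> \<le> 2 * 1"
        using theta_range[OF \<eta>(1), of \<xi>1 t] by (intro mult_mono) auto
      then show ?thesis by (simp only: \<phi>_def \<theta>1_def norm_mult norm_of_real)
    qed
    then have "norm (\<Phi>1 \<phi> y) \<le> 2 * norm y" by (rule p.calc_norm_le[OF \<phi>])
    moreover have "\<phi> t * \<rho> t = \<theta>1 t" for t
    proof -
      have "((t - l1)\<^sup>2 + \<kappa>\<^sup>2) / \<kappa>\<^sup>2 * (\<kappa>\<^sup>2 / ((t - l1)\<^sup>2 + \<kappa>\<^sup>2)) = 1" using pos[of t] \<kappa> by simp
      moreover have "\<phi> t * \<rho> t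
          = of_real (((t - l1)\<^sup>2 + \<kappa>\<^sup>2) / \<kappa>\<^sup>2 * (\<kappa>\<^sup>2 / ((t - l1)\<^sup>2 + \<kappa>\<^sup>2))) * \<theta>1 t"
        by (simp only: \<phi>_def \<rho>_eq of_real_mult mult_ac)
      ultimately show ?thesis by (simp only: of_real_1 mult_1)
    qed
    then have "\<Phi>1 \<phi> y = \<Phi>1 \<theta>1 w"
      using p.calc_mult[OF \<phi> \<rho>] by (simp add: y_def)
    ultimately show ?thesis using x by (simp add: w_def n_def)
  qed
  have t\<rho>: "(\<lambda>t. of_real t * \<rho> t) \<in> C0"
  proof -
    have "of_real t * \<rho> t = of_real (\<kappa>\<^sup>2) * (r2 t + z * (r1 t * r2 t))" for t
    proof -
      have "(of_real t - z) * r1 t = 1" using of_real_diff_neq_0[OF z(1), of t] by (simp add: r1_def)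
      then have "of_real t * r1 t = 1 + z * r1 t" by (simp add: algebra_simps)
      then have "of_real (\<kappa>\<^sup>2) * ((of_real t * r1 t) * r2 t) = of_real (\<kappa>\<^sup>2) * ((1 + z * r1 t) * r2 t)" by simp
      then show ?thesis by (simp only: \<rho>_def distrib_left distrib_right mult_1 mult_ac)
    qed
    then show ?thesis by (simp only: C0_scale C0_add C0_mult r)
  qed
  define y1 where "y1 = \<Phi>1 (\<lambda>t. of_real t * \<rho> t) w"
  have yy1: "(y, y1) \<in> position_op" unfolding y_def y1_def by (rule p.calc_in_graph[OF \<rho> t\<rho>])
  have y1_y: "norm (y1 - of_real l1 *\<^sub>C y) \<le> \<kappa> / 2 * n"
  proof -
    have "y1 - of_real l1 *\<^sub>C y = \<Phi>1 (\<lambda>t. of_real t * \<rho> t - of_real l1 * \<rho> t) w"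
      by (simp add: y_def y1_def p.calc_diff p.calc_scale \<rho> t\<rho> C0_scale)
    also have "norm \<dots> \<le> \<kappa> / 2 * norm w"
    proof (rule p.calc_norm_le[OF C0_diff[OF t\<rho> C0_scale[OF \<rho>]]])
      fix t
      have "of_real t * \<rho> t - of_real l1 * \<rho> t = of_real ((t - l1) * (\<kappa>\<^sup>2 / ((t - l1)\<^sup>2 + \<kappa>\<^sup>2)))"
        by (simp only: \<rho>_eq left_diff_distrib of_real_diff of_real_mult)
      moreover have "\<bar>(t - l1) * (\<kappa>\<^sup>2 / ((t - l1)\<^sup>2 + \<kappa>\<^sup>2))\<bar> \<le> \<kappa> / 2"
      proof -
        \<comment> \<open>The arithmetic-geometric mean inequality controls the slowly decaying tail
          of \<rho> after multiplication by \<open>t - l1\<close>.\<close>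
        have "2 * \<bar>t - l1\<bar> * \<kappa> \<le> (t - l1)\<^sup>2 + \<kappa>\<^sup>2"
          using sum_squares_bound[of "\<bar>t - l1\<bar>" \<kappa>] by simp
        then have "\<kappa> * (2 * \<bar>t - l1\<bar> * \<kappa>) \<le> \<kappa> * ((t - l1)\<^sup>2 + \<kappa>\<^sup>2)" using \<kappa> by (intro mult_left_mono) auto
        then have "\<bar>t - l1\<bar> * \<kappa>\<^sup>2 / ((t - l1)\<^sup>2 + \<kappa>\<^sup>2) \<le> \<kappa> / 2"
          using pos[of t] by (simp add: divide_le_eq power2_eq_square mult_ac)
        then show ?thesis using pos[of t] by (simp add: abs_mult abs_divide)
      qed
      ultimately show "norm (of_real t * \<rho> t - of_real l1 * \<rho> t) \<le> \<kappa> / 2" by (simp only: norm_of_real)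
    qed
    also have "\<dots> \<le> \<kappa> / 2 * n" using norm_w \<kappa> by (intro mult_left_mono) auto
    finally show ?thesis .
  qed
  define h where "h = \<i> * complex_of_real hbar"
  have norm_h: "norm h = \<bar>hbar\<bar>" by (simp add: h_def norm_mult)
  \<comment> \<open>The momentum of \<open>y\<close>, obtained by commuting it first past
    \<open>R2\<close> and then past \<open>R1\<close>.\<close>
  define y2 where "y2 = of_real (\<kappa>\<^sup>2) *\<^sub>C (R1 (R2 w' + h *\<^sub>C R2 (R2 w)) + h *\<^sub>C R1 (R1 (R2 w)))"
  have yy2: "(y, y2) \<in> momentum_op hbar"
    unfolding y y2_def h_def
    by (intro eq.graph_cscale momentum_position_resolvent_commutator[OF \<Phi>1 z(1)]
        momentum_position_resolvent_commutator[OF \<Phi>1 z(2)] ww')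
      (simp_all add: R1_def R2_def r1_def[abs_def] r2_def[abs_def])
  have y2_y: "norm (y2 - of_real l2 *\<^sub>C y) \<le> (2 * \<eta> + 2 * \<bar>hbar\<bar> / \<kappa>) * n"
  proof -
    have "y2 - of_real l2 *\<^sub>C y = of_real (\<kappa>\<^sup>2) *\<^sub>C
        (R1 (R2 (w' - of_real l2 *\<^sub>C w)) + h *\<^sub>C (R1 (R2 (R2 w)) + R1 (R1 (R2 w))))"
      unfolding y y2_def
      by (simp add: blinfun.add_right blinfun.diff_right R_cscale l2.scale_right_distrib
          l2.scale_right_diff_distrib l2.scale_left_commute algebra_simps)
    \<comment> \<open>The factor \<open>\<kappa>\<^sup>2\<close> cancels the bounds
      \<open>1 / \<kappa>\<close> of two resolvents; the third resolvent in each commutator term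
      leaves \<open>\<bar>hbar\<bar> / \<kappa>\<close>.\<close>
    also have "norm \<dots> \<le> \<kappa>\<^sup>2 * (2 * \<eta> * n / \<kappa> / \<kappa> + \<bar>hbar\<bar> * (n / \<kappa> / \<kappa> / \<kappa> + n / \<kappa> / \<kappa> / \<kappa>))"
    proof -
      have mono: "norm (R1 v) \<le> b / \<kappa>" "norm (R2 v) \<le> b / \<kappa>" if "norm v \<le> b" for v b
        using norm_R[of v] divide_right_mono[OF that, of \<kappa>] \<kappa> by linarith+
      have "norm (R1 (R2 (w' - of_real l2 *\<^sub>C w))) \<le> 2 * \<eta> * n / \<kappa> / \<kappa>" by (intro mono w'_w)
      moreover have "norm (R1 (R2 (R2 w))) \<le> n / \<kappa> / \<kappa> / \<kappa>" "norm (R1 (R1 (R2 w))) \<le> n / \<kappa> / \<kappa> / \<kappa>"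
        by (intro mono norm_w)+
      then have "norm (h *\<^sub>C (R1 (R2 (R2 w)) + R1 (R1 (R2 w)))) \<le> \<bar>hbar\<bar> * (n / \<kappa> / \<kappa> / \<kappa> + n / \<kappa> / \<kappa> / \<kappa>)"
        unfolding norm_cscale norm_h by (intro mult_left_mono norm_triangle_le add_mono) auto
      ultimately show ?thesis
        unfolding norm_cscale norm_of_real abs_power2
        by (intro mult_left_mono norm_triangle_le add_mono) auto
    qed
    also have "\<dots> = (2 * \<eta> + 2 * \<bar>hbar\<bar> / \<kappa>) * n"
      using \<kappa> by (simp add: power2_eq_square field_simps)
    finally show ?thesis .
  qed
  have y0: "norm y > 0" using norm_y n by linarith
  define a where "a = complex_of_real (1 / norm y)"
  \<comment> \<open>Normalizing \<open>y\<close> costs a factor 4, since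
    \<open>norm y \<ge> n / 4\<close>.\<close>
  have norm_a: "norm a * X \<le> 4 * c" if "X \<le> c * n" "c \<ge> 0" for X c :: real
  proof -
    have "X \<le> 4 * c * norm y" using that norm_y mult_left_mono[OF norm_y that(2)] by simp
    then show ?thesis using y0 by (simp add: a_def norm_divide divide_le_eq)
  qed
  have dist: "norm (a *\<^sub>C x' - l *\<^sub>R (a *\<^sub>C y)) = norm a * norm (x' - of_real l *\<^sub>C y)" for x' l
  proof -
    have "a *\<^sub>C x' - l *\<^sub>R (a *\<^sub>C y) = a *\<^sub>C (x' - of_real l *\<^sub>C y)"
      by (simp add: scaleR_cscale l2.scale_right_diff_distrib l2.scale_left_commute)
    then show ?thesis by simp
  qed
  show ?thesis
  proof (intro exI conjI)
    show "norm (a *\<^sub>C y) = 1" using y0 by (simp add: a_def norm_divide)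
    show "(a *\<^sub>C y, a *\<^sub>C y1) \<in> position_op" by (rule ep.graph_cscale[OF yy1])
    show "(a *\<^sub>C y, a *\<^sub>C y2) \<in> momentum_op hbar" by (rule eq.graph_cscale[OF yy2])
    show "norm (a *\<^sub>C y1 - l1 *\<^sub>R (a *\<^sub>C y)) \<le> 2 * \<kappa>"
      unfolding dist using norm_a[OF y1_y] \<kappa> by simp
    show "norm (a *\<^sub>C y2 - l2 *\<^sub>R (a *\<^sub>C y)) \<le> 8 * \<eta> + 8 * \<bar>hbar\<bar> / \<kappa>"
      unfolding dist using norm_a[OF y2_y] \<kappa> \<eta>(1) by simp
  qed
qed

theorem theorem7p2:
  fixes \<epsilon> M :: real
  assumes "\<epsilon> > 0" and "M > 1"
  shows "\<exists>\<eta>>0. \<exists>\<delta>>0. \<forall>hbar::real. hbar \<noteq> 0 \<and> \<bar>hbar\<bar> < \<delta> \<longrightarrow>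
           synthetic_spectrum M \<eta> position_op (momentum_op hbar) \<noteq> {} \<and>
           (\<forall>l1 l2. (l1, l2) \<in> synthetic_spectrum M \<eta> position_op (momentum_op hbar) \<longrightarrow>
              (\<exists>v u w. norm v = 1 \<and>
                 (v, u) \<in> position_op \<and> norm (u - l1 *\<^sub>R v) < \<epsilon> \<and>
                 (v, w) \<in> momentum_op hbar \<and> norm (w - l2 *\<^sub>R v) < \<epsilon>))"
proof -
  \<comment> \<open>The width used later is \<open>\<kappa> = \<epsilon> / 4\<close>, so the
    position error is at most \<open>\<epsilon> / 2\<close>. Then \<open>\<epsilon> / 32\<close>
    gives \<open>8 * \<eta> \<le> \<epsilon> / 4\<close> as well as
    \<open>2 * \<eta> \<le> \<kappa>\<close>.\<close>
  define \<eta> where "\<eta> = min (1 / 4) (\<epsilon> / 32)"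
  \<comment> \<open>The first bound is the smallness of \<open>sqrt (\<bar>hbar\<bar> / 2)\<close>
    required for nonemptiness. The second makes the commutator term
    \<open>8 * \<bar>hbar\<bar> / (\<epsilon> / 4)\<close> less than
    \<open>\<epsilon> / 2\<close>.\<close>
  define \<delta> where "\<delta> = min (2 * (3 * \<eta>\<^sup>2 / 8)\<^sup>2) (\<epsilon>\<^sup>2 / 64)"
  have \<eta>: "\<eta> > 0" "\<eta> \<le> 1 / 4" "\<eta> \<le> \<epsilon> / 32" using assms by (simp_all add: \<eta>_def)
  have \<delta>: "\<delta> > 0" using assms \<eta>(1) by (simp add: \<delta>_def)
  obtain \<Phi>1 where \<Phi>1: "is_functional_calculus position_op \<Phi>1"
    using essentially_selfadjoint.functional_calculus_exists[OF essentially_selfadjoint_position] by blast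
  have "synthetic_spectrum M \<eta> position_op (momentum_op hbar) \<noteq> {} \<and>
           (\<forall>l1 l2. (l1, l2) \<in> synthetic_spectrum M \<eta> position_op (momentum_op hbar) \<longrightarrow>
              (\<exists>v u w. norm v = 1 \<and>
                 (v, u) \<in> position_op \<and> norm (u - l1 *\<^sub>R v) < \<epsilon> \<and>
                 (v, w) \<in> momentum_op hbar \<and> norm (w - l2 *\<^sub>R v) < \<epsilon>))"
    if hbar: "hbar \<noteq> 0" "\<bar>hbar\<bar> < \<delta>" for hbar :: real
  proof (intro conjI allI impI)
    obtain \<Phi>2 where \<Phi>2: "is_functional_calculus (momentum_op hbar) \<Phi>2"
      using essentially_selfadjoint.functional_calculus_exists[OF essentially_selfadjoint_momentum[OF hbar(1)]] by blast
    have "\<bar>hbar\<bar> / 2 \<le> (3 * \<eta>\<^sup>2 / 8)\<^sup>2" using hbar by (simp add: \<delta>_def)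
    then have "sqrt (\<bar>hbar\<bar> / 2) \<le> 3 * \<eta>\<^sup>2 / 8" by (intro real_le_lsqrt) auto
    then show "synthetic_spectrum M \<eta> position_op (momentum_op hbar) \<noteq> {}"
      by (rule synthetic_spectrum_nonempty[OF assms(2) \<eta>(1) hbar(1) _ \<Phi>1 \<Phi>2])
    fix l1 l2 assume "(l1, l2) \<in> synthetic_spectrum M \<eta> position_op (momentum_op hbar)"
    then obtain \<xi>1 \<xi>2 where \<xi>: "(l1, l2) \<in> cball (\<xi>1, \<xi>2) \<eta>"
        "norm (Theta (\<xi>1, \<xi>2) \<eta> position_op (momentum_op hbar)) \<ge> 1 - \<eta>"
      unfolding synthetic_spectrum_def by auto
    have "\<bar>l1 - \<xi>1\<bar> \<le> \<eta>" "\<bar>l2 - \<xi>2\<bar> \<le> \<eta>"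
      using \<xi>(1) order_trans[OF dist_fst_le] order_trans[OF dist_snd_le]
      by (fastforce simp: mem_cball dist_real_def abs_minus_commute)+
    from approximate_joint_eigenvector[OF _ \<eta>(1,2) _ this \<Phi>1 \<Phi>2 hbar(1) \<xi>(2), of "\<epsilon> / 4"]
    obtain v u w where v: "norm v = 1" "(v, u) \<in> position_op" "norm (u - l1 *\<^sub>R v) \<le> 2 * (\<epsilon> / 4)"
      "(v, w) \<in> momentum_op hbar" "norm (w - l2 *\<^sub>R v) \<le> 8 * \<eta> + 8 * \<bar>hbar\<bar> / (\<epsilon> / 4)"
      using assms(1) \<eta>(3) by auto
    have "\<bar>hbar\<bar> < \<epsilon>\<^sup>2 / 64" using hbar(2) by (simp add: \<delta>_def)
    then have "8 * \<bar>hbar\<bar> / (\<epsilon> / 4) < \<epsilon> / 2"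
      using assms(1) by (simp add: power2_eq_square field_simps)
    then have "norm (w - l2 *\<^sub>R v) < \<epsilon>" "norm (u - l1 *\<^sub>R v) < \<epsilon>" using v(3,5) \<eta>(3) assms(1) by linarith+
    with v show "\<exists>v u w. norm v = 1 \<and>
                 (v, u) \<in> position_op \<and> norm (u - l1 *\<^sub>R v) < \<epsilon> \<and>
                 (v, w) \<in> momentum_op hbar \<and> norm (w - l2 *\<^sub>R v) < \<epsilon>" by blast
  qed
  with \<eta>(1) \<delta> show ?thesis by blast
qed

end
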